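(* Let $m>0$ and let $A=\mathrm{Op}(\sigma_A)$ with $\sigma_A\in S^m_{1,0}(\mathbb{Z}^n\times\mathbb{T}^n)$. Assume that there exist $C_0>0$ and $d_0>0$ such that for all $x\in\mathbb{T}^n$ and all $k\in\mathbb{Z}^n$ with $|k|\ge d_0$ (where in particular $\sigma_A(k,x)$ is real) $$-\sigma_A(k,x)\ge C_0|k|^m.$$ Let $T>0$. Then for every $u_0\in\ell^2(\mathbb{Z}^n)$ and $f\in L^1([0,T],\ell^2(\mathbb{Z}^n))$ the equation $$\frac{\partial u}{\partial t}-Au=f,\quad t\in[0,T],\qquad u(0)=u_0,$$ has a unique solution $u\in C([0,T],\ell^2(\mathbb{Z}^n))$. Moreover, there exists $C>0$, independent of $u_0$, $f$ and $t$, such that for all $t\in[0,T]$ $$\|u(t)\|_{\ell^2(\mathbb{Z}^n)}^2\le C\Big(\|u_0\|_{\ell^2(\mathbb{Z}^n)}^2+\int_0^t\|f(\tau)\|_{\ell^2(\mathbb{Z}^n)}^2\,d\tau\Big).$$ (The right-hand side may be $+\infty$.)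
   Context: $\mathbb{T}^n=\mathbb{R}^n/\mathbb{Z}^n$ with normalised Lebesgue measure. For rapidly decreasing $f$ on $\mathbb{Z}^n$, $\widehat f(x)=\sum_{k\in\mathbb{Z}^n}e^{-2\pi i k\cdot x}f(k)$ and $\mathrm{Op}(\sigma)f(k)=\int_{\mathbb{T}^n}e^{2\pi i k\cdot x}\sigma(k,x)\widehat f(x)\,dx$. For $s\in\mathbb{R}$, $\ell^2_s(\mathbb{Z}^n)$ is the space of $f:\mathbb{Z}^n\to\mathbb{C}$ with $\|f\|_{\ell^2_s}=\big(\sum_{k}(1+|k|)^{2s}|f(k)|^2\big)^{1/2}<\infty$. An operator with symbol in $S^m_{1,0}$ extends to a bounded operator $\ell^2(\mathbb{Z}^n)\to\ell^2_{-m}(\mathbb{Z}^n)$. A solution $u\in C([0,T],\ell^2(\mathbb{Z}^n))$ of the equation means $u(t)=u_0+\int_0^t(Au(s)+f(s))\,ds$ in $\ell^2_{-m}(\mathbb{Z}^n)$ for all $t\in[0,T]$. $\Delta^\alpha=\Delta_1^{\alpha_1}\cdots\Delta_n^{\alpha_n}$ with $\Delta_j\tau(k)=\tau(k+v_j)-\tau(k)$, $v_j$ the $j$-th standard unit vector; $D_x^{(\alpha)}=D_{x_1}^{(\alpha_1)}\cdots D_{x_n}^{(\alpha_n)}$ with $D_{x_j}^{(0)}=I$, $D_{x_j}^{(\ell)}=\prod_{r=0}^{\ell-1}\big(\frac{1}{2\pi i}\frac{\partial}{\partial x_j}-r\big)$ for $\ell\ge1$. $S^m_{1,0}(\mathbb{Z}^n\times\mathbb{T}^n)$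 consists of $\sigma:\mathbb{Z}^n\times\mathbb{T}^n\to\mathbb{C}$ with $\sigma(k,\cdot)\in C^\infty(\mathbb{T}^n)$ for all $k$ and, for all multi-indices $\alpha,\beta$, $|D_x^{(\beta)}\Delta_k^\alpha\sigma(k,x)|\le C_{\alpha,\beta}(1+|k|)^{m-|\alpha|}$ for all $(k,x)$. *)

theory Defs
  imports "HOL-Analysis.Analysis"
begin

section \<open>The Hilbert space of square-summable families\<close>

text \<open>
  A type for \<open>\<ell>\<^sup>2\<close> over an index type, so that Bochner integrability, continuity and norms
  of \<open>\<ell>\<^sup>2\<close>-valued functions are the library notions.
\<close>

typedef 'a ell2 = "{f :: 'a \<Rightarrow> complex. (\<lambda>k. (cmod (f k))\<^sup>2) summable_on UNIV}"
  morphisms ell2_apply Abs_ell2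
  by (rule exI[of _ "\<lambda>_. 0"]) simp

lemma ell2_eqI: "(\<And>k. ell2_apply u k = ell2_apply v k) \<Longrightarrow> u = v"
  by (metis ell2_apply_inject ext)

lemma ell2_summable: "(\<lambda>k. (cmod (ell2_apply u k))\<^sup>2) summable_on UNIV"
  using ell2_apply[of u] by simp

lemma square_summable_add:
  fixes f g :: "'a \<Rightarrow> complex"
  assumes "(\<lambda>k. (cmod (f k))\<^sup>2) summable_on UNIV" "(\<lambda>k. (cmod (g k))\<^sup>2) summable_on UNIV"
  shows "(\<lambda>k. (cmod (f k + g k))\<^sup>2) summable_on UNIV"
proof (rule summable_on_comparison_test)
  show "(\<lambda>k. 2 * ((cmod (f k))\<^sup>2 + (cmod (g k))\<^sup>2)) summable_on UNIV"
    by (intro summable_on_cmult_right summable_on_add assms)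
next
  fix k
  have "(cmod (f k + g k))\<^sup>2 \<le> (cmod (f k) + cmod (g k))\<^sup>2"
    by (intro power_mono norm_triangle_ineq) simp
  also have "\<dots> \<le> 2 * ((cmod (f k))\<^sup>2 + (cmod (g k))\<^sup>2)"
    using zero_le_power2[of "cmod (f k) - cmod (g k)"] by (simp add: power2_sum power2_diff)
  finally show "(cmod (f k + g k))\<^sup>2 \<le> 2 * ((cmod (f k))\<^sup>2 + (cmod (g k))\<^sup>2)" .
qed simp

lemma square_summable_cmult:
  fixes f :: "'a \<Rightarrow> complex"
  assumes "(\<lambda>k. (cmod (f k))\<^sup>2) summable_on UNIV"
  shows "(\<lambda>k. (cmod (c * f k))\<^sup>2) summable_on UNIV"
  using summable_on_cmult_right[OF assms, of "(cmod c)\<^sup>2"]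
  by (simp add: norm_mult power_mult_distrib)

instantiation ell2 :: (type) real_vector
begin

definition "0 = Abs_ell2 (\<lambda>_. 0)"
definition "u + v = Abs_ell2 (\<lambda>k. ell2_apply u k + ell2_apply v k)"
definition "- u = Abs_ell2 (\<lambda>k. - ell2_apply u k)"
definition "u - v = Abs_ell2 (\<lambda>k. ell2_apply u k - ell2_apply v k)"
definition "r *\<^sub>R u = Abs_ell2 (\<lambda>k. r *\<^sub>R ell2_apply u k)"

lemma ell2_apply_zero [simp]: "ell2_apply 0 k = 0"
  unfolding zero_ell2_def by (subst Abs_ell2_inverse) auto

lemma ell2_apply_add [simp]: "ell2_apply (u + v) k = ell2_apply u k + ell2_apply v k"
  unfolding plus_ell2_def
  by (subst Abs_ell2_inverse) (auto intro: square_summable_add ell2_summable)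

lemma ell2_apply_uminus [simp]: "ell2_apply (- u) k = - ell2_apply u k"
  unfolding uminus_ell2_def by (subst Abs_ell2_inverse) (auto intro: ell2_summable)

lemma ell2_apply_diff [simp]: "ell2_apply (u - v) k = ell2_apply u k - ell2_apply v k"
  unfolding minus_ell2_def
  by (subst Abs_ell2_inverse)
     (use square_summable_add[of "ell2_apply u" "\<lambda>k. - ell2_apply v k"] ell2_summable in auto)

lemma ell2_apply_scaleR [simp]: "ell2_apply (r *\<^sub>R u) k = r *\<^sub>R ell2_apply u k"
  unfolding scaleR_ell2_def
  by (subst Abs_ell2_inverse)
     (use square_summable_cmult[of "ell2_apply u" "of_real r"] ell2_summable
       in \<open>auto simp: scaleR_conv_of_real\<close>)

instance
  by standard (auto intro!: ell2_eqI simp: algebra_simps)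

end

lemma ell2_inner_summable:
  "(\<lambda>k. inner (ell2_apply u k) (ell2_apply v k)) summable_on UNIV"
proof -
  have "(\<lambda>k. norm (inner (ell2_apply u k) (ell2_apply v k))) summable_on UNIV"
  proof (rule summable_on_comparison_test)
    show "(\<lambda>k. (cmod (ell2_apply u k))\<^sup>2 + (cmod (ell2_apply v k))\<^sup>2) summable_on UNIV"
      by (intro summable_on_add ell2_summable)
    fix k
    have "norm (inner (ell2_apply u k) (ell2_apply v k))
        \<le> cmod (ell2_apply u k) * cmod (ell2_apply v k)"
      by (simp add: Cauchy_Schwarz_ineq2)
    also have "\<dots> \<le> (cmod (ell2_apply u k))\<^sup>2 + (cmod (ell2_apply v k))\<^sup>2"
    proof -
      have "x * y \<le> x\<^sup>2 + y\<^sup>2" for x y :: real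
        using zero_le_power2[of "x - y"] zero_le_power2[of x] zero_le_power2[of y]
        unfolding power2_diff by linarith
      then show ?thesis .
    qed
    finally show "norm (inner (ell2_apply u k) (ell2_apply v k))
        \<le> (cmod (ell2_apply u k))\<^sup>2 + (cmod (ell2_apply v k))\<^sup>2" .
  qed simp
  then show ?thesis
    by (rule abs_summable_summable)
qed

instantiation ell2 :: (type) real_inner
begin

text \<open>The real part of the usual Hermitian inner product; it induces the usual norm.\<close>

definition "inner u v = (\<Sum>\<^sub>\<infinity>k. inner (ell2_apply u k) (ell2_apply v k))"
definition "norm u = sqrt (inner u u)" for u :: "'a ell2"
definition "sgn u = u /\<^sub>R norm u" for u :: "'a ell2"
definition "dist u v = norm (u - v)" for u v :: "'a ell2"
definition "uniformity = (INF e\<in>{0 <..}. principal {(u, v :: 'a ell2). dist u v < e})"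
definition "open S = (\<forall>u\<in>S. \<forall>\<^sub>F (u', v) in uniformity. u' = u \<longrightarrow> v \<in> S)" for S :: "'a ell2 set"

instance
proof
  fix u v w :: "'a ell2" and r :: real and S :: "'a ell2 set"
  show "inner u v = inner v u"
    by (simp add: inner_ell2_def inner_commute)
  show "inner (u + v) w = inner u w + inner v w"
    by (simp add: inner_ell2_def inner_add_left infsum_add ell2_inner_summable)
  show "inner (r *\<^sub>R u) v = r * inner u v"
    by (simp only: inner_ell2_def ell2_apply_scaleR inner_scaleR_left infsum_cmult_right')
  show "0 \<le> inner u u"
    by (simp add: inner_ell2_def infsum_nonneg)
  show "(inner u u = 0) = (u = 0)"
  proof
    assume "inner u u = 0"
    then have "inner (ell2_apply u k) (ell2_apply u k) = 0" for k
      using nonneg_infsum_le_0D[OF _ ell2_inner_summable[of u u], where x = k]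
      by (simp add: inner_ell2_def)
    then show "u = 0"
      by (intro ell2_eqI) simp
  qed (simp add: inner_ell2_def)
qed (simp_all add: norm_ell2_def sgn_ell2_def dist_ell2_def uniformity_ell2_def open_ell2_def)

end

lemma norm_ell2_eq: "norm u = sqrt (\<Sum>\<^sub>\<infinity>k. (cmod (ell2_apply u k))\<^sup>2)"
  by (simp add: norm_ell2_def inner_ell2_def power2_norm_eq_inner)

lemma norm_ell2_power2: "(norm u)\<^sup>2 = (\<Sum>\<^sub>\<infinity>k. (cmod (ell2_apply u k))\<^sup>2)"
  by (simp add: norm_ell2_eq infsum_nonneg)

lemma ell2_finite_sum_le: "finite F \<Longrightarrow> (\<Sum>k\<in>F. (cmod (ell2_apply u k))\<^sup>2) \<le> (norm u)\<^sup>2"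
  unfolding norm_ell2_power2 by (intro finite_sum_le_infsum ell2_summable) auto

lemma ell2_apply_norm_le: "cmod (ell2_apply u k) \<le> norm u"
  using ell2_finite_sum_le[of "{k}" u] by (simp add: power2_le_iff_abs_le)

lemma square_summableI:
  fixes f :: "'a \<Rightarrow> complex"
  assumes "\<And>F. finite F \<Longrightarrow> (\<Sum>k\<in>F. (cmod (f k))\<^sup>2) \<le> B"
  shows "(\<lambda>k. (cmod (f k))\<^sup>2) summable_on UNIV"
  using assms by (intro nonneg_bdd_above_summable_on bdd_aboveI[of _ B]) auto

lemma norm_ell2_leI:
  assumes "\<And>F. finite F \<Longrightarrow> (\<Sum>k\<in>F. (cmod (ell2_apply u k))\<^sup>2) \<le> B\<^sup>2" "0 \<le> B"
  shows "norm u \<le> B"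
proof -
  have "(norm u)\<^sup>2 \<le> B\<^sup>2"
    unfolding norm_ell2_power2 by (intro infsum_le_finite_sums ell2_summable assms(1))
  then show ?thesis
    using assms(2) by (rule power2_le_imp_le)
qed

instance ell2 :: (type) banach
proof
  fix X :: "nat \<Rightarrow> 'a ell2"
  assume C: "Cauchy X"
  have "Cauchy (\<lambda>n. ell2_apply (X n) k)" for k
  proof (rule metric_CauchyI)
    fix e :: real assume "e > 0"
    with C obtain M where M: "\<And>m n. m \<ge> M \<Longrightarrow> n \<ge> M \<Longrightarrow> dist (X m) (X n) < e"
      by (meson metric_CauchyD)
    have "dist (ell2_apply (X m) k) (ell2_apply (X n) k) < e" if "m \<ge> M" "n \<ge> M" for m n
      using M[OF that] ell2_apply_norm_le[of "X m - X n" k] by (simp add: dist_norm)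
    then show "\<exists>M. \<forall>m\<ge>M. \<forall>n\<ge>M. dist (ell2_apply (X m) k) (ell2_apply (X n) k) < e"
      by blast
  qed
  then have "\<forall>k. \<exists>l. (\<lambda>n. ell2_apply (X n) k) \<longlonglongrightarrow> l"
    by (simp add: Cauchy_convergent_iff convergent_def)
  then obtain L where L: "\<And>k. (\<lambda>n. ell2_apply (X n) k) \<longlonglongrightarrow> L k"
    by metis
  have bound: "\<exists>M. \<forall>n\<ge>M. \<forall>F. finite F \<longrightarrow> (\<Sum>k\<in>F. (cmod (ell2_apply (X n) k - L k))\<^sup>2) \<le> e\<^sup>2"
    if "e > 0" for e :: real
  proof -
    from C that obtain M where M: "\<And>m n. m \<ge> M \<Longrightarrow> n \<ge> M \<Longrightarrow> dist (X m) (X n) < e"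
      by (meson metric_CauchyD)
    have "(\<Sum>k\<in>F. (cmod (ell2_apply (X n) k - L k))\<^sup>2) \<le> e\<^sup>2" if "n \<ge> M" "finite F" for n F
    proof (rule Lim_bounded)
      show "(\<lambda>m. \<Sum>k\<in>F. (cmod (ell2_apply (X n) k - ell2_apply (X m) k))\<^sup>2)
          \<longlonglongrightarrow> (\<Sum>k\<in>F. (cmod (ell2_apply (X n) k - L k))\<^sup>2)"
        by (intro tendsto_intros L)
      show "\<forall>m\<ge>M. (\<Sum>k\<in>F. (cmod (ell2_apply (X n) k - ell2_apply (X m) k))\<^sup>2) \<le> e\<^sup>2"
      proof (intro allI impI)
        fix m assume "M \<le> m"
        have "(\<Sum>k\<in>F. (cmod (ell2_apply (X n) k - ell2_apply (X m) k))\<^sup>2) \<le> (norm (X n - X m))\<^sup>2"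
          using ell2_finite_sum_le[OF \<open>finite F\<close>, of "X n - X m"] by simp
        also have "\<dots> \<le> e\<^sup>2"
          using M[OF \<open>n \<ge> M\<close> \<open>M \<le> m\<close>] by (intro power_mono) (auto simp: dist_norm)
        finally show "(\<Sum>k\<in>F. (cmod (ell2_apply (X n) k - ell2_apply (X m) k))\<^sup>2) \<le> e\<^sup>2" .
      qed
    qed
    then show ?thesis by blast
  qed
  have "(\<lambda>k. (cmod (L k))\<^sup>2) summable_on UNIV"
  proof -
    from bound[of 1] obtain M where
      M: "\<And>F. finite F \<Longrightarrow> (\<Sum>k\<in>F. (cmod (ell2_apply (X M) k - L k))\<^sup>2) \<le> 1\<^sup>2"
      by (metis order_refl zero_less_one)
    have "(\<lambda>k. (cmod (ell2_apply (X M) k - L k))\<^sup>2) summable_on UNIV"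
      using M by (rule square_summableI)
    then have "(\<lambda>k. (cmod (L k - ell2_apply (X M) k))\<^sup>2) summable_on UNIV"
      by (simp add: norm_minus_commute)
    from square_summable_add[OF this ell2_summable[of "X M"]] show ?thesis
      by simp
  qed
  then have app: "ell2_apply (Abs_ell2 L) = L"
    by (simp add: Abs_ell2_inverse)
  have "X \<longlonglongrightarrow> Abs_ell2 L"
  proof (rule metric_LIMSEQ_I)
    fix e :: real assume "e > 0"
    with bound[of "e / 2"] obtain M where
      M: "\<And>n F. n \<ge> M \<Longrightarrow> finite F \<Longrightarrow> (\<Sum>k\<in>F. (cmod (ell2_apply (X n) k - L k))\<^sup>2) \<le> (e / 2)\<^sup>2"
      by auto
    have "norm (X n - Abs_ell2 L) \<le> e / 2" if "n \<ge> M" for n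
      using M[OF that] \<open>e > 0\<close> by (intro norm_ell2_leI) (auto simp: app)
    then show "\<exists>M. \<forall>n\<ge>M. dist (X n) (Abs_ell2 L) < e"
      using \<open>e > 0\<close> by (intro exI[of _ M]) (force simp: dist_norm)
  qed
  then show "convergent X"
    by (auto simp: convergent_def)
qed

lemma ell2_countable_dense:
  "\<exists>D :: 'a::countable ell2 set. countable D \<and> (\<forall>u. \<forall>e>0. \<exists>w\<in>D. dist w u < e)"
proof -
  obtain Q :: "complex set" where Q: "countable Q" "\<And>X. open X \<Longrightarrow> X \<noteq> {} \<Longrightarrow> \<exists>q\<in>Q. q \<in> X"
    using countable_dense_setE by blast
  have Qne: "Q \<noteq> {}"
    using Q(2)[of UNIV] by auto
  define q where "q = from_nat_into Q"
  have q: "\<exists>n. dist (q n) z < e" if "e > 0" for z e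
    using Q(2)[of "ball z e"] that from_nat_into_surj[OF Q(1)]
    by (force simp: q_def dist_commute)
  define G where "G = (\<lambda>xs :: ('a \<times> nat) list. Abs_ell2
      (\<lambda>k. case map_of xs k of None \<Rightarrow> 0 | Some n \<Rightarrow> q n))"
  have G: "ell2_apply (G xs) k = (case map_of xs k of None \<Rightarrow> 0 | Some n \<Rightarrow> q n)" for xs k
  proof -
    have "(\<lambda>k. (cmod (case map_of xs k of None \<Rightarrow> 0 | Some n \<Rightarrow> q n))\<^sup>2) summable_on UNIV"
    proof (rule finite_nonzero_values_imp_summable_on)
      show "finite {k \<in> UNIV. (cmod (case map_of xs k of None \<Rightarrow> 0 | Some n \<Rightarrow> q n))\<^sup>2 \<noteq> 0}"
        by (rule finite_subset[OF _ finite_dom_map_of[of xs]]) (auto split: option.splits)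
    qed
    then show ?thesis
      unfolding G_def by (simp add: Abs_ell2_inverse)
  qed
  have "\<exists>w\<in>range G. dist w u < e" if e: "e > 0" for u e
  proof -
    define d where "d = e / 2"
    have d: "d > 0" using e by (simp add: d_def)
    obtain F where F: "finite F"
      "dist (\<Sum>k\<in>F. (cmod (ell2_apply u k))\<^sup>2) ((norm u)\<^sup>2) \<le> d\<^sup>2 / 2"
      using infsum_finite_approximation[OF ell2_summable[of u], of "d\<^sup>2 / 2"] d
      unfolding norm_ell2_power2 by auto
    define c where "c = d / sqrt (2 * (real (card F) + 1))"
    have c: "c > 0" using d by (simp add: c_def)
    have "\<forall>k. \<exists>n. dist (q n) (ell2_apply u k) < c"
      by (intro allI q c)
    then obtain n where n: "\<And>k. dist (q (n k)) (ell2_apply u k) < c"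
      by metis
    obtain ys where ys: "set ys = F" using finite_list[OF F(1)] by auto
    define w where "w = G (map (\<lambda>k. (k, n k)) ys)"
    have w: "ell2_apply w k = (if k \<in> F then q (n k) else 0)" for k
      by (simp add: w_def G ys map_of_map_restrict restrict_map_def)
    have "norm (w - u) \<le> d"
    proof (rule norm_ell2_leI)
      fix H :: "'a set" assume H: "finite H"
      have "(\<Sum>k\<in>H. (cmod (ell2_apply (w - u) k))\<^sup>2) \<le> (\<Sum>k\<in>F \<union> (H - F). (cmod (ell2_apply (w - u) k))\<^sup>2)"
        using F(1) H by (intro sum_mono2) auto
      also have "\<dots> = (\<Sum>k\<in>F. (cmod (ell2_apply (w - u) k))\<^sup>2) + (\<Sum>k\<in>H - F. (cmod (ell2_apply (w - u) k))\<^sup>2)"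
        using F(1) H by (intro sum.union_disjoint) auto
      also have "(\<Sum>k\<in>F. (cmod (ell2_apply (w - u) k))\<^sup>2) \<le> (\<Sum>k\<in>F. c\<^sup>2)"
        using n by (intro sum_mono power_mono) (auto simp: w dist_norm less_imp_le)
      also have "(\<Sum>k\<in>F. c\<^sup>2) \<le> d\<^sup>2 / 2"
        by (simp add: c_def power_divide field_simps)
      also have "(\<Sum>k\<in>H - F. (cmod (ell2_apply (w - u) k))\<^sup>2) = (\<Sum>k\<in>H - F. (cmod (ell2_apply u k))\<^sup>2)"
        by (intro sum.cong) (auto simp: w)
      also have "\<dots> \<le> d\<^sup>2 / 2"
      proof -
        have "(\<Sum>k\<in>F. (cmod (ell2_apply u k))\<^sup>2) + (\<Sum>k\<in>H - F. (cmod (ell2_apply u k))\<^sup>2)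
            = (\<Sum>k\<in>F \<union> (H - F). (cmod (ell2_apply u k))\<^sup>2)"
          using F(1) H by (subst sum.union_disjoint) auto
        also have "\<dots> \<le> (norm u)\<^sup>2"
          using F(1) H by (intro ell2_finite_sum_le) auto
        finally show ?thesis
          using F(2) unfolding dist_real_def by linarith
      qed
      finally show "(\<Sum>k\<in>H. (cmod (ell2_apply (w - u) k))\<^sup>2) \<le> d\<^sup>2"
        by simp
    qed (use d in simp)
    then have "dist w u < e"
      using e by (simp add: dist_norm d_def)
    then show ?thesis
      by (auto simp: w_def)
  qed
  then show ?thesis
    by (intro exI[of _ "range G"]) auto
qed

instance ell2 :: (countable) second_countable_topology
proof
  obtain D :: "'a ell2 set" where D: "countable D" "\<And>u e. e > 0 \<Longrightarrow> \<exists>w\<in>D. dist w u < e"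
    using ell2_countable_dense by metis
  define B where "B = (\<lambda>(w, n). ball w (inverse (real (Suc n)))) ` (D \<times> (UNIV :: nat set))"
  have "topological_basis B"
  proof (rule topological_basisI)
    fix S :: "'a ell2 set" and u assume "open S" "u \<in> S"
    then obtain e where e: "e > 0" "ball u e \<subseteq> S"
      by (meson open_contains_ball)
    then obtain n where n: "inverse (real (Suc n)) < e / 2"
      using reals_Archimedean[of "e / 2"] by auto
    obtain w where w: "w \<in> D" "dist w u < inverse (real (Suc n))"
      using D(2)[of "inverse (real (Suc n))" u] by auto
    have "ball w (inverse (real (Suc n))) \<subseteq> ball u e"
    proof
      fix v assume "v \<in> ball w (inverse (real (Suc n)))"
      then show "v \<in> ball u e"
        using w(2) n dist_triangle[of u v w] by (simp add: dist_commute)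
    qed
    with e w show "\<exists>B'\<in>B. u \<in> B' \<and> B' \<subseteq> S"
      unfolding B_def by (intro bexI[of _ "ball w (inverse (real (Suc n)))"]) auto
  qed (auto simp: B_def)
  moreover have "countable B"
    unfolding B_def using D(1) by (intro countable_image countable_SIGMA) auto
  ultimately show "\<exists>B :: 'a ell2 set set. countable B \<and> open = generate_topology B"
    by (blast intro: topological_basis_imp_subbasis)
qed


section \<open>Lattice, torus and weighted spaces\<close>

text \<open>
  Functions on the torus are functions on \<open>\<real>\<^sup>n\<close> that are periodic with respect to \<open>\<int>\<^sup>n\<close>, and the
  normalised measure is Lebesgue measure on the unit cube.
\<close>

definition real_vec :: "int^'n::finite \<Rightarrow> real^'n" where
  "real_vec k = (\<chi> i. real_of_int (k $ i))"

definition torus_periodic :: "(real^'n::finite \<Rightarrow> complex) \<Rightarrow> bool" where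
  "torus_periodic g \<longleftrightarrow> (\<forall>x l. g (x + real_vec l) = g x)"

definition torus_integral :: "(real^'n::finite \<Rightarrow> complex) \<Rightarrow> complex" where
  "torus_integral g = (LINT x : cbox 0 1 | lborel. g x)"

definition weighted_ell2 :: "real \<Rightarrow> (int^'n::finite \<Rightarrow> complex) set" where
  "weighted_ell2 s =
    {f. (\<lambda>k. (1 + norm (real_vec k)) powr (2 * s) * (cmod (f k))\<^sup>2) summable_on UNIV}"

definition weighted_norm :: "real \<Rightarrow> (int^'n::finite \<Rightarrow> complex) \<Rightarrow> real" where
  "weighted_norm s f = sqrt (\<Sum>\<^sub>\<infinity>k. (1 + norm (real_vec k)) powr (2 * s) * (cmod (f k))\<^sup>2)"

text \<open>
  Multiplication by \<open>(1 + |k|)\<^sup>s\<close> is an isometric isomorphism from the weighted space of order \<open>s\<close>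
  onto the unweighted one. Bochner integration in the weighted space is the library notion,
  transported along it.
\<close>

definition weight_iso :: "real \<Rightarrow> (int^'n::finite \<Rightarrow> complex) \<Rightarrow> (int^'n) ell2" where
  "weight_iso s f = Abs_ell2 (\<lambda>k. complex_of_real ((1 + norm (real_vec k)) powr s) * f k)"

definition weight_iso_inv :: "real \<Rightarrow> (int^'n::finite) ell2 \<Rightarrow> int^'n \<Rightarrow> complex" where
  "weight_iso_inv s u = (\<lambda>k. complex_of_real ((1 + norm (real_vec k)) powr (- s)) * ell2_apply u k)"

definition weighted_integrable :: "real \<Rightarrow> real set \<Rightarrow> (real \<Rightarrow> int^'n::finite \<Rightarrow> complex) \<Rightarrow> bool" where
  "weighted_integrable s I g \<longleftrightarrow>
    (\<forall>t\<in>I. g t \<in> weighted_ell2 s) \<and> set_integrable lebesgue I (\<lambda>t. weight_iso s (g t))"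

definition weighted_integral ::
    "real \<Rightarrow> real set \<Rightarrow> (real \<Rightarrow> int^'n::finite \<Rightarrow> complex) \<Rightarrow> int^'n \<Rightarrow> complex" where
  "weighted_integral s I g = weight_iso_inv s (LINT t : I | lebesgue. weight_iso s (g t))"

lemma weighted_ell2_zero: "weighted_ell2 0 = range (ell2_apply :: (int^'n::finite) ell2 \<Rightarrow> _)"
proof -
  have "1 + norm (real_vec k) \<noteq> 0" for k :: "int^'n"
    using norm_ge_zero[of "real_vec k"] by linarith
  then show ?thesis
    by (simp add: weighted_ell2_def type_definition.Rep_range[OF type_definition_ell2])
qed

lemma weighted_norm_zero: "weighted_norm 0 (ell2_apply u) = norm u"
  for u :: "(int^'n::finite) ell2"
proof -
  have "1 + norm (real_vec k) \<noteq> 0" for k :: "int^'n"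
    using norm_ge_zero[of "real_vec k"] by linarith
  then show ?thesis
    by (simp add: weighted_norm_def norm_ell2_eq)
qed

lemma weight_iso:
  assumes "f \<in> weighted_ell2 s"
  shows "ell2_apply (weight_iso s f) k = complex_of_real ((1 + norm (real_vec k)) powr s) * f k"
    and "norm (weight_iso s f) = weighted_norm s f"
    and "weight_iso_inv s (weight_iso s f) = f"
proof -
  have pos: "1 + norm (real_vec k) > 0" for k :: "int^'a"
    using norm_ge_zero[of "real_vec k"] by linarith
  have sq: "(cmod (complex_of_real ((1 + norm (real_vec k)) powr s) * f k))\<^sup>2
      = (1 + norm (real_vec k)) powr (2 * s) * (cmod (f k))\<^sup>2" for k
    by (simp add: norm_mult power_mult_distrib power2_eq_square flip: powr_add)
  show app: "ell2_apply (weight_iso s f) k = complex_of_real ((1 + norm (real_vec k)) powr s) * f k"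
    for k
    unfolding weight_iso_def using assms
    by (subst Abs_ell2_inverse) (auto simp: sq weighted_ell2_def)
  show "norm (weight_iso s f) = weighted_norm s f"
    by (simp only: norm_ell2_eq app sq weighted_norm_def)
  show "weight_iso_inv s (weight_iso s f) = f"
  proof
    fix k
    have "weight_iso_inv s (weight_iso s f) k
        = complex_of_real ((1 + norm (real_vec k)) powr (- s) * (1 + norm (real_vec k)) powr s) * f k"
      by (simp add: weight_iso_inv_def app)
    also have "(1 + norm (real_vec k)) powr (- s) * (1 + norm (real_vec k)) powr s = 1"
      using pos[of k] by (simp flip: powr_add)
    finally show "weight_iso_inv s (weight_iso s f) k = f k"
      by simp
  qed
qed


section \<open>Symbol classes\<close>

text \<open>
  A fixed enumeration of the coordinates, giving the order in which the products over
  \<open>j = 1, \<dots>, n\<close> are composed. The factors commute on the functions in question.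
\<close>

definition coords :: "'n::finite list" where
  "coords = (SOME js. distinct js \<and> set js = UNIV)"

definition multi_order :: "('n::finite \<Rightarrow> nat) \<Rightarrow> nat" where
  "multi_order \<alpha> = (\<Sum>j\<in>UNIV. \<alpha> j)"

definition difference :: "'n::finite \<Rightarrow> (int^'n \<Rightarrow> complex) \<Rightarrow> int^'n \<Rightarrow> complex" where
  "difference j \<tau> = (\<lambda>k. \<tau> (k + axis j 1) - \<tau> k)"

definition multi_difference ::
    "('n::finite \<Rightarrow> nat) \<Rightarrow> (int^'n \<Rightarrow> complex) \<Rightarrow> int^'n \<Rightarrow> complex" where
  "multi_difference \<alpha> = foldr (\<lambda>j. difference j ^^ \<alpha> j) coords"

definition partial_deriv :: "'n::finite \<Rightarrow> (real^'n \<Rightarrow> complex) \<Rightarrow> real^'n \<Rightarrow> complex" where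
  "partial_deriv j g = (\<lambda>x. vector_derivative (\<lambda>h. g (x + h *\<^sub>R axis j 1)) (at 0))"

primrec C_times :: "nat \<Rightarrow> (real^'n::finite \<Rightarrow> complex) \<Rightarrow> bool" where
  "C_times 0 g \<longleftrightarrow> continuous_on UNIV g"
| "C_times (Suc N) g \<longleftrightarrow>
    (\<forall>x. g differentiable at x) \<and> (\<forall>j. C_times N (partial_deriv j g))"

definition C_infinity :: "(real^'n::finite \<Rightarrow> complex) \<Rightarrow> bool" where
  "C_infinity g \<longleftrightarrow> (\<forall>N. C_times N g)"

primrec falling_deriv :: "'n::finite \<Rightarrow> nat \<Rightarrow> (real^'n \<Rightarrow> complex) \<Rightarrow> real^'n \<Rightarrow> complex" where
  "falling_deriv j 0 g = g"
| "falling_deriv j (Suc l) g =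
    (\<lambda>x. 1 / (2 * of_real pi * \<i>) * partial_deriv j (falling_deriv j l g) x
        - of_nat l * falling_deriv j l g x)"

definition multi_falling_deriv ::
    "('n::finite \<Rightarrow> nat) \<Rightarrow> (real^'n \<Rightarrow> complex) \<Rightarrow> real^'n \<Rightarrow> complex" where
  "multi_falling_deriv \<beta> = foldr (\<lambda>j. falling_deriv j (\<beta> j)) coords"

definition symbol_class :: "real \<Rightarrow> (int^'n::finite \<Rightarrow> real^'n \<Rightarrow> complex) set" where
  "symbol_class m = {\<sigma>.
    (\<forall>k. torus_periodic (\<sigma> k) \<and> C_infinity (\<sigma> k)) \<and>
    (\<forall>\<alpha> \<beta>. \<exists>C. \<forall>k x.
      cmod (multi_falling_deriv \<beta> (\<lambda>y. multi_difference \<alpha> (\<lambda>l. \<sigma> l y) k) x)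
        \<le> C * (1 + norm (real_vec k)) powr (m - real (multi_order \<alpha>)))}"


section \<open>Operators and the evolution equation\<close>

definition rapidly_decreasing :: "(int^'n::finite \<Rightarrow> complex) \<Rightarrow> bool" where
  "rapidly_decreasing f \<longleftrightarrow> (\<forall>N::nat. \<exists>C. \<forall>k. (1 + norm (real_vec k)) ^ N * cmod (f k) \<le> C)"

definition fourier :: "(int^'n::finite \<Rightarrow> complex) \<Rightarrow> real^'n \<Rightarrow> complex" where
  "fourier f x = (\<Sum>\<^sub>\<infinity>k. exp (- 2 * of_real pi * \<i> * of_real (real_vec k \<bullet> x)) * f k)"

definition Op :: "(int^'n::finite \<Rightarrow> real^'n \<Rightarrow> complex) \<Rightarrow> (int^'n \<Rightarrow> complex) \<Rightarrow> int^'n \<Rightarrow> complex" where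
  "Op \<sigma> f k = torus_integral
    (\<lambda>x. exp (2 * of_real pi * \<i> * of_real (real_vec k \<bullet> x)) * \<sigma> k x * fourier f x)"

definition bounded_extension ::
    "real \<Rightarrow> ((int^'n::finite \<Rightarrow> complex) \<Rightarrow> int^'n \<Rightarrow> complex) \<Rightarrow>
     ((int^'n) ell2 \<Rightarrow> int^'n \<Rightarrow> complex) \<Rightarrow> bool" where
  "bounded_extension m P A \<longleftrightarrow>
    (\<forall>u v w a b. (\<forall>k. ell2_apply w k = a * ell2_apply u k + b * ell2_apply v k) \<longrightarrow>
      (\<forall>k. A w k = a * A u k + b * A v k)) \<and>
    (\<exists>B. \<forall>u. A u \<in> weighted_ell2 (- m) \<and> weighted_norm (- m) (A u) \<le> B * norm u) \<and>
    (\<forall>u. rapidly_decreasing (ell2_apply u) \<longrightarrow> A u = P (ell2_apply u))"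

text \<open>
  The bounded extension of \<open>Op \<sigma>\<close> from \<open>\<ell>\<^sup>2\<close> to the weighted space of order \<open>-m\<close>. For a symbol of
  order \<open>m\<close> it exists, and it is unique because rapidly decreasing functions are dense in \<open>\<ell>\<^sup>2\<close>.
\<close>

definition Op_ext :: "real \<Rightarrow> (int^'n::finite \<Rightarrow> real^'n \<Rightarrow> complex) \<Rightarrow>
    (int^'n) ell2 \<Rightarrow> int^'n \<Rightarrow> complex" where
  "Op_ext m \<sigma> = (THE A. bounded_extension m (Op \<sigma>) A)"

definition is_solution ::
    "real \<Rightarrow> ((int^'n::finite) ell2 \<Rightarrow> int^'n \<Rightarrow> complex) \<Rightarrow> real \<Rightarrow> (int^'n) ell2 \<Rightarrow>
     (real \<Rightarrow> (int^'n) ell2) \<Rightarrow> (real \<Rightarrow> (int^'n) ell2) \<Rightarrow> bool" where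
  "is_solution m A T u0 f u \<longleftrightarrow>
    continuous_on {0..T} u \<and>
    (\<forall>t\<in>{0..T}.
      weighted_integrable (- m) {0..t} (\<lambda>s k. A (u s) k + ell2_apply (f s) k) \<and>
      (\<forall>k. ell2_apply (u t) k = ell2_apply u0 k
        + weighted_integral (- m) {0..t} (\<lambda>s k. A (u s) k + ell2_apply (f s) k) k))"

end

theory Submission
  imports Defs
begin

text \<open>
  On the Fourier side the operator is the matrix \<open>K k l = a k (k - l)\<close>, where \<open>a k j\<close> is the \<open>j\<close>-th
  Fourier coefficient of \<open>\<sigma> k\<close>; it decays rapidly off the diagonal, and differences of \<open>a\<close> in \<open>k\<close> gain
  one order. Garding's inequality is obtained without symbolic calculus: average \<open>K\<close> over translates
  of a large but fixed box \<open>Q\<close>, freezing \<open>\<sigma>\<close> at the corner \<open>p\<close> of each box. Each frozen form is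
  \<open>\<integral> \<sigma> p x |v\<^sub>p x|\<^sup>2 dx\<close>, hence bounded by ellipticity. The averaging costs a small multiple of the
  principal order, because few pairs \<open>(k, l)\<close> with \<open>k - l\<close> fixed are separated by a large box, plus terms of
  order \<open>m - 1\<close>. Conjugation with \<open>(1 + |k|)\<^sup>s\<close> also only costs order \<open>m - 1\<close>, so the inequality holds
  in every weighted space.

  The truncations of \<open>K\<close> to finite cubes inherit the inequality for free, which gives energy estimates for the
  Galerkin approximations in all weighted spaces. For truncated data the bounds of order \<open>m + 1\<close> make the
  approximations a Cauchy sequence, and the \<open>L\<^sup>1\<close> energy estimate extends this to general data.
  Conversely, a projected solution solves the Galerkin system up to an error that vanishes in the weighted
  space of order \<open>- m - 1\<close>; so every solution is the limit of the same approximations, which yields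
  uniqueness and the estimate.
\<close>


section \<open>Weights on the lattice and Schur's test\<close>

text \<open>The energy method does not apply to a solution directly: for \<open>u\<close> in
  \<open>ell2\<close> the image \<open>A u\<close> lies only in the weighted space of order
  \<open>- m\<close>, so its pairing with \<open>u\<close> is undefined. Estimates are therefore
  made for finite systems, with constants independent of the finite set. Several weight orders occur
  because the tail outside a cube gains a factor \<open>1 / N\<close> only against one extra order
  of the weight. Existence obtains this order from finitely supported data, which lie in order
  \<open>m + 1\<close>; for uniqueness the solution has no order to spare, and the error is measured
  in order \<open>- m - 1\<close> instead. In the Garding inequality an error of order
  \<open>m - 1\<close> is harmless, being dominated by a small multiple of the coercive term of
  order \<open>m\<close> plus a constant. An error of order \<open>m\<close> itself has to be beaten
  by the ellipticity constant. This forces the long boxes: the proportion of a box lost under a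
  shift is a small multiple of the length of the shift, and the rapid off-diagonal decay pays for
  that length.\<close>

definition wt :: "int^'n::finite \<Rightarrow> real" where
  "wt k = 1 + norm (real_vec k)"

abbreviation nsq :: "'k set \<Rightarrow> ('k \<Rightarrow> complex) \<Rightarrow> real" where
  "nsq F v \<equiv> \<Sum>k\<in>F. (cmod (v k))\<^sup>2"

text \<open>The squared weighted norm of order \<open>s\<close>, restricted to \<open>F\<close>.
  Working with finite sums keeps the estimates free of summability questions.\<close>

abbreviation wsq :: "real \<Rightarrow> (int^'n::finite) set \<Rightarrow> (int^'n \<Rightarrow> complex) \<Rightarrow> real" where
  "wsq s F v \<equiv> \<Sum>k\<in>F. wt k powr (2 * s) * (cmod (v k))\<^sup>2"

lemma wt_ge_1: "1 \<le> wt k"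
  by (simp add: wt_def)

lemma wt_pos [simp]: "0 < wt k" "0 \<le> wt k" "wt k \<noteq> 0"
  using wt_ge_1[of k] by linarith+

lemma real_vec_simps:
  "real_vec (k + l) = real_vec k + real_vec l"
  "real_vec (k - l) = real_vec k - real_vec l"
  "real_vec (- k) = - real_vec k"
  "real_vec 0 = 0"
  by (simp_all add: real_vec_def vec_eq_iff)

lemma wt_minus [simp]: "wt (- k) = wt k"
  by (simp add: wt_def real_vec_simps)

lemma wt_diff_commute: "wt (k - l) = wt (l - k)"
  by (metis minus_diff_eq wt_minus)

lemma wt_add_le: "wt (k + l) \<le> wt k * wt l"
proof -
  have "wt (k + l) \<le> 1 + (norm (real_vec k) + norm (real_vec l))"
    by (simp add: wt_def real_vec_simps norm_triangle_ineq)
  also have "\<dots> \<le> wt k * wt l"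
    by (simp add: wt_def algebra_simps)
  finally show ?thesis .
qed

lemma wt_le_mult: "wt k \<le> wt l * wt (k - l)"
  using wt_add_le[of l "k - l"] by simp

lemma abs_wt_diff_le: "\<bar>wt k - wt l\<bar> \<le> wt (k - l)"
  using norm_triangle_ineq3[of "real_vec k" "real_vec l"]
  by (simp add: wt_def real_vec_simps)

text \<open>The two comparisons of \<open>a\<close> with \<open>b\<close> serve one sign of
  \<open>s\<close> each, so both signs can be treated at once.\<close>

lemma powr_compare:
  fixes a b c s :: real
  assumes "a > 0" "b > 0" "c > 0" "a \<le> b * c" "b \<le> a * c"
  shows "a powr s \<le> b powr s * c powr \<bar>s\<bar>"
proof (cases "s \<ge> 0")
  case True
  then have "a powr s \<le> (b * c) powr s"
    using assms by (intro powr_mono2) auto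
  then show ?thesis
    using assms True by (simp add: powr_mult)
next
  case False
  then have "(a * c) powr s \<le> b powr s"
    using assms by (intro powr_mono2') auto
  then have "a powr s * (c powr s * c powr (- s)) \<le> b powr s * c powr (- s)"
    using assms by (simp add: powr_mult mult_right_mono flip: mult.assoc)
  then show ?thesis
    using False assms by (simp flip: powr_add)
qed

text \<open>Peetre's inequality: the weight is submultiplicative, and moving a power from
  \<open>k\<close> to \<open>l\<close> costs a power of the weight of \<open>k - l\<close>
  only.\<close>

lemma wt_powr_le: "wt k powr s \<le> wt l powr s * wt (k - l) powr \<bar>s\<bar>"
  by (rule powr_compare) (use wt_le_mult[of k l] wt_le_mult[of l k] in \<open>auto simp: wt_diff_commute\<close>)

lemma wt_powr_mono: "s \<le> t \<Longrightarrow> wt k powr s \<le> wt k powr t"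
  by (rule powr_mono) (auto simp: wt_ge_1)

text \<open>By the mean value theorem the difference gains one order, since the intermediate weight
  is comparable to \<open>wt k\<close> up to powers of \<open>wt (k - l)\<close>. This is why
  conjugation with powers of the weight costs only order \<open>m - 1\<close>.\<close>

lemma wt_powr_diff_le:
  "\<bar>wt l powr s - wt k powr s\<bar> \<le> \<bar>s\<bar> * wt k powr (s - 1) * wt (k - l) powr (\<bar>s\<bar> + 2)"
proof -
  \<comment> \<open>\<open>A\<close> is whichever of the end points \<open>a\<close> and
    \<open>b\<close> equals \<open>wt k\<close>, so that one statement serves both orders of
    \<open>wt k\<close> and \<open>wt l\<close>.\<close>
  have *: "\<bar>b powr s - a powr s\<bar> \<le> \<bar>s\<bar> * c * (A powr (s - 1) * c powr \<bar>s - 1\<bar>)"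
    if "0 < a" "a < b" "b - a \<le> c" "a \<le> A" "A \<le> b" "A \<le> a * c" "b \<le> A * c" "c \<ge> 1"
    for a b c A :: real
  proof -
    have "\<exists>z>a. z < b \<and> b powr s - a powr s = (b - a) * (s * z powr (s - 1))"
      using that by (intro MVT2) (auto intro!: has_real_derivative_powr)
    then obtain z where z: "a < z" "z < b" "b powr s - a powr s = (b - a) * (s * z powr (s - 1))"
      by blast
    have "A \<le> z * c"
      using that z by (intro order_trans[OF \<open>A \<le> a * c\<close>]) auto
    then have "z powr (s - 1) \<le> A powr (s - 1) * c powr \<bar>s - 1\<bar>"
      using that z by (intro powr_compare) auto
    moreover have "\<bar>(b - a) * (s * z powr (s - 1))\<bar> = \<bar>s\<bar> * (b - a) * z powr (s - 1)"
      using that by (simp add: abs_mult)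
    ultimately show ?thesis
      unfolding z(3) using that by (auto intro!: mult_mono)
  qed
  have "\<bar>wt l powr s - wt k powr s\<bar>
      \<le> \<bar>s\<bar> * wt (k - l) * (wt k powr (s - 1) * wt (k - l) powr \<bar>s - 1\<bar>)"
  proof (cases "wt k" "wt l" rule: linorder_cases)
    case less
    then show ?thesis
      using abs_wt_diff_le[of l k] wt_le_mult[of l k] wt_ge_1
      by (intro *) (auto simp: wt_diff_commute[of l k])
  next
    case equal
    then show ?thesis by simp
  next
    case greater
    have "\<bar>wt k powr s - wt l powr s\<bar>
        \<le> \<bar>s\<bar> * wt (k - l) * (wt k powr (s - 1) * wt (k - l) powr \<bar>s - 1\<bar>)"
      using greater abs_wt_diff_le[of k l] wt_le_mult[of k l] wt_ge_1
      by (intro *) auto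
    then show ?thesis
      by (simp add: abs_minus_commute)
  qed
  also have "\<dots> = \<bar>s\<bar> * wt k powr (s - 1) * wt (k - l) powr (\<bar>s - 1\<bar> + 1)"
    by (simp add: powr_add)
  also have "\<dots> \<le> \<bar>s\<bar> * wt k powr (s - 1) * wt (k - l) powr (\<bar>s\<bar> + 2)"
    by (intro mult_left_mono wt_powr_mono) auto
  finally show ?thesis .
qed

section \<open>Lattice sums of powers of the weight\<close>

definition summ_exp :: "'n::finite itself \<Rightarrow> real" where
  "summ_exp _ = 2 * real CARD('n)"

lemma int_inverse_square_sum_le:
  "\<exists>B\<ge>0. \<forall>R. (\<Sum>x\<in>{- int R..int R}. 1 / (1 + \<bar>real_of_int x\<bar>)\<^sup>2) \<le> B"
proof -
  have s: "summable (\<lambda>n. 1 / (1 + real n)\<^sup>2)"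
    using inverse_squares_sums by (simp add: sums_iff add.commute)
  define B where "B = (\<Sum>n. 1 / (1 + real n)\<^sup>2)"
  have fin: "(\<Sum>n\<in>{..R}. 1 / (1 + real n)\<^sup>2) \<le> B" for R
    unfolding B_def by (intro sum_le_suminf s) auto
  have "(\<Sum>x\<in>{- int R..int R}. 1 / (1 + \<bar>real_of_int x\<bar>)\<^sup>2) \<le> B + B" for R
  proof -
    have "{- int R..int R} = int ` {..R} \<union> (\<lambda>n. - int n) ` {..R}"
    proof (intro equalityI subsetI)
      fix x assume "x \<in> {- int R..int R}"
      then have "x = int (nat x) \<and> nat x \<le> R \<or> x = - int (nat (- x)) \<and> nat (- x) \<le> R"
        by auto
      then show "x \<in> int ` {..R} \<union> (\<lambda>n. - int n) ` {..R}" by blast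
    qed auto
    then have "(\<Sum>x\<in>{- int R..int R}. 1 / (1 + \<bar>real_of_int x\<bar>)\<^sup>2)
        \<le> (\<Sum>x\<in>int ` {..R}. 1 / (1 + \<bar>real_of_int x\<bar>)\<^sup>2)
          + (\<Sum>x\<in>(\<lambda>n. - int n) ` {..R}. 1 / (1 + \<bar>real_of_int x\<bar>)\<^sup>2)"
      by (simp add: sum_Un sum_nonneg)
    also have "\<dots> = (\<Sum>n\<in>{..R}. 1 / (1 + real n)\<^sup>2) + (\<Sum>n\<in>{..R}. 1 / (1 + real n)\<^sup>2)"
      by (subst (1 2) sum.reindex) (auto simp: inj_on_def)
    also have "\<dots> \<le> B + B"
      by (intro add_mono fin)
    finally show ?thesis .
  qed
  moreover have "B \<ge> 0"
    unfolding B_def by (intro suminf_nonneg s) auto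
  ultimately show ?thesis
    by (intro exI[of _ "B + B"]) auto
qed

lemma abs_component_le_wt: "1 + \<bar>real_of_int (j $ i)\<bar> \<le> wt j"
  using component_le_norm_cart[of "real_vec j" i] by (simp add: wt_def real_vec_def)

text \<open>Each \<open>1 + |j $ i|\<close> is at most \<open>wt j\<close>, so the power
  \<open>2 * CARD('n)\<close> of the weight allots exponent 2 to every coordinate. The sum over a
  cube containing \<open>F\<close> then factorises into convergent one-dimensional sums.\<close>

lemma wt_powr_sum_bounded:
  "\<exists>S>0. \<forall>F :: (int^'n::finite) set. finite F \<longrightarrow> (\<Sum>j\<in>F. wt j powr (- summ_exp TYPE('n))) \<le> S"
proof -
  obtain B where B: "B \<ge> 0" "\<And>R. (\<Sum>x\<in>{- int R..int R}. 1 / (1 + \<bar>real_of_int x\<bar>)\<^sup>2) \<le> B"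
    using int_inverse_square_sum_le by blast
  have "(\<Sum>j\<in>F. wt j powr (- summ_exp TYPE('n))) \<le> B ^ CARD('n)"
    if F: "finite F" for F :: "(int^'n) set"
  proof -
    define h where "h = (\<lambda>x::int. 1 / (1 + \<bar>real_of_int x\<bar>)\<^sup>2)"
    have h0: "h x \<ge> 0" for x by (simp add: h_def)
    have le: "wt j powr (- summ_exp TYPE('n)) \<le> (\<Prod>i\<in>UNIV. h (j $ i))" for j :: "int^'n"
    proof -
      have "wt j powr (- summ_exp TYPE('n)) = 1 / wt j powr (real (2 * CARD('n)))"
        by (simp add: summ_exp_def powr_minus_divide)
      also have "\<dots> = (\<Prod>i\<in>(UNIV::'n set). 1 / (wt j)\<^sup>2)"
        by (subst powr_realpow) (auto simp: power_mult power_divide)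
      also have "\<dots> \<le> (\<Prod>i\<in>UNIV. h (j $ i))"
        unfolding h_def using abs_component_le_wt[of j]
        by (intro prod_mono conjI divide_left_mono power_mono) auto
      finally show ?thesis .
    qed
    define R where "R = Max (insert 0 ((\<lambda>(j, i). nat \<bar>j $ i\<bar>) ` (F \<times> UNIV)))"
    have R: "j $ i \<in> {- int R..int R}" if "j \<in> F" for j i
    proof -
      have "nat \<bar>j $ i\<bar> \<le> R"
        unfolding R_def using that F by (intro Max_ge) (auto intro!: image_eqI[of _ _ "(j, i)"])
      then show ?thesis by auto
    qed
    have "(\<Sum>j\<in>F. wt j powr (- summ_exp TYPE('n))) \<le> (\<Sum>j\<in>F. \<Prod>i\<in>UNIV. h (j $ i))"
      by (intro sum_mono le)
    also have "\<dots> = (\<Sum>g\<in>vec_nth ` F. \<Prod>i\<in>UNIV. h (g i))"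
      by (subst sum.reindex) (auto simp: inj_on_def vec_nth_inject)
    also have "\<dots> \<le> (\<Sum>g\<in>PiE (UNIV :: 'n set) (\<lambda>_. {- int R..int R}). \<Prod>i\<in>UNIV. h (g i))"
    proof (rule sum_mono2)
      show "finite (PiE (UNIV :: 'n set) (\<lambda>_. {- int R..int R}))"
        by (intro finite_PiE) auto
      show "vec_nth ` F \<subseteq> PiE UNIV (\<lambda>_. {- int R..int R})"
        using R by (auto simp: PiE_UNIV_domain)
    qed (auto intro: prod_nonneg h0)
    also have "\<dots> = (\<Prod>i\<in>(UNIV::'n set). \<Sum>x\<in>{- int R..int R}. h x)"
      by (subst prod_sum_PiE) auto
    also have "\<dots> \<le> (\<Prod>i\<in>(UNIV::'n set). B)"
      using B(2) by (intro prod_mono) (auto simp: h_def intro!: sum_nonneg)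
    finally show ?thesis by simp
  qed
  then show ?thesis
    using B(1) by (intro exI[of _ "B ^ CARD('n) + 1"]) (auto intro: add_increasing2 add_nonneg_pos)
qed

definition wt_sum :: "'n::finite itself \<Rightarrow> real" where
  "wt_sum _ = (SOME S. S > 0 \<and> (\<forall>F :: (int^'n) set. finite F \<longrightarrow>
     (\<Sum>j\<in>F. wt j powr (- summ_exp TYPE('n))) \<le> S))"

lemma wt_sum:
  shows wt_sum_pos: "wt_sum TYPE('n::finite) > 0"
    and wt_sum_le: "finite (F :: (int^'n) set) \<Longrightarrow>
      (\<Sum>j\<in>F. wt j powr (- summ_exp TYPE('n))) \<le> wt_sum TYPE('n)"
proof -
  have "wt_sum TYPE('n) > 0 \<and> (\<forall>F :: (int^'n) set. finite F \<longrightarrow>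
     (\<Sum>j\<in>F. wt j powr (- summ_exp TYPE('n))) \<le> wt_sum TYPE('n))"
    unfolding wt_sum_def by (rule someI_ex) (use wt_powr_sum_bounded in blast)
  then show "wt_sum TYPE('n::finite) > 0" "finite (F :: (int^'n) set) \<Longrightarrow>
      (\<Sum>j\<in>F. wt j powr (- summ_exp TYPE('n))) \<le> wt_sum TYPE('n)"
    by auto
qed

lemma wt_sum_diff_le:
  fixes F :: "(int^'n::finite) set"
  assumes "finite F"
  shows "(\<Sum>l\<in>F. wt (k - l) powr (- summ_exp TYPE('n))) \<le> wt_sum TYPE('n)"
    and "(\<Sum>l\<in>F. wt (l - k) powr (- summ_exp TYPE('n))) \<le> wt_sum TYPE('n)"
proof -
  have "(\<Sum>l\<in>F. wt (k - l) powr (- summ_exp TYPE('n)))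
      = (\<Sum>j\<in>(\<lambda>l. k - l) ` F. wt j powr (- summ_exp TYPE('n)))"
    by (subst sum.reindex) (auto simp: inj_on_def)
  then show "(\<Sum>l\<in>F. wt (k - l) powr (- summ_exp TYPE('n))) \<le> wt_sum TYPE('n)"
    using assms wt_sum_le[of "(\<lambda>l. k - l) ` F"] by simp
  then show "(\<Sum>l\<in>F. wt (l - k) powr (- summ_exp TYPE('n))) \<le> wt_sum TYPE('n)"
    by (simp add: wt_diff_commute)
qed

text \<open>Young's inequality splits \<open>x k * x l\<close>. The half with \<open>x l\<close>
  first trades \<open>wt k powr \<mu>\<close> for \<open>wt l powr \<mu>\<close>, which uses up
  \<open>|\<mu>|\<close> of the decay; hence the lower bound on \<open>N\<close>.\<close>

lemma schur_quadratic:
  fixes x :: "int^'n::finite \<Rightarrow> real"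
  assumes F: "finite F" and N: "N \<ge> summ_exp TYPE('n) + \<bar>\<mu>\<bar>" and x: "\<And>k. x k \<ge> 0"
  shows "(\<Sum>k\<in>F. \<Sum>l\<in>F. wt k powr \<mu> * wt (k - l) powr (- N) * x k * x l)
    \<le> wt_sum TYPE('n) * (\<Sum>k\<in>F. wt k powr \<mu> * (x k)\<^sup>2)"
proof -
  define d where "d = summ_exp TYPE('n)"
  define c where "c = (\<lambda>k l :: int^'n. wt (k - l) powr (- d))"
  define y where "y = (\<lambda>k. wt k powr \<mu> * (x k)\<^sup>2)"
  have y0: "y k \<ge> 0" for k by (simp add: y_def)
  have term_le: "wt k powr \<mu> * wt (k - l) powr (- N) * x k * x l \<le> (c k l * y k + c k l * y l) / 2" for k l
  proof -
    have 1: "wt (k - l) powr (- N) \<le> c k l"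
      unfolding c_def d_def using N by (intro wt_powr_mono) auto
    have "wt k powr \<mu> * wt (k - l) powr (- N)
        \<le> wt l powr \<mu> * wt (k - l) powr \<bar>\<mu>\<bar> * wt (k - l) powr (- N)"
      by (intro mult_right_mono wt_powr_le) auto
    also have "\<dots> = wt l powr \<mu> * wt (k - l) powr (\<bar>\<mu>\<bar> - N)"
      by (simp flip: powr_add)
    also have "\<dots> \<le> wt l powr \<mu> * c k l"
      unfolding c_def d_def using N by (intro mult_left_mono wt_powr_mono) auto
    finally have 2: "wt k powr \<mu> * wt (k - l) powr (- N) \<le> wt l powr \<mu> * c k l" .
    have "x k * x l \<le> ((x k)\<^sup>2 + (x l)\<^sup>2) / 2"
      using sum_squares_bound[of "x k" "x l"] by simp
    then have "wt k powr \<mu> * wt (k - l) powr (- N) * (x k * x l)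
        \<le> wt k powr \<mu> * wt (k - l) powr (- N) * (((x k)\<^sup>2 + (x l)\<^sup>2) / 2)"
      by (intro mult_left_mono) auto
    also have "\<dots> = (wt k powr \<mu> * wt (k - l) powr (- N) * (x k)\<^sup>2
        + wt k powr \<mu> * wt (k - l) powr (- N) * (x l)\<^sup>2) / 2"
      by (simp add: field_simps)
    also have "\<dots> \<le> (wt k powr \<mu> * c k l * (x k)\<^sup>2 + wt l powr \<mu> * c k l * (x l)\<^sup>2) / 2"
      using 1 2 by (intro divide_right_mono add_mono mult_right_mono mult_left_mono) auto
    finally show ?thesis
      by (simp add: y_def mult_ac)
  qed
  have "(\<Sum>k\<in>F. \<Sum>l\<in>F. wt k powr \<mu> * wt (k - l) powr (- N) * x k * x l)
      \<le> (\<Sum>k\<in>F. \<Sum>l\<in>F. (c k l * y k + c k l * y l) / 2)"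
    by (intro sum_mono term_le)
  also have "\<dots> = ((\<Sum>k\<in>F. \<Sum>l\<in>F. c k l * y k) + (\<Sum>k\<in>F. \<Sum>l\<in>F. c k l * y l)) / 2"
    by (simp add: sum.distrib flip: sum_divide_distrib)
  also have "(\<Sum>k\<in>F. \<Sum>l\<in>F. c k l * y l) = (\<Sum>l\<in>F. \<Sum>k\<in>F. c k l * y l)"
    by (rule sum.swap)
  also have "((\<Sum>k\<in>F. \<Sum>l\<in>F. c k l * y k) + (\<Sum>l\<in>F. \<Sum>k\<in>F. c k l * y l)) / 2
      \<le> ((\<Sum>k\<in>F. wt_sum TYPE('n) * y k) + (\<Sum>l\<in>F. wt_sum TYPE('n) * y l)) / 2"
    unfolding sum_distrib_right[symmetric] c_def d_def
    by (intro divide_right_mono add_mono sum_mono mult_right_mono wt_sum_diff_le F y0) auto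
  also have "\<dots> = wt_sum TYPE('n) * (\<Sum>k\<in>F. y k)"
    by (simp flip: sum_distrib_left)
  finally show ?thesis
    by (simp only: y_def)
qed

text \<open>Schur's test: Cauchy-Schwarz with the kernel split into two square roots. Row sums bound
  one factor, and column sums enter after exchanging the order of summation.\<close>

lemma schur_operator:
  fixes y :: "int^'n::finite \<Rightarrow> real"
  assumes F: "finite F" and G: "finite G" and y: "\<And>k. y k \<ge> 0"
  shows "(\<Sum>k\<in>F. (\<Sum>l\<in>G. wt (k - l) powr (- summ_exp TYPE('n)) * y l)\<^sup>2)
    \<le> (wt_sum TYPE('n))\<^sup>2 * (\<Sum>l\<in>G. (y l)\<^sup>2)"
proof -
  define S where "S = wt_sum TYPE('n)"
  have S: "S > 0" by (simp add: S_def wt_sum_pos)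
  define c where "c = (\<lambda>k l :: int^'n. wt (k - l) powr (- summ_exp TYPE('n)))"
  have c0: "c k l \<ge> 0" for k l by (simp add: c_def)
  have c1: "(\<Sum>l\<in>G. c k l) \<le> S" and c2: "(\<Sum>k\<in>F. c k l) \<le> S" for k l
    unfolding c_def S_def using wt_sum_diff_le F G by blast+
  have "(\<Sum>l\<in>G. c k l * y l)\<^sup>2 \<le> S * (\<Sum>l\<in>G. c k l * (y l)\<^sup>2)" for k
  proof -
    have "(\<Sum>l\<in>G. c k l * y l)\<^sup>2 = (\<Sum>l\<in>G. sqrt (c k l) * (sqrt (c k l) * y l))\<^sup>2"
      by (simp add: c0 flip: mult.assoc)
    also have "\<dots> \<le> (\<Sum>l\<in>G. (sqrt (c k l))\<^sup>2) * (\<Sum>l\<in>G. (sqrt (c k l) * y l)\<^sup>2)"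
      by (rule Cauchy_Schwarz_ineq_sum)
    also have "\<dots> = (\<Sum>l\<in>G. c k l) * (\<Sum>l\<in>G. c k l * (y l)\<^sup>2)"
      by (simp add: c0 power_mult_distrib)
    also have "\<dots> \<le> S * (\<Sum>l\<in>G. c k l * (y l)\<^sup>2)"
      by (intro mult_right_mono c1 sum_nonneg) (auto simp: c0)
    finally show ?thesis .
  qed
  then have "(\<Sum>k\<in>F. (\<Sum>l\<in>G. c k l * y l)\<^sup>2) \<le> (\<Sum>k\<in>F. S * (\<Sum>l\<in>G. c k l * (y l)\<^sup>2))"
    by (intro sum_mono)
  also have "\<dots> = S * (\<Sum>k\<in>F. \<Sum>l\<in>G. c k l * (y l)\<^sup>2)"
    by (simp add: sum_distrib_left)
  also have "(\<Sum>k\<in>F. \<Sum>l\<in>G. c k l * (y l)\<^sup>2) = (\<Sum>l\<in>G. \<Sum>k\<in>F. c k l * (y l)\<^sup>2)"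
    by (rule sum.swap)
  also have "\<dots> \<le> (\<Sum>l\<in>G. S * (y l)\<^sup>2)"
    unfolding sum_distrib_right[symmetric] by (intro sum_mono mult_right_mono c2) auto
  finally show ?thesis
    using S by (simp add: S_def c_def power2_eq_square sum_distrib_left mult_ac)
qed

text \<open>Moving the weight from \<open>k\<close> to \<open>l\<close> consumes \<open>|s|\<close>
  of the off-diagonal decay and leaves a summable kernel, so the matrix acts from order
  \<open>s\<close> to order \<open>s - m\<close>. The moduli inside the inner sum later give
  absolute convergence of the rows.\<close>

lemma matrix_bound_finite:
  fixes K :: "int^'n::finite \<Rightarrow> int^'n \<Rightarrow> complex"
  assumes K: "\<And>k l. cmod (K k l) \<le> C * wt k powr m * wt (k - l) powr (- (summ_exp TYPE('n) + \<bar>s\<bar>))"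
    and C: "C \<ge> 0" and F: "finite F" and G: "finite G"
  shows "(\<Sum>k\<in>F. wt k powr (2 * (s - m)) * (\<Sum>l\<in>G. cmod (K k l) * cmod (u l))\<^sup>2)
    \<le> (C * wt_sum TYPE('n))\<^sup>2 * wsq s G u"
proof -
  define d where "d = summ_exp TYPE('n)"
  define y where "y = (\<lambda>l. wt l powr s * cmod (u l))"
  have le: "wt k powr (s - m) * cmod (K k l) * cmod (u l) \<le> C * (wt (k - l) powr (- d) * y l)" for k l
  proof -
    have "wt k powr (s - m) * cmod (K k l)
        \<le> wt k powr (s - m) * (C * wt k powr m * wt (k - l) powr (- (d + \<bar>s\<bar>)))"
      unfolding d_def by (intro mult_left_mono K) auto
    also have "\<dots> = C * wt k powr s * wt (k - l) powr (- (d + \<bar>s\<bar>))"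
      by (simp add: powr_diff)
    also have "\<dots> \<le> C * (wt l powr s * wt (k - l) powr \<bar>s\<bar>) * wt (k - l) powr (- (d + \<bar>s\<bar>))"
      by (intro mult_right_mono mult_left_mono wt_powr_le C) auto
    also have "\<dots> = C * (wt (k - l) powr (- d) * wt l powr s)"
      by (simp add: mult_ac flip: powr_add)
    finally have "wt k powr (s - m) * cmod (K k l) \<le> C * (wt (k - l) powr (- d) * wt l powr s)" .
    then show ?thesis
      unfolding y_def using mult_right_mono[OF _ norm_ge_zero[of "u l"]] by (fastforce simp: mult_ac)
  qed
  have "(\<Sum>k\<in>F. wt k powr (2 * (s - m)) * (\<Sum>l\<in>G. cmod (K k l) * cmod (u l))\<^sup>2)
      = (\<Sum>k\<in>F. (\<Sum>l\<in>G. wt k powr (s - m) * cmod (K k l) * cmod (u l))\<^sup>2)"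
  proof (intro sum.cong refl)
    fix k :: "int^'n"
    have "wt k powr (2 * (s - m)) = (wt k powr (s - m))\<^sup>2"
      by (simp add: power2_eq_square flip: powr_add)
    then show "wt k powr (2 * (s - m)) * (\<Sum>l\<in>G. cmod (K k l) * cmod (u l))\<^sup>2
        = (\<Sum>l\<in>G. wt k powr (s - m) * cmod (K k l) * cmod (u l))\<^sup>2"
      by (simp only: power_mult_distrib[symmetric] sum_distrib_left mult.assoc)
  qed
  also have "\<dots> \<le> (\<Sum>k\<in>F. (C * (\<Sum>l\<in>G. wt (k - l) powr (- d) * y l))\<^sup>2)"
    unfolding sum_distrib_left by (intro sum_mono power_mono le sum_nonneg) auto
  also have "\<dots> = C\<^sup>2 * (\<Sum>k\<in>F. (\<Sum>l\<in>G. wt (k - l) powr (- d) * y l)\<^sup>2)"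
    by (simp only: power_mult_distrib sum_distrib_left[of "C\<^sup>2"])
  also have "\<dots> \<le> C\<^sup>2 * ((wt_sum TYPE('n))\<^sup>2 * (\<Sum>l\<in>G. (y l)\<^sup>2))"
    unfolding d_def by (intro mult_left_mono schur_operator F G) (auto simp: y_def)
  also have "(\<Sum>l\<in>G. (y l)\<^sup>2) = wsq s G u"
    by (intro sum.cong refl) (simp add: y_def power_mult_distrib power2_eq_square flip: powr_add)
  finally show ?thesis
    by (simp add: power_mult_distrib mult.assoc)
qed

section \<open>A Garding inequality for matrices with slowly varying diagonals\<close>

text \<open>The unit vectors generate the lattice as a group. This extends bounds on unit
  differences of a symbol to arbitrary shifts.\<close>

lemma int_vec_induct:
  fixes P :: "int^'n::finite \<Rightarrow> bool"
  assumes zero: "P 0" and unit: "\<And>i. P (axis i 1)"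
    and add: "\<And>q r. P q \<Longrightarrow> P r \<Longrightarrow> P (q + r)" and uminus: "\<And>q. P q \<Longrightarrow> P (- q)"
  shows "P q"
proof -
  have nat: "P (axis i (int c))" for i c
  proof (induction c)
    case 0
    have "axis i (int 0) = (0 :: int^'n)" by (simp add: vec_eq_iff axis_def)
    then show ?case using zero by metis
  next
    case (Suc c)
    have "axis i (int (Suc c)) = (axis i (int c) + axis i 1 :: int^'n)"
      by (simp add: vec_eq_iff axis_def)
    then show ?case using add[OF Suc unit] by simp
  qed
  have "P (axis i c)" for i c
  proof (cases c rule: int_cases2)
    case (nonpos n)
    have "axis i c = (- axis i (int n) :: int^'n)"
      by (simp add: vec_eq_iff axis_def nonpos)
    then show ?thesis using uminus[OF nat] by simp
  qed (use nat in simp)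
  then have *: "P (axis i c)" for i c by blast
  have "P (\<Sum>i\<in>I. axis i (q $ i))" if "finite I" for I
    using that(1) by (induction I rule: finite_induct) (auto intro: zero add *)
  moreover have "(\<Sum>i\<in>UNIV. axis i (q $ i)) = q"
    by (simp add: vec_eq_iff axis_def)
  ultimately show ?thesis
    by (metis finite_class.finite_UNIV)
qed

lemma card_int_box:
  fixes S :: "'n::finite \<Rightarrow> int set"
  assumes "\<And>i. finite (S i)"
  shows "finite {q :: int^'n. \<forall>i. q $ i \<in> S i}"
    and "card {q :: int^'n. \<forall>i. q $ i \<in> S i} = (\<Prod>i\<in>UNIV. card (S i))"
proof -
  have "bij_betw vec_nth {q :: int^'n. \<forall>i. q $ i \<in> S i} (PiE UNIV S)"
  proof (rule bij_betw_imageI)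
    show "vec_nth ` {q :: int^'n. \<forall>i. q $ i \<in> S i} = PiE UNIV S"
    proof (intro equalityI subsetI)
      fix g assume "g \<in> PiE UNIV S"
      then show "g \<in> vec_nth ` {q :: int^'n. \<forall>i. q $ i \<in> S i}"
        by (intro image_eqI[of _ _ "\<chi> i. g i"]) auto
    qed auto
  qed (auto simp: inj_on_def vec_nth_inject)
  moreover have "finite (PiE UNIV S)"
    using assms by (intro finite_PiE) auto
  ultimately show "finite {q :: int^'n. \<forall>i. q $ i \<in> S i}"
    and "card {q :: int^'n. \<forall>i. q $ i \<in> S i} = (\<Prod>i\<in>UNIV. card (S i))"
    by (auto simp: bij_betw_finite bij_betw_same_card card_PiE)
qed

text \<open>A shift by \<open>j\<close> pushes out of a cube of side \<open>L\<close> at most one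
  layer of thickness \<open>|j $ i|\<close> per coordinate, a proportion \<open>|j $ i| / L\<close>
  of the cube. The factor \<open>wt j\<close> makes the bound hold for all shifts
  simultaneously.\<close>

lemma folner_boxes:
  assumes "\<epsilon> > 0"
  shows "\<exists>Q :: (int^'n::finite) set. finite Q \<and> Q \<noteq> {} \<and>
    (\<forall>j. real (card {q\<in>Q. q + j \<notin> Q}) \<le> \<epsilon> * wt j * card Q)"
proof -
  \<comment> \<open>The union bound over the \<open>CARD('n)\<close> coordinates is paid for by a
    side \<open>L\<close> with \<open>CARD('n) \<le> \<epsilon> * L\<close>.\<close>
  obtain L0 :: nat where L0: "real CARD('n) / \<epsilon> < real L0"
    using reals_Archimedean2 by blast
  define L where "L = Suc L0"
  have L: "real CARD('n) \<le> \<epsilon> * real L" "L > 0"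
    using L0 assms by (auto simp: L_def field_simps)
  define Q where "Q = {q :: int^'n. \<forall>i. q $ i \<in> {0..<int L}}"
  have finQ: "finite Q" and cardQ: "card Q = L ^ CARD('n)"
    unfolding Q_def using card_int_box[of "\<lambda>_::'n. {0..<int L}"] by auto
  have side: "real (card {q\<in>Q. q $ i + c \<notin> {0..<int L}}) * L \<le> \<bar>real_of_int c\<bar> * card Q" for i :: 'n and c
  proof -
    \<comment> \<open>Leaving the cube in direction \<open>i\<close> constrains the
      \<open>i\<close>-th coordinate alone, so the exit set is again a box and its cardinality a
      product.\<close>
    define S where "S = (\<lambda>i'. if i' = i then {x\<in>{0..<int L}. x + c \<notin> {0..<int L}} else {0..<int L})"
    have "{q\<in>Q. q $ i + c \<notin> {0..<int L}} = {q. \<forall>i'. q $ i' \<in> S i'}"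
      by (auto simp: S_def Q_def split: if_splits)
    moreover have "finite (S i')" for i'
      by (rule finite_subset[of _ "{0..<int L}"]) (auto simp: S_def)
    ultimately have "card {q\<in>Q. q $ i + c \<notin> {0..<int L}} = (\<Prod>i'\<in>UNIV. card (S i'))"
      using card_int_box(2)[of S] by simp
    also have "\<dots> = card (S i) * (\<Prod>i'\<in>UNIV - {i}. card (S i'))"
      by (rule prod.remove) auto
    also have "(\<Prod>i'\<in>UNIV - {i}. card (S i')) = (\<Prod>i'\<in>UNIV - {i}. L)"
      by (intro prod.cong) (auto simp: S_def)
    also have "card (S i) \<le> nat \<bar>c\<bar>"
    proof -
      have "S i \<subseteq> (if c \<ge> 0 then {int L - c..<int L} else {0..<- c})"
        by (auto simp: S_def)
      then have "card (S i) \<le> card (if c \<ge> 0 then {int L - c..<int L} else {0..<- c})"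
        by (intro card_mono) auto
      then show ?thesis by (auto split: if_splits)
    qed
    finally have "card {q\<in>Q. q $ i + c \<notin> {0..<int L}} * L \<le> nat \<bar>c\<bar> * (\<Prod>i'\<in>UNIV - {i}. L) * L"
      by simp
    also have "\<dots> = nat \<bar>c\<bar> * (\<Prod>i'\<in>(UNIV :: 'n set). L)"
      by (subst prod.remove[of UNIV i]) auto
    also have "\<dots> = nat \<bar>c\<bar> * card Q"
      by (simp add: cardQ)
    finally have "real (card {q\<in>Q. q $ i + c \<notin> {0..<int L}} * L) \<le> real (nat \<bar>c\<bar> * card Q)"
      by (simp only: of_nat_le_iff)
    then show ?thesis by simp
  qed
  have "real (card {q\<in>Q. q + j \<notin> Q}) \<le> \<epsilon> * wt j * card Q" for j
  proof -
    have "{q\<in>Q. q + j \<notin> Q} \<subseteq> (\<Union>i\<in>UNIV. {q\<in>Q. q $ i + j $ i \<notin> {0..<int L}})"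
      by (auto simp: Q_def)
    then have "card {q\<in>Q. q + j \<notin> Q} \<le> card (\<Union>i\<in>UNIV. {q\<in>Q. q $ i + j $ i \<notin> {0..<int L}})"
      using finQ by (intro card_mono) auto
    also have "\<dots> \<le> (\<Sum>i\<in>UNIV. card {q\<in>Q. q $ i + j $ i \<notin> {0..<int L}})"
      by (rule card_UN_le) auto
    finally have "real (card {q\<in>Q. q + j \<notin> Q}) \<le> real (\<Sum>i\<in>UNIV. card {q\<in>Q. q $ i + j $ i \<notin> {0..<int L}})"
      by (simp only: of_nat_le_iff)
    then have "real (card {q\<in>Q. q + j \<notin> Q}) * L
        \<le> (\<Sum>i\<in>UNIV. real (card {q\<in>Q. q $ i + j $ i \<notin> {0..<int L}}) * L)"
      by (simp add: mult_right_mono flip: sum_distrib_right)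
    also have "\<dots> \<le> (\<Sum>i\<in>(UNIV :: 'n set). \<bar>real_of_int (j $ i)\<bar> * card Q)"
      by (intro sum_mono side)
    also have "\<dots> \<le> (\<Sum>i\<in>(UNIV :: 'n set). wt j * card Q)"
    proof (intro sum_mono mult_right_mono)
      show "\<bar>real_of_int (j $ i)\<bar> \<le> wt j" for i
        using abs_component_le_wt[of j i] by linarith
    qed auto
    also have "\<dots> = real CARD('n) * (wt j * card Q)"
      by simp
    also have "\<dots> \<le> \<epsilon> * real L * (wt j * card Q)"
      using L by (intro mult_right_mono) auto
    finally have "real (card {q\<in>Q. q + j \<notin> Q}) * L \<le> (\<epsilon> * wt j * card Q) * L"
      by (simp add: mult_ac)
    then show ?thesis
      using L by simp
  qed
  moreover have "Q \<noteq> {}"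
    using cardQ L by (metis card.empty power_not_zero not_gr_zero)
  ultimately show ?thesis
    using finQ by blast
qed

text \<open>For \<open>W\<close> beyond \<open>B / c\<close> the higher power wins; below that
  threshold the left side is bounded by a constant. This is how terms of order \<open>m - 1\<close>
  are absorbed.\<close>

lemma powr_interpolation:
  fixes B c m :: real
  assumes "B \<ge> 0" "c > 0"
  shows "\<exists>D\<ge>0. \<forall>W\<ge>1. B * W powr (m - 1) \<le> c * W powr m + D"
proof -
  define R where "R = max 1 (B / c)"
  have "B * W powr (m - 1) \<le> c * W powr m + B * R powr \<bar>m - 1\<bar>" if "W \<ge> 1" for W
  proof (cases "W \<ge> R")
    case True
    then have "B \<le> c * W"
      using assms by (simp add: R_def field_simps)
    then have "B * W powr (m - 1) \<le> c * W * W powr (m - 1)"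
      by (intro mult_right_mono) auto
    also have "\<dots> = c * W powr m"
      using that by (simp add: powr_diff)
    finally show ?thesis
      using assms by (intro add_increasing2) auto
  next
    case False
    have "W powr (m - 1) \<le> W powr \<bar>m - 1\<bar>"
      using that by (intro powr_mono) auto
    also have "\<dots> \<le> R powr \<bar>m - 1\<bar>"
      using that False by (intro powr_mono2) auto
    finally have "B * W powr (m - 1) \<le> B * R powr \<bar>m - 1\<bar>"
      using assms by (intro mult_left_mono) auto
    then show ?thesis
      using assms by (intro add_increasing) auto
  qed
  then show ?thesis
    using assms by (intro exI[of _ "B * R powr \<bar>m - 1\<bar>"]) auto
qed

lemma window_sum:
  fixes g :: "'a::ab_group_add \<Rightarrow> 'b::comm_monoid_add"
  assumes "finite F" "finite Q" "k \<in> F"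
  shows "(\<Sum>q\<in>Q. g (k - q)) = (\<Sum>p\<in>(\<lambda>(k, q). k - q) ` (F \<times> Q). if k - p \<in> Q then g p else 0)"
proof -
  have "(\<Sum>p\<in>(\<lambda>(k, q). k - q) ` (F \<times> Q). if k - p \<in> Q then g p else 0)
      = (\<Sum>p\<in>(\<lambda>q. k - q) ` Q. g p)"
  proof (rule sum.mono_neutral_cong_right)
    have "p \<in> (\<lambda>q. k - q) ` Q" if "k - p \<in> Q" for p
      using that by (intro image_eqI[of _ _ "k - p"]) auto
    then show "\<forall>p\<in>(\<lambda>(k, q). k - q) ` (F \<times> Q) - (\<lambda>q. k - q) ` Q. (if k - p \<in> Q then g p else 0) = 0"
      by auto
  qed (use assms in auto)
  also have "\<dots> = (\<Sum>q\<in>Q. g (k - q))"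
    by (subst sum.reindex) (auto simp: inj_on_def)
  finally show ?thesis by simp
qed

locale symbol_coeffs =
  fixes a :: "int^'n::finite \<Rightarrow> int^'n \<Rightarrow> complex" and m :: real
  assumes m_pos: "m > 0"
    and decay: "\<And>N. \<exists>C\<ge>0. \<forall>k j. cmod (a k j) \<le> C * wt k powr m * wt j powr (- N)"
    and diff_decay: "\<And>N i. \<exists>C\<ge>0. \<forall>k j. cmod (a (k + axis i 1) j - a k j)
      \<le> C * wt k powr (m - 1) * wt j powr (- N)"
    and frozen_form: "\<exists>c>0. \<exists>C\<ge>0. \<forall>p F v. finite F \<longrightarrow>
      Re (\<Sum>k\<in>F. \<Sum>l\<in>F. cnj (v k) * a p (k - l) * v l)
        \<le> (C - c * wt p powr m) * nsq F v"
begin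

text \<open>A shift is composed of unit steps, and on the way the weight changes by a factor
  depending on \<open>q\<close> only. The dependence of the constant on \<open>q\<close> is harmless
  because the box of shifts is fixed.\<close>

lemma shift_decay:
  "\<exists>C\<ge>0. \<forall>k j. cmod (a (k + q) j - a k j) \<le> C * wt k powr (m - 1) * wt j powr (- N)"
proof (induction q rule: int_vec_induct)
  case 1
  show ?case by (intro exI[of _ 0]) auto
next
  case (2 i)
  show ?case by (rule diff_decay)
next
  case (3 q r)
  then obtain C D where C: "C \<ge> 0" "\<And>k j. cmod (a (k + q) j - a k j) \<le> C * wt k powr (m - 1) * wt j powr (- N)"
    and D: "D \<ge> 0" "\<And>k j. cmod (a (k + r) j - a k j) \<le> D * wt k powr (m - 1) * wt j powr (- N)"
    by blast
  have "cmod (a (k + (q + r)) j - a k j) \<le> (D * wt q powr \<bar>m - 1\<bar> + C) * wt k powr (m - 1) * wt j powr (- N)" for k j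
  proof -
    have "cmod (a (k + (q + r)) j - a k j) \<le> cmod (a (k + q + r) j - a (k + q) j) + cmod (a (k + q) j - a k j)"
      using norm_triangle_ineq[of "a (k + q + r) j - a (k + q) j" "a (k + q) j - a k j"]
      by (simp add: add.assoc)
    also have "\<dots> \<le> D * wt (k + q) powr (m - 1) * wt j powr (- N) + C * wt k powr (m - 1) * wt j powr (- N)"
      by (intro add_mono C D)
    also have "\<dots> \<le> D * (wt k powr (m - 1) * wt q powr \<bar>m - 1\<bar>) * wt j powr (- N) + C * wt k powr (m - 1) * wt j powr (- N)"
      using wt_powr_le[of "k + q" "m - 1" k]
      by (intro add_mono mult_right_mono mult_left_mono D) auto
    finally show ?thesis
      by (simp add: algebra_simps)
  qed
  then show ?case
    using C D by (intro exI[of _ "D * wt q powr \<bar>m - 1\<bar> + C"]) auto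
next
  case (4 q)
  then obtain C where C: "C \<ge> 0" "\<And>k j. cmod (a (k + q) j - a k j) \<le> C * wt k powr (m - 1) * wt j powr (- N)"
    by blast
  have "cmod (a (k + - q) j - a k j) \<le> C * wt q powr \<bar>m - 1\<bar> * wt k powr (m - 1) * wt j powr (- N)" for k j
  proof -
    have "cmod (a (k + - q) j - a k j) = cmod (a (k - q + q) j - a (k - q) j)"
      by (simp add: norm_minus_commute)
    also have "\<dots> \<le> C * wt (k - q) powr (m - 1) * wt j powr (- N)"
      by (rule C)
    also have "\<dots> \<le> C * (wt k powr (m - 1) * wt q powr \<bar>m - 1\<bar>) * wt j powr (- N)"
      using wt_powr_le[of "k - q" "m - 1" k]
      by (intro mult_right_mono mult_left_mono C) auto
    finally show ?thesis
      by (simp add: algebra_simps)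
  qed
  then show ?case
    using C by (intro exI[of _ "C * wt q powr \<bar>m - 1\<bar>"]) auto
qed

text \<open>The error has three sources. The conjugating factor differs from 1 by order -1; moving
  the first argument from \<open>k\<close> to \<open>k - q\<close> gains one order; the offsets
  whose box contains \<open>k\<close> but not \<open>l\<close> form a proportion at most
  \<open>\<epsilon> * wt (k - l)\<close>. Only the third source keeps order \<open>m\<close>, and it
  carries the factor \<open>\<epsilon>\<close>.\<close>

lemma frozen_approximation:
  assumes C: "C \<ge> 0" "\<And>k j. cmod (a k j) \<le> C * wt k powr m * wt j powr (- (N + \<bar>s\<bar> + 2))"
    and D: "D \<ge> 0" "\<And>q k j. q \<in> Q \<Longrightarrow> cmod (a (k - q) j - a k j) \<le> D * wt k powr (m - 1) * wt j powr (- N)"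
    and Q: "finite Q" "Q \<noteq> {}" "\<And>j. real (card {q\<in>Q. q + j \<notin> Q}) \<le> \<epsilon> * wt j * card Q"
  shows "cmod (complex_of_real (wt k powr s * wt l powr (- s)) * a k (k - l)
      - (\<Sum>q\<in>Q. if q + (l - k) \<in> Q then a (k - q) (k - l) else 0) / card Q)
    \<le> (\<bar>s\<bar> * C + D) * (wt k powr (m - 1) * wt (k - l) powr (- N)) + \<epsilon> * C * (wt k powr m * wt (k - l) powr (- N))"
proof -
  define n where "n = real (card Q)"
  have n: "n > 0" using Q by (auto simp: n_def card_gt_0_iff)
  define t where "t = wt k powr s * wt l powr (- s)"
  define j where "j = k - l"
  define b where "b = wt k powr m * wt j powr (- N)"
  define b1 where "b1 = wt k powr (m - 1) * wt j powr (- N)"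
  \<comment> \<open>The extra \<open>|s| + 2\<close> powers of decay in the hypothesis on
    \<open>C\<close> pay for the mean value bound of the weight difference.\<close>
  have s1: "\<bar>t - 1\<bar> * cmod (a k j) \<le> \<bar>s\<bar> * C * b1"
  proof -
    have "\<bar>t - 1\<bar> = wt k powr s * \<bar>wt l powr (- s) - wt k powr (- s)\<bar>"
    proof -
      have "t - 1 = wt k powr s * (wt l powr (- s) - wt k powr (- s))"
        by (simp add: t_def right_diff_distrib flip: powr_add)
      then show ?thesis by (simp add: abs_mult)
    qed
    also have "\<dots> \<le> wt k powr s * (\<bar>- s\<bar> * wt k powr (- s - 1) * wt j powr (\<bar>- s\<bar> + 2))"
      unfolding j_def by (intro mult_left_mono wt_powr_diff_le) auto
    also have "\<dots> = \<bar>s\<bar> * ((wt k powr s * wt k powr (- s - 1)) * wt j powr (\<bar>s\<bar> + 2))"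
      by simp
    also have "wt k powr s * wt k powr (- s - 1) = wt k powr (- 1)"
      by (simp only: powr_add[symmetric]) simp
    finally have "\<bar>t - 1\<bar> * cmod (a k j)
        \<le> \<bar>s\<bar> * (wt k powr (- 1) * wt j powr (\<bar>s\<bar> + 2)) * (C * wt k powr m * wt j powr (- (N + \<bar>s\<bar> + 2)))"
      by (intro mult_mono C) auto
    also have "\<dots> = \<bar>s\<bar> * C * ((wt k powr (- 1) * wt k powr m) * (wt j powr (\<bar>s\<bar> + 2) * wt j powr (- (N + \<bar>s\<bar> + 2))))"
      by (simp only: mult_ac)
    also have "\<dots> = \<bar>s\<bar> * C * b1"
      unfolding b1_def powr_add[symmetric] by simp
    finally show ?thesis .
  qed
  have s2: "cmod (a k j) * wt j \<le> C * b"
  proof -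
    have "cmod (a k j) * wt j \<le> C * wt k powr m * wt j powr (- (N + \<bar>s\<bar> + 2)) * wt j powr 1"
      using mult_right_mono[OF C(2)[of k j], of "wt j"] by simp
    also have "\<dots> = C * (wt k powr m * (wt j powr (- (N + \<bar>s\<bar> + 2)) * wt j powr 1))"
      by (simp only: mult.assoc)
    also have "\<dots> = C * (wt k powr m * wt j powr (- (N + \<bar>s\<bar> + 1)))"
      unfolding powr_add[symmetric] by simp
    also have "\<dots> \<le> C * b"
      unfolding b_def by (intro mult_left_mono wt_powr_mono C) auto
    finally show ?thesis .
  qed
  have "of_real t * a k j - (\<Sum>q\<in>Q. if q + (l - k) \<in> Q then a (k - q) j else 0) / n
      = (\<Sum>q\<in>Q. of_real t * a k j - (if q + (l - k) \<in> Q then a (k - q) j else 0)) / n"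
    using n by (simp add: n_def sum_subtractf diff_divide_distrib)
  also have "cmod \<dots> = cmod (\<Sum>q\<in>Q. of_real t * a k j - (if q + (l - k) \<in> Q then a (k - q) j else 0)) / n"
    using n by (simp add: norm_divide)
  also have "\<dots> \<le> (\<Sum>q\<in>Q. \<bar>s\<bar> * C * b1 + D * b1 + (if q + (l - k) \<in> Q then 0 else cmod (a k j))) / n"
  proof (intro divide_right_mono sum_norm_le)
    fix q assume q: "q \<in> Q"
    have eq: "of_real t * a k j - (if q + (l - k) \<in> Q then a (k - q) j else 0)
        = of_real (t - 1) * a k j + (if q + (l - k) \<in> Q then a k j - a (k - q) j else a k j)"
      by (simp add: algebra_simps)
    have "cmod (of_real t * a k j - (if q + (l - k) \<in> Q then a (k - q) j else 0))
        \<le> cmod (of_real (t - 1) * a k j) + cmod (if q + (l - k) \<in> Q then a k j - a (k - q) j else a k j)"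
      unfolding eq by (rule norm_triangle_ineq)
    also have "cmod (of_real (t - 1) * a k j) \<le> \<bar>s\<bar> * C * b1"
      unfolding norm_mult norm_of_real by (rule s1)
    also have "cmod (if q + (l - k) \<in> Q then a k j - a (k - q) j else a k j)
        \<le> D * b1 + (if q + (l - k) \<in> Q then 0 else cmod (a k j))"
      using D(2)[OF q, of k j] D(1) by (auto simp: b1_def norm_minus_commute mult.assoc)
    finally show "cmod (of_real t * a k j - (if q + (l - k) \<in> Q then a (k - q) j else 0))
        \<le> \<bar>s\<bar> * C * b1 + D * b1 + (if q + (l - k) \<in> Q then 0 else cmod (a k j))"
      by (simp add: add.assoc)
  qed (use n in simp)
  also have "\<dots> = \<bar>s\<bar> * C * b1 + D * b1 + real (card {q\<in>Q. q + (l - k) \<notin> Q}) * cmod (a k j) / n"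
  proof -
    have "(\<Sum>q\<in>Q. if q + (l - k) \<in> Q then 0 else cmod (a k j))
        = (\<Sum>q\<in>{q\<in>Q. q + (l - k) \<notin> Q}. cmod (a k j))"
      using Q(1) by (intro sum.mono_neutral_cong_right) auto
    then show ?thesis
      using n by (simp add: n_def sum.distrib field_simps)
  qed
  also have "\<dots> \<le> \<bar>s\<bar> * C * b1 + D * b1 + (\<epsilon> * wt (l - k) * n) * cmod (a k j) / n"
    unfolding n_def by (intro add_left_mono divide_right_mono mult_right_mono Q) auto
  also have "\<dots> = \<bar>s\<bar> * C * b1 + D * b1 + \<epsilon> * (cmod (a k j) * wt j)"
    using n by (simp add: j_def wt_diff_commute)
  also have "\<dots> \<le> \<bar>s\<bar> * C * b1 + D * b1 + \<epsilon> * (C * b)"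
  proof -
    \<comment> \<open>The sign of \<open>\<epsilon>\<close> is read off from the counting hypothesis
      at the zero shift.\<close>
    have "0 \<le> \<epsilon> * wt (0 :: int^'n) * real (card Q)"
      using Q(3)[of 0] by (meson of_nat_0_le_iff order_trans)
    then have "\<epsilon> \<ge> 0"
      using n wt_ge_1[of "0 :: int^'n"] by (auto simp: n_def zero_le_mult_iff)
    then show ?thesis
      by (intro add_left_mono mult_left_mono s2)
  qed
  finally show ?thesis
    unfolding t_def b_def b1_def n_def j_def by (simp add: algebra_simps)
qed

text \<open>Regrouped by corners, the averaged form is a sum of frozen forms, each restricted to the
  points of \<open>F\<close> in the box \<open>p + Q\<close>. Every \<open>k\<close> lies in exactly
  \<open>card Q\<close> of these boxes, so averaging restores the diagonal; replacing the weight at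
  \<open>k - q\<close> by the weight at \<open>k\<close> costs order \<open>m - 1\<close>.\<close>

lemma window_form_le:
  assumes c: "c > 0"
    and form: "\<And>p F v. finite F \<Longrightarrow> Re (\<Sum>k\<in>F. \<Sum>l\<in>F. cnj (v k) * a p (k - l) * v l)
        \<le> (C - c * wt p powr m) * nsq F v"
    and F: "finite F" and Q: "finite Q" "Q \<noteq> {}"
  shows "Re (\<Sum>k\<in>F. \<Sum>l\<in>F. cnj (y k) * ((\<Sum>q\<in>Q. if q + (l - k) \<in> Q then a (k - q) (k - l) else 0) / card Q) * y l)
    \<le> (\<Sum>k\<in>F. (C - c * wt k powr m + c * m * (\<Sum>q\<in>Q. wt q powr (m + 2)) * wt k powr (m - 1)) * (cmod (y k))\<^sup>2)"
proof -
  define n where "n = real (card Q)"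
  have n: "n > 0" using Q by (auto simp: n_def card_gt_0_iff)
  define P where "P = (\<lambda>(k, q). k - q) ` (F \<times> Q)"
  have P: "finite P" using F Q by (simp add: P_def)
  \<comment> \<open>A crude common bound for the offset weights. Its size is immaterial, since it
    multiplies a term of order \<open>m - 1\<close>.\<close>
  define M where "M = (\<Sum>q\<in>Q. wt q powr (m + 2))"
  define Fp where "Fp = (\<lambda>p. {k\<in>F. k - p \<in> Q})"
  have Fp: "finite (Fp p)" for p using F by (simp add: Fp_def)
  have "(\<Sum>k\<in>F. \<Sum>l\<in>F. cnj (y k) * ((\<Sum>q\<in>Q. if q + (l - k) \<in> Q then a (k - q) (k - l) else 0) / n) * y l)
      = (\<Sum>k\<in>F. \<Sum>l\<in>F. (\<Sum>p\<in>P. if k - p \<in> Q \<and> l - p \<in> Q then cnj (y k) * a p (k - l) * y l else 0)) / n"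
    unfolding sum_divide_distrib[of _ F]
  proof (intro sum.cong refl)
    fix k l assume "k \<in> F" "l \<in> F"
    have "(\<Sum>q\<in>Q. if q + (l - k) \<in> Q then a (k - q) (k - l) else 0)
        = (\<Sum>q\<in>Q. if l - (k - q) \<in> Q then a (k - q) (k - l) else 0)"
      by (intro sum.cong refl) (simp add: algebra_simps)
    also have "\<dots> = (\<Sum>p\<in>P. if k - p \<in> Q then if l - p \<in> Q then a p (k - l) else 0 else 0)"
      unfolding P_def by (rule window_sum[OF F Q(1) \<open>k \<in> F\<close>])
    finally have e: "(\<Sum>q\<in>Q. if q + (l - k) \<in> Q then a (k - q) (k - l) else 0)
        = (\<Sum>p\<in>P. if k - p \<in> Q then if l - p \<in> Q then a p (k - l) else 0 else 0)" .
    show "cnj (y k) * ((\<Sum>q\<in>Q. if q + (l - k) \<in> Q then a (k - q) (k - l) else 0) / complex_of_real n) * y l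
        = (\<Sum>p\<in>P. if k - p \<in> Q \<and> l - p \<in> Q then cnj (y k) * a p (k - l) * y l else 0) / complex_of_real n"
      unfolding e sum_divide_distrib sum_distrib_left sum_distrib_right
      by (intro sum.cong refl) auto
  qed
  also have "(\<Sum>k\<in>F. \<Sum>l\<in>F. (\<Sum>p\<in>P. if k - p \<in> Q \<and> l - p \<in> Q then cnj (y k) * a p (k - l) * y l else 0))
      = (\<Sum>p\<in>P. \<Sum>k\<in>F. \<Sum>l\<in>F. if k - p \<in> Q \<and> l - p \<in> Q then cnj (y k) * a p (k - l) * y l else 0)"
  proof -
    have "(\<Sum>k\<in>F. \<Sum>l\<in>F. \<Sum>p\<in>P. h k l p) = (\<Sum>p\<in>P. \<Sum>k\<in>F. \<Sum>l\<in>F. h k l p)" for h :: "_ \<Rightarrow> _ \<Rightarrow> _ \<Rightarrow> complex"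
      by (subst sum.swap[of _ F P], intro sum.cong refl sum.swap)
    then show ?thesis .
  qed
  also have "\<dots> = (\<Sum>p\<in>P. \<Sum>k\<in>Fp p. \<Sum>l\<in>Fp p. cnj (y k) * a p (k - l) * y l)"
  proof (rule sum.cong[OF refl])
    fix p
    have inner: "(\<Sum>l\<in>F. if k - p \<in> Q \<and> l - p \<in> Q then cnj (y k) * a p (k - l) * y l else 0)
        = (if k - p \<in> Q then (\<Sum>l\<in>Fp p. cnj (y k) * a p (k - l) * y l) else 0)" for k
      using F by (auto simp: Fp_def split: if_splits intro!: sum.mono_neutral_cong_right)
    show "(\<Sum>k\<in>F. \<Sum>l\<in>F. if k - p \<in> Q \<and> l - p \<in> Q then cnj (y k) * a p (k - l) * y l else 0)
        = (\<Sum>k\<in>Fp p. \<Sum>l\<in>Fp p. cnj (y k) * a p (k - l) * y l)"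
      unfolding inner using F by (auto simp: Fp_def split: if_splits intro!: sum.mono_neutral_cong_right)
  qed
  finally have "Re (\<Sum>k\<in>F. \<Sum>l\<in>F. cnj (y k) * ((\<Sum>q\<in>Q. if q + (l - k) \<in> Q then a (k - q) (k - l) else 0) / n) * y l)
      = (\<Sum>p\<in>P. Re (\<Sum>k\<in>Fp p. \<Sum>l\<in>Fp p. cnj (y k) * a p (k - l) * y l)) / n"
    by simp
  also have "\<dots> \<le> (\<Sum>p\<in>P. (C - c * wt p powr m) * nsq (Fp p) y) / n"
    using n by (intro divide_right_mono sum_mono form Fp) auto
  also have "(\<Sum>p\<in>P. (C - c * wt p powr m) * nsq (Fp p) y)
      = (\<Sum>p\<in>P. \<Sum>k\<in>F. if k - p \<in> Q then (C - c * wt p powr m) * (cmod (y k))\<^sup>2 else 0)"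
    unfolding sum_distrib_left Fp_def using F by (intro sum.cong refl sum.mono_neutral_cong_left) auto
  also have "\<dots> = (\<Sum>k\<in>F. \<Sum>p\<in>P. if k - p \<in> Q then (C - c * wt p powr m) * (cmod (y k))\<^sup>2 else 0)"
    by (rule sum.swap)
  also have "\<dots> = (\<Sum>k\<in>F. \<Sum>q\<in>Q. (C - c * wt (k - q) powr m) * (cmod (y k))\<^sup>2)"
    unfolding P_def by (intro sum.cong refl window_sum[symmetric] F Q)
  also have "\<dots> \<le> (\<Sum>k\<in>F. \<Sum>q\<in>Q. (C - c * wt k powr m + c * m * M * wt k powr (m - 1)) * (cmod (y k))\<^sup>2)"
  proof (intro sum_mono mult_right_mono)
    fix k q assume q: "q \<in> Q"
    have "wt k powr m - wt (k - q) powr m \<le> \<bar>wt (k - q) powr m - wt k powr m\<bar>"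
      by simp
    also have "\<dots> \<le> \<bar>m\<bar> * wt k powr (m - 1) * wt q powr (\<bar>m\<bar> + 2)"
      using wt_powr_diff_le[of "k - q" m k] by simp
    also have "\<dots> \<le> m * wt k powr (m - 1) * M"
      unfolding M_def using m_pos Q q
      by (auto intro!: mult_left_mono member_le_sum[of q Q "\<lambda>q. wt q powr (m + 2)"])
    finally have "c * (wt k powr m - wt (k - q) powr m) \<le> c * (m * wt k powr (m - 1) * M)"
      using c by (intro mult_left_mono) auto
    then show "C - c * wt (k - q) powr m \<le> C - c * wt k powr m + c * m * M * wt k powr (m - 1)"
      by (simp add: algebra_simps)
  qed auto
  also have "\<dots> = n * (\<Sum>k\<in>F. (C - c * wt k powr m + c * m * M * wt k powr (m - 1)) * (cmod (y k))\<^sup>2)"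
    by (simp add: n_def sum_distrib_left)
  finally show ?thesis
    using n by (simp add: n_def M_def divide_right_mono)
qed

text \<open>Half of the coercive term of order \<open>m\<close> absorbs the pairs separated by the
  boxes, the other half all errors of order \<open>m - 1\<close>. What remains is a constant,
  independent of \<open>F\<close>.\<close>

theorem garding:
  "\<exists>C\<ge>0. \<forall>F v. finite F \<longrightarrow>
     Re (\<Sum>k\<in>F. \<Sum>l\<in>F. of_real (wt k powr (2 * s)) * cnj (v k) * a k (k - l) * v l)
       \<le> C * wsq s F v"
proof -
  \<comment> \<open>Enough decay for Schur's test at order \<open>m\<close> and at order
    \<open>m - 1\<close>.\<close>
  define N where "N = summ_exp TYPE('n) + \<bar>m\<bar> + \<bar>m - 1\<bar>"
  define S where "S = wt_sum TYPE('n)"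
  have S: "S > 0" by (simp add: S_def wt_sum_pos)
  obtain c C0 where c: "c > 0" "C0 \<ge> 0" and form: "\<And>p F v. finite F \<Longrightarrow>
      Re (\<Sum>k\<in>F. \<Sum>l\<in>F. cnj (v k) * a p (k - l) * v l)
        \<le> (C0 - c * wt p powr m) * nsq F v"
    using frozen_form by blast
  obtain C where C: "C \<ge> 0" "\<And>k j. cmod (a k j) \<le> C * wt k powr m * wt j powr (- (N + \<bar>s\<bar> + 2))"
    using decay by blast
  \<comment> \<open>Chosen so that the separated pairs, after Schur's test with constant
    \<open>S\<close>, consume at most \<open>c / 2\<close>; the summand 1 guards against
    \<open>C = 0\<close>.\<close>
  define \<epsilon> where "\<epsilon> = c / 2 / (S * (C + 1))"
  have "S * (\<epsilon> * (C + 1)) = c / 2"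
    using S C by (simp add: \<epsilon>_def)
  moreover have eps: "\<epsilon> > 0"
    using S C c by (simp add: \<epsilon>_def)
  ultimately have epsC: "S * (\<epsilon> * C) \<le> c / 2"
    using S by (smt (verit) mult_left_mono)
  obtain Q :: "(int^'n) set" where Q: "finite Q" "Q \<noteq> {}"
    "\<And>j. real (card {q\<in>Q. q + j \<notin> Q}) \<le> \<epsilon> * wt j * card Q"
    using folner_boxes[OF eps] by blast
  have "\<forall>q. \<exists>D\<ge>0. \<forall>k j. cmod (a (k + (- q)) j - a k j) \<le> D * wt k powr (m - 1) * wt j powr (- N)"
    using shift_decay by blast
  then obtain Dq where Dq: "\<And>q. Dq q \<ge> 0"
    "\<And>q k j. cmod (a (k - q) j - a k j) \<le> Dq q * wt k powr (m - 1) * wt j powr (- N)"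
    unfolding add_uminus_conv_diff by metis
  define D where "D = (\<Sum>q\<in>Q. Dq q)"
  have D: "D \<ge> 0"
    unfolding D_def by (intro sum_nonneg Dq)
  have DQ: "cmod (a (k - q) j - a k j) \<le> D * wt k powr (m - 1) * wt j powr (- N)" if "q \<in> Q" for q k j
  proof -
    have "Dq q \<le> D"
      unfolding D_def using Q(1) that Dq(1) by (intro member_le_sum) auto
    then show ?thesis
      by (intro order_trans[OF Dq(2)] mult_right_mono) auto
  qed
  define B where "B = c * m * (\<Sum>q\<in>Q. wt q powr (m + 2)) + S * (\<bar>s\<bar> * C + D)"
  have "B \<ge> 0"
    unfolding B_def using c m_pos S C D by (intro add_nonneg_nonneg mult_nonneg_nonneg sum_nonneg) auto
  then obtain E where E: "E \<ge> 0" "\<And>W. W \<ge> 1 \<Longrightarrow> B * W powr (m - 1) \<le> c / 2 * W powr m + E"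
    using powr_interpolation[of B "c / 2" m] c by auto
  have main: "Re (\<Sum>k\<in>F. \<Sum>l\<in>F. of_real (wt k powr (2 * s)) * cnj (v k) * a k (k - l) * v l)
       \<le> (C0 + E) * wsq s F v" if F: "finite F" for F v
  proof -
    \<comment> \<open>Conjugation: in terms of \<open>y\<close> the form of weight
      \<open>2 * s\<close> is unweighted, with entries multiplied by
      \<open>wt k powr s * wt l powr (- s)\<close>.\<close>
    define y where "y = (\<lambda>k. of_real (wt k powr s) * v k)"
    define x where "x = (\<lambda>k. cmod (y k))"
    define A where "A = (\<lambda>k l. (\<Sum>q\<in>Q. if q + (l - k) \<in> Q then a (k - q) (k - l) else 0) / complex_of_real (card Q))"
    define R where "R = (\<lambda>k l. complex_of_real (wt k powr s * wt l powr (- s)) * a k (k - l) - A k l)"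
    have R: "cmod (R k l) \<le> (\<bar>s\<bar> * C + D) * (wt k powr (m - 1) * wt (k - l) powr (- N)) + \<epsilon> * C * (wt k powr m * wt (k - l) powr (- N))" for k l
      unfolding R_def A_def using frozen_approximation[OF C D DQ Q] by simp
    have x2: "(x k)\<^sup>2 = wt k powr (2 * s) * (cmod (v k))\<^sup>2" for k
      by (simp add: x_def y_def norm_mult power_mult_distrib power2_eq_square flip: powr_add)
    have "of_real (wt k powr (2 * s)) * cnj (v k) * a k (k - l) * v l
        = cnj (y k) * A k l * y l + cnj (y k) * R k l * y l" for k l
    proof -
      have "cnj (y k) * A k l * y l + cnj (y k) * R k l * y l
          = cnj (y k) * (complex_of_real (wt k powr s * wt l powr (- s)) * a k (k - l)) * y l"
        by (simp add: R_def algebra_simps)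
      also have "\<dots> = of_real ((wt k powr s * wt k powr s) * (wt l powr (- s) * wt l powr s)) * cnj (v k) * a k (k - l) * v l"
        by (simp add: y_def mult_ac)
      finally show ?thesis
        by (simp flip: powr_add)
    qed
    then have "Re (\<Sum>k\<in>F. \<Sum>l\<in>F. of_real (wt k powr (2 * s)) * cnj (v k) * a k (k - l) * v l)
       = Re (\<Sum>k\<in>F. \<Sum>l\<in>F. cnj (y k) * A k l * y l) + Re (\<Sum>k\<in>F. \<Sum>l\<in>F. cnj (y k) * R k l * y l)"
      by (simp add: sum.distrib)
    also have "Re (\<Sum>k\<in>F. \<Sum>l\<in>F. cnj (y k) * A k l * y l)
       \<le> (\<Sum>k\<in>F. (C0 - c * wt k powr m + c * m * (\<Sum>q\<in>Q. wt q powr (m + 2)) * wt k powr (m - 1)) * (x k)\<^sup>2)"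
      unfolding A_def x_def using window_form_le[OF c(1) form F Q(1,2)] by simp
    also have "Re (\<Sum>k\<in>F. \<Sum>l\<in>F. cnj (y k) * R k l * y l)
        \<le> (\<Sum>k\<in>F. \<Sum>l\<in>F. (\<bar>s\<bar> * C + D) * (wt k powr (m - 1) * wt (k - l) powr (- N) * x k * x l)
             + \<epsilon> * C * (wt k powr m * wt (k - l) powr (- N) * x k * x l))"
    proof -
      have "Re (cnj (y k) * R k l * y l) \<le> (\<bar>s\<bar> * C + D) * (wt k powr (m - 1) * wt (k - l) powr (- N) * x k * x l)
             + \<epsilon> * C * (wt k powr m * wt (k - l) powr (- N) * x k * x l)" for k l
      proof -
        have "Re (cnj (y k) * R k l * y l) \<le> cmod (cnj (y k) * R k l * y l)"
          by (rule complex_Re_le_cmod)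
        also have "\<dots> = cmod (R k l) * (x k * x l)"
          by (simp add: norm_mult x_def)
        also have "\<dots> \<le> ((\<bar>s\<bar> * C + D) * (wt k powr (m - 1) * wt (k - l) powr (- N)) + \<epsilon> * C * (wt k powr m * wt (k - l) powr (- N))) * (x k * x l)"
          by (intro mult_right_mono R) (auto simp: x_def)
        finally show ?thesis by (simp add: algebra_simps)
      qed
      then show ?thesis
        unfolding Re_sum by (intro sum_mono)
    qed
    also have "\<dots> = (\<bar>s\<bar> * C + D) * (\<Sum>k\<in>F. \<Sum>l\<in>F. wt k powr (m - 1) * wt (k - l) powr (- N) * x k * x l)
        + \<epsilon> * C * (\<Sum>k\<in>F. \<Sum>l\<in>F. wt k powr m * wt (k - l) powr (- N) * x k * x l)"
      by (simp add: sum.distrib sum_distrib_left)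
    also have "\<dots> \<le> (\<bar>s\<bar> * C + D) * (S * (\<Sum>k\<in>F. wt k powr (m - 1) * (x k)\<^sup>2))
        + \<epsilon> * C * (S * (\<Sum>k\<in>F. wt k powr m * (x k)\<^sup>2))"
      unfolding S_def using C D eps F
      by (intro add_mono mult_left_mono schur_quadratic) (auto simp: N_def x_def)
    also have "\<dots> = (\<Sum>k\<in>F. (S * (\<bar>s\<bar> * C + D) * wt k powr (m - 1) + S * (\<epsilon> * C) * wt k powr m) * (x k)\<^sup>2)"
      by (simp add: sum_distrib_left sum.distrib algebra_simps)
    also have "(\<Sum>k\<in>F. (C0 - c * wt k powr m + c * m * (\<Sum>q\<in>Q. wt q powr (m + 2)) * wt k powr (m - 1)) * (x k)\<^sup>2) + \<dots>
        = (\<Sum>k\<in>F. (C0 - c * wt k powr m + B * wt k powr (m - 1) + S * (\<epsilon> * C) * wt k powr m) * (x k)\<^sup>2)"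
      unfolding sum.distrib[symmetric] B_def by (intro sum.cong refl) (simp add: algebra_simps)
    also have "\<dots> \<le> (\<Sum>k\<in>F. (C0 + E) * (x k)\<^sup>2)"
    proof (intro sum_mono mult_right_mono)
      fix k :: "int^'n"
      have "S * (\<epsilon> * C) * wt k powr m \<le> c / 2 * wt k powr m"
        by (intro mult_right_mono epsC) auto
      then show "C0 - c * wt k powr m + B * wt k powr (m - 1) + S * (\<epsilon> * C) * wt k powr m \<le> C0 + E"
        using E(2)[OF wt_ge_1[of k]] by linarith
    qed auto
    finally show ?thesis
      by (simp add: x2 sum_distrib_left)
  qed
  then show ?thesis
    using c E by (intro exI[of _ "C0 + E"]) auto
qed

end

section \<open>Fourier coefficients of symbols\<close>

lemma torus_integral_eq:
  assumes "continuous_on UNIV g"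
  shows "torus_integral g = integral (cbox 0 1) g"
    and "g integrable_on cbox 0 1"
proof -
  have "set_integrable lborel (cbox 0 1) g"
    unfolding set_integrable_def
    by (intro borel_integrable_compact compact_cbox continuous_on_subset[OF assms]) auto
  then show "torus_integral g = integral (cbox 0 1) g" "g integrable_on cbox 0 1"
    unfolding torus_integral_def by (rule set_borel_integral_eq_integral(2), rule set_borel_integral_eq_integral(1))
qed

text \<open>The corner \<open>1 + (v - 1) *\<^sub>R axis i 1\<close> has \<open>i\<close>-th
  coordinate \<open>v\<close> and all others 1. The boxes are thus slabs that extend from
  \<open>u\<close> to \<open>v\<close> in direction \<open>i\<close> and over the unit interval
  otherwise.\<close>

lemma integral_slab_split:
  fixes g :: "real^'n::finite \<Rightarrow> complex"
  assumes "continuous_on UNIV g" "u \<le> w" "w \<le> v"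
  shows "integral (cbox (u *\<^sub>R axis i 1) (1 + (v - 1) *\<^sub>R axis i 1)) g
    = integral (cbox (u *\<^sub>R axis i 1) (1 + (w - 1) *\<^sub>R axis i 1)) g
    + integral (cbox (w *\<^sub>R axis i 1) (1 + (v - 1) *\<^sub>R axis i 1)) g"
proof -
  define e :: "real^'n" where "e = axis i 1"
  have e: "e \<in> Basis" "\<And>x. x \<bullet> e = x $ i"
    by (auto simp: e_def inner_axis Basis_vec_def)
  let ?a = "u *\<^sub>R e" and ?b = "1 + (v - 1) *\<^sub>R e"
  have comp: "(r *\<^sub>R e) $ i' = (if i' = i then r else 0)"
    "(1 + r *\<^sub>R e) $ i' = (if i' = i then 1 + r else 1)" for r i'
    by (auto simp: e_def axis_def)
  have slab: "x \<in> cbox (r *\<^sub>R e) (1 + (r' - 1) *\<^sub>R e)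
      \<longleftrightarrow> r \<le> x $ i \<and> x $ i \<le> r' \<and> (\<forall>i'. i' \<noteq> i \<longrightarrow> 0 \<le> x $ i' \<and> x $ i' \<le> 1)" for x r r'
    unfolding mem_box_cart comp by force
  have "cbox ?a ?b \<inter> {x. x \<bullet> e \<le> w} = cbox ?a (1 + (w - 1) *\<^sub>R e)"
    by (intro set_eqI) (use assms(2,3) in \<open>auto simp: slab e\<close>)
  moreover have "cbox ?a ?b \<inter> {x. x \<bullet> e \<ge> w} = cbox (w *\<^sub>R e) ?b"
    by (intro set_eqI) (use assms(2,3) in \<open>auto simp: slab e\<close>)
  moreover have "g integrable_on cbox ?a ?b"
    by (intro integrable_continuous continuous_on_subset[OF assms(1)]) auto
  ultimately show ?thesis
    using integral_split[of g ?a ?b e w] e by (simp add: e_def)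
qed

lemma real_vec_axis: "real_vec (axis i 1) = axis i 1"
  by (simp add: real_vec_def axis_def vec_eq_iff)

text \<open>By periodicity the slab that sticks out of the translated cube contributes the same as
  the slab it left uncovered.\<close>

lemma torus_translate:
  fixes g :: "real^'n::finite \<Rightarrow> complex"
  assumes g: "continuous_on UNIV g" "torus_periodic g" and \<tau>: "0 \<le> \<tau>" "\<tau> \<le> 1"
  shows "integral (cbox 0 1) (\<lambda>x. g (x + \<tau> *\<^sub>R axis i 1)) = integral (cbox 0 1) g"
proof -
  define e :: "real^'n" where "e = axis i 1"
  define I where "I = (\<lambda>u v. integral (cbox (u *\<^sub>R e) (1 + (v - 1) *\<^sub>R e)) g)"
  have split: "I u v = I u w + I w v" if "u \<le> w" "w \<le> v" for u v w
    unfolding I_def e_def by (rule integral_slab_split[OF g(1) that])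
  have shift: "integral (cbox (a *\<^sub>R e) (1 + (b - 1) *\<^sub>R e)) (\<lambda>x. g (x + c *\<^sub>R e)) = I (a + c) (b + c)" for a b c
    using integral_shift_cbox[of "(a + c) *\<^sub>R e" "c *\<^sub>R e" "1 + (b + c - 1) *\<^sub>R e" g]
    unfolding I_def by (simp add: algebra_simps)
  have per: "g (x + 1 *\<^sub>R e) = g x" for x
    using g(2) unfolding torus_periodic_def e_def by (metis real_vec_axis scaleR_one)
  have "I 1 (1 + \<tau>) = I 0 \<tau>"
    using shift[of 0 \<tau> 1] unfolding per by (simp add: I_def add.commute)
  moreover have "I 0 1 + I 1 (1 + \<tau>) = I 0 \<tau> + I \<tau> (1 + \<tau>)"
    using split[of 0 1 "1 + \<tau>"] split[of 0 \<tau> "1 + \<tau>"] \<tau> by simp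
  ultimately have "I \<tau> (1 + \<tau>) = I 0 1"
    by simp
  then show ?thesis
    using shift[of 0 1 \<tau>] by (simp add: I_def e_def add.commute)
qed

text \<open>Translations in direction \<open>i\<close> preserve the integral of \<open>h\<close>, so
  \<open>h\<close> may be averaged over them first. After exchanging the integrals, the fundamental
  theorem on one period gives zero.\<close>

lemma torus_integral_derivative:
  fixes g h :: "real^'n::finite \<Rightarrow> complex"
  assumes deriv: "\<And>x. ((\<lambda>\<tau>. g (x + \<tau> *\<^sub>R axis i 1)) has_vector_derivative h x) (at 0)"
    and h: "continuous_on UNIV h" "torus_periodic h" and g: "torus_periodic g"
  shows "torus_integral h = 0"
proof -
  define e :: "real^'n" where "e = axis i 1"
  have line: "integral {0..1} (\<lambda>\<tau>. h (x + \<tau> *\<^sub>R e)) = 0" for x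
  proof -
    have "((\<lambda>\<tau>. h (x + \<tau> *\<^sub>R e)) has_integral g (x + 1 *\<^sub>R e) - g (x + 0 *\<^sub>R e)) {0..1}"
    proof (rule fundamental_theorem_of_calculus)
      fix t :: real
      have "((\<lambda>\<tau>. g ((x + t *\<^sub>R e) + \<tau> *\<^sub>R e)) has_vector_derivative h (x + t *\<^sub>R e)) (at (t - t))"
        using deriv[of "x + t *\<^sub>R e"] by (simp add: e_def)
      moreover have "((\<lambda>s::real. s - t) has_vector_derivative 1) (at t)"
        by (auto intro!: derivative_eq_intros)
      ultimately have "(((\<lambda>\<tau>. g ((x + t *\<^sub>R e) + \<tau> *\<^sub>R e)) \<circ> (\<lambda>s. s - t)) has_vector_derivative 1 *\<^sub>R h (x + t *\<^sub>R e)) (at t)"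
        by (intro vector_diff_chain_at)
      then show "((\<lambda>\<tau>. g (x + \<tau> *\<^sub>R e)) has_vector_derivative h (x + t *\<^sub>R e)) (at t within {0..1})"
        by (auto simp: o_def algebra_simps intro: has_vector_derivative_at_within)
    qed simp
    moreover have "g (x + 1 *\<^sub>R e) = g x"
      using g unfolding torus_periodic_def e_def by (metis real_vec_axis scaleR_one)
    ultimately show ?thesis
      by (simp add: integral_unique)
  qed
  have "0 = integral (cbox 0 1) (\<lambda>x. integral (cbox 0 1) (\<lambda>\<tau>. h (x + \<tau> *\<^sub>R e)))"
    by (simp add: line)
  also have "\<dots> = integral (cbox 0 1) (\<lambda>\<tau>. integral (cbox 0 1) (\<lambda>x. h (x + \<tau> *\<^sub>R e)))"
    by (intro integral_swap_continuous)
       (auto simp: case_prod_unfold intro!: continuous_intros continuous_on_compose2[OF h(1)])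
  also have "\<dots> = integral (cbox 0 1) (\<lambda>\<tau>::real. integral (cbox 0 1) h)"
    unfolding e_def by (intro integral_cong torus_translate h) auto
  also have "\<dots> = integral (cbox 0 1) h"
    by simp
  finally show ?thesis
    by (simp add: torus_integral_eq h)
qed

section \<open>Characters and Fourier coefficients\<close>

definition torus_char :: "int^'n::finite \<Rightarrow> real^'n \<Rightarrow> complex" where
  "torus_char j x = exp (2 * of_real pi * \<i> * of_real (real_vec j \<bullet> x))"

text \<open>The usual Fourier coefficient at frequency \<open>- j\<close>. With this sign the matrix
  entry of the operator is \<open>torus_coeff (\<sigma> k) (k - l)\<close>.\<close>

definition torus_coeff :: "(real^'n::finite \<Rightarrow> complex) \<Rightarrow> int^'n \<Rightarrow> complex" where
  "torus_coeff g j = torus_integral (\<lambda>x. torus_char j x * g x)"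

lemma norm_torus_char [simp]: "cmod (torus_char j x) = 1"
  by (simp add: torus_char_def)

lemma torus_char_zero [simp]: "torus_char 0 x = 1"
  by (simp add: torus_char_def real_vec_simps)

lemma torus_char_add: "torus_char (j + l) x = torus_char j x * torus_char l x"
  by (simp add: torus_char_def real_vec_simps inner_add_left algebra_simps exp_add)

lemma torus_char_uminus: "torus_char (- j) x = cnj (torus_char j x)"
  by (simp add: torus_char_def real_vec_simps exp_cnj)

lemma continuous_torus_char: "continuous_on S (torus_char j)"
  unfolding torus_char_def by (intro continuous_intros)

lemma torus_char_periodic: "torus_char j (x + real_vec l) = torus_char j x"
proof -
  have "real_vec j \<bullet> real_vec l = of_int (\<Sum>i\<in>UNIV. j $ i * l $ i)"
    by (simp add: inner_vec_def real_vec_def)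
  then have "torus_char j (x + real_vec l)
      = torus_char j x * exp (\<i> * (of_int (\<Sum>i\<in>UNIV. j $ i * l $ i) * (of_real pi * 2)))"
    by (simp add: torus_char_def inner_add_right algebra_simps exp_add[symmetric])
  also have "exp (\<i> * (of_int (\<Sum>i\<in>UNIV. j $ i * l $ i) * (of_real pi * 2))) = 1"
    by (rule exp_2pi_1_int)
  finally show ?thesis by simp
qed

lemma torus_char_derivative:
  "((\<lambda>\<tau>. torus_char j (x + \<tau> *\<^sub>R axis i 1)) has_vector_derivative
     (2 * of_real pi * \<i> * of_int (j $ i)) * torus_char j x) (at 0)"
proof -
  have "((\<lambda>\<tau>. exp (2 * of_real pi * \<i> * (of_real (real_vec j \<bullet> x) + of_real \<tau> * of_int (j $ i)))) has_vector_derivative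
     (2 * of_real pi * \<i> * of_int (j $ i)) * torus_char j x) (at (0::real))"
    unfolding torus_char_def
    by (rule has_vector_derivative_eq_rhs[OF has_vector_derivative_real_field])
      (auto intro!: derivative_eq_intros)
  moreover have "real_vec j \<bullet> (x + \<tau> *\<^sub>R axis i 1) = real_vec j \<bullet> x + \<tau> * of_int (j $ i)" for \<tau>
    by (simp add: inner_add_right inner_axis real_vec_def)
  ultimately show ?thesis
    by (simp add: torus_char_def)
qed

section \<open>Smooth periodic functions and the decay of their coefficients\<close>

lemma partial_deriv_derivative:
  fixes g :: "real^'n::finite \<Rightarrow> complex"
  assumes "g differentiable at x"
  shows "((\<lambda>\<tau>. g (x + \<tau> *\<^sub>R axis i 1)) has_vector_derivative partial_deriv i g x) (at 0)"
proof -
  from assms obtain D where D: "(g has_derivative D) (at x)"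
    by (auto simp: differentiable_def)
  have "(g \<circ> (\<lambda>\<tau>. x + \<tau> *\<^sub>R axis i 1) has_derivative D \<circ> (\<lambda>\<tau>. \<tau> *\<^sub>R axis i 1)) (at 0)"
    by (rule diff_chain_at) (auto intro!: derivative_eq_intros D)
  then have "((\<lambda>\<tau>. g (x + \<tau> *\<^sub>R axis i 1)) has_vector_derivative D (axis i 1)) (at 0)"
    using has_derivative_linear[OF D] by (simp add: o_def has_vector_derivative_def linear_scale)
  then show ?thesis
    unfolding partial_deriv_def by (simp add: vector_derivative_at)
qed

lemma C_times_continuous: "C_times N g \<Longrightarrow> continuous_on UNIV g"
  by (cases N) (auto simp: continuous_on_eq_continuous_at differentiable_imp_continuous_within)

lemma C_times_lin:
  "C_times N g \<Longrightarrow> C_times N h \<Longrightarrow> C_times N (\<lambda>x. c * g x + d * h x)"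
proof (induction N arbitrary: g h)
  case 0
  then show ?case by (auto intro!: continuous_intros)
next
  case (Suc N)
  have "partial_deriv i (\<lambda>x. c * g x + d * h x) = (\<lambda>x. c * partial_deriv i g x + d * partial_deriv i h x)" for i
  proof
    fix x
    have "((\<lambda>\<tau>. c * g (x + \<tau> *\<^sub>R axis i 1) + d * h (x + \<tau> *\<^sub>R axis i 1)) has_vector_derivative
        c * partial_deriv i g x + d * partial_deriv i h x) (at 0)"
      using Suc.prems by (intro has_vector_derivative_add has_vector_derivative_mult_right partial_deriv_derivative) auto
    then show "partial_deriv i (\<lambda>x. c * g x + d * h x) x = c * partial_deriv i g x + d * partial_deriv i h x"
      unfolding partial_deriv_def[of i "\<lambda>x. c * g x + d * h x"] by (simp add: vector_derivative_at)
  qed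
  then show ?case
    using Suc by auto
qed

lemma C_infinity_lin:
  "C_infinity g \<Longrightarrow> C_infinity h \<Longrightarrow> C_infinity (\<lambda>x. c * g x + d * h x)"
  by (simp add: C_infinity_def C_times_lin)

lemma C_infinity_partial_deriv: "C_infinity g \<Longrightarrow> C_infinity (partial_deriv i g)"
  unfolding C_infinity_def by (metis C_times.simps(2))

lemma C_infinity_continuous: "C_infinity g \<Longrightarrow> continuous_on UNIV g"
  unfolding C_infinity_def using C_times_continuous by blast

lemma C_infinity_differentiable: "C_infinity g \<Longrightarrow> g differentiable at x"
  unfolding C_infinity_def by (metis C_times.simps(2))

lemma C_infinity_falling_deriv: "C_infinity g \<Longrightarrow> C_infinity (falling_deriv i l g)"
proof (induction l)
  case (Suc l)
  then show ?case
    using C_infinity_lin[where c = "1 / (2 * of_real pi * \<i>)" and d = "- of_nat l"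
        and g = "partial_deriv i (falling_deriv i l g)" and h = "falling_deriv i l g"]
      C_infinity_partial_deriv[of "falling_deriv i l g" i] by simp
qed simp

lemma torus_periodic_partial_deriv: "torus_periodic g \<Longrightarrow> torus_periodic (partial_deriv i g)"
  unfolding torus_periodic_def partial_deriv_def
proof (intro allI)
  fix x l
  assume per: "\<forall>x l. g (x + real_vec l) = g x"
  have "(\<lambda>\<tau>. g (x + real_vec l + \<tau> *\<^sub>R axis i 1)) = (\<lambda>\<tau>. g (x + \<tau> *\<^sub>R axis i 1))"
  proof
    fix \<tau>
    have e: "x + real_vec l + \<tau> *\<^sub>R axis i 1 = (x + \<tau> *\<^sub>R axis i 1) + real_vec l"
      by (simp add: algebra_simps)
    show "g (x + real_vec l + \<tau> *\<^sub>R axis i 1) = g (x + \<tau> *\<^sub>R axis i 1)"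
      by (simp only: e per)
  qed
  then show "vector_derivative (\<lambda>\<tau>. g (x + real_vec l + \<tau> *\<^sub>R axis i 1)) (at 0)
      = vector_derivative (\<lambda>\<tau>. g (x + \<tau> *\<^sub>R axis i 1)) (at 0)"
    by simp
qed

lemma torus_periodic_falling_deriv: "torus_periodic g \<Longrightarrow> torus_periodic (falling_deriv i l g)"
proof (induction l)
  case (Suc l)
  then show ?case
    using torus_periodic_partial_deriv[of "falling_deriv i l g" i] by (auto simp: torus_periodic_def)
qed simp

lemma torus_coeff_lin:
  assumes "continuous_on UNIV g" "continuous_on UNIV h"
  shows "torus_coeff (\<lambda>x. c * g x + d * h x) j = c * torus_coeff g j + d * torus_coeff h j"
proof -
  have cont: "continuous_on UNIV (\<lambda>x. torus_char j x * f x)" if "continuous_on UNIV f" for f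
    using that by (intro continuous_intros continuous_torus_char)
  have "torus_coeff (\<lambda>x. c * g x + d * h x) j
      = integral (cbox 0 1) (\<lambda>x. torus_char j x * (c * g x + d * h x))"
    unfolding torus_coeff_def by (intro torus_integral_eq cont continuous_intros assms)
  also have "\<dots> = integral (cbox 0 1) (\<lambda>x. c * (torus_char j x * g x) + d * (torus_char j x * h x))"
    by (intro integral_cong) (simp add: algebra_simps)
  also have "\<dots> = integral (cbox 0 1) (\<lambda>x. c * (torus_char j x * g x)) + integral (cbox 0 1) (\<lambda>x. d * (torus_char j x * h x))"
    by (intro integral_add torus_integral_eq continuous_intros cont assms)
  also have "\<dots> = c * torus_coeff g j + d * torus_coeff h j"
    unfolding torus_coeff_def by (simp add: torus_integral_eq cont assms)
  finally show ?thesis .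
qed

text \<open>The derivative of the product of a character with \<open>g\<close> integrates to
  zero.\<close>

lemma torus_coeff_partial_deriv:
  assumes "C_infinity g" "torus_periodic g"
  shows "torus_coeff (partial_deriv i g) j = - (2 * of_real pi * \<i> * of_int (j $ i)) * torus_coeff g j"
proof -
  define \<omega> :: complex where "\<omega> = 2 * of_real pi * \<i> * of_int (j $ i)"
  note cont = C_infinity_continuous[OF assms(1)] C_infinity_continuous[OF C_infinity_partial_deriv[OF assms(1), of i]]
  have "torus_integral (\<lambda>x. torus_char j x * (1 * partial_deriv i g x + \<omega> * g x)) = 0"
  proof (rule torus_integral_derivative)
    fix x
    have "((\<lambda>\<tau>. torus_char j (x + \<tau> *\<^sub>R axis i 1) * g (x + \<tau> *\<^sub>R axis i 1)) has_vector_derivative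
        torus_char j (x + 0 *\<^sub>R axis i 1) * partial_deriv i g x + \<omega> * torus_char j x * g (x + 0 *\<^sub>R axis i 1)) (at 0)"
      unfolding \<omega>_def
      by (intro has_vector_derivative_mult torus_char_derivative partial_deriv_derivative C_infinity_differentiable assms)
    then show "((\<lambda>\<tau>. torus_char j (x + \<tau> *\<^sub>R axis i 1) * g (x + \<tau> *\<^sub>R axis i 1)) has_vector_derivative
        torus_char j x * (1 * partial_deriv i g x + \<omega> * g x)) (at 0)"
      by (simp add: algebra_simps)
  next
    show "continuous_on UNIV (\<lambda>x. torus_char j x * (1 * partial_deriv i g x + \<omega> * g x))"
      by (intro continuous_intros continuous_torus_char cont)
    show "torus_periodic (\<lambda>x. torus_char j x * (1 * partial_deriv i g x + \<omega> * g x))"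
      using assms(2) torus_periodic_partial_deriv[OF assms(2), of i]
      by (simp add: torus_periodic_def torus_char_periodic)
    show "torus_periodic (\<lambda>x. torus_char j x * g x)"
      using assms(2) by (simp add: torus_periodic_def torus_char_periodic)
  qed
  then have "1 * torus_coeff (partial_deriv i g) j + \<omega> * torus_coeff g j = 0"
    using torus_coeff_lin[OF cont(2,1), of 1 \<omega> j] unfolding torus_coeff_def by simp
  then show ?thesis
    unfolding \<omega>_def[symmetric] by (simp add: add_eq_0_iff2)
qed

text \<open>Characters diagonalise the falling derivatives; the product is the falling factorial of
  \<open>- j $ i\<close>.\<close>

lemma torus_coeff_falling_deriv:
  assumes "C_infinity g" "torus_periodic g"
  shows "torus_coeff (falling_deriv i l g) j = (\<Prod>r<l. - of_int (j $ i) - of_nat r) * torus_coeff g j"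
proof (induction l)
  case (Suc l)
  let ?h = "falling_deriv i l g"
  note h = C_infinity_falling_deriv[OF assms(1)] torus_periodic_falling_deriv[OF assms(2)]
  have "torus_coeff (falling_deriv i (Suc l) g) j
      = torus_coeff (\<lambda>x. 1 / (2 * of_real pi * \<i>) * partial_deriv i ?h x + (- of_nat l) * ?h x) j"
    by simp
  also have "\<dots> = 1 / (2 * of_real pi * \<i>) * torus_coeff (partial_deriv i ?h) j + (- of_nat l) * torus_coeff ?h j"
    by (intro torus_coeff_lin C_infinity_continuous C_infinity_partial_deriv h)
  also have "\<dots> = (- of_int (j $ i) - of_nat l) * torus_coeff ?h j"
    by (simp add: torus_coeff_partial_deriv h field_simps)
  finally show ?case
    by (simp add: Suc mult_ac)
qed simp

lemma measure_unit_cube: "measure lborel (cbox (0 :: real^'n::finite) 1) = 1"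
proof -
  have "(0 :: real^'n) \<in> cbox 0 1"
    by (simp add: mem_box_cart)
  then show ?thesis
    by (subst content_cbox_cart) auto
qed

lemma torus_coeff_bound:
  assumes "continuous_on UNIV g" "\<And>x. cmod (g x) \<le> B"
  shows "cmod (torus_coeff g j) \<le> B"
proof -
  have cont: "continuous_on UNIV (\<lambda>x. torus_char j x * g x)"
    by (intro continuous_intros continuous_torus_char assms)
  have B: "0 \<le> B"
    using assms(2) norm_ge_zero order_trans by blast
  have "cmod (torus_coeff g j) \<le> B * measure lborel (cbox (0 :: real^'a) 1)"
    unfolding torus_coeff_def torus_integral_eq(1)[OF cont]
    by (rule has_integral_bound[OF B integrable_integral[OF torus_integral_eq(2)[OF cont]]])
       (auto simp: norm_mult assms)
  also have "measure lborel (cbox (0 :: real^'a) 1) = 1"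
    by (rule measure_unit_cube)
  finally show ?thesis by simp
qed

text \<open>Symbol estimates control falling derivatives, hence falling factorials rather than
  powers. If \<open>|y| > 2 * l\<close>, each factor is at least \<open>|y| / 2\<close>; otherwise
  the constant term suffices.\<close>

lemma falling_product_bound:
  fixes y :: int
  shows "\<bar>real_of_int y\<bar> ^ l \<le> 2 ^ l * \<bar>\<Prod>r<l. - real_of_int y - real r\<bar> + (2 * real l) ^ l"
proof (cases "\<bar>real_of_int y\<bar> \<le> 2 * real l")
  case True
  then show ?thesis
    by (intro add_increasing power_mono) auto
next
  case False
  have "(\<Prod>r<l. \<bar>real_of_int y\<bar>) \<le> (\<Prod>r<l. 2 * \<bar>- real_of_int y - real r\<bar>)"
    using False by (intro prod_mono) (auto simp: abs_if)
  then show ?thesis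
    by (intro add_increasing2) (auto simp: prod.distrib abs_prod)
qed

text \<open>Both sides are compared with the largest of 1 and the moduli of the coordinates.\<close>

lemma wt_power_le:
  "wt (j :: int^'n::finite) ^ l \<le> (real CARD('n) + 1) ^ l * (1 + (\<Sum>i\<in>UNIV. \<bar>real_of_int (j $ i)\<bar> ^ l))"
proof -
  define M where "M = Max (insert 1 (range (\<lambda>i. \<bar>real_of_int (j $ i)\<bar>)))"
  have M: "M \<ge> 1" "\<And>i. \<bar>real_of_int (j $ i)\<bar> \<le> M"
    unfolding M_def by (rule Max_ge; simp)+
  have "M \<in> insert 1 (range (\<lambda>i. \<bar>real_of_int (j $ i)\<bar>))"
    unfolding M_def by (rule Max_in) auto
  then have "M ^ l \<le> 1 + (\<Sum>i\<in>UNIV. \<bar>real_of_int (j $ i)\<bar> ^ l)"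
  proof
    assume "M \<in> range (\<lambda>i. \<bar>real_of_int (j $ i)\<bar>)"
    then obtain i where "M = \<bar>real_of_int (j $ i)\<bar>" by blast
    then show ?thesis
      using member_le_sum[of i UNIV "\<lambda>i. \<bar>real_of_int (j $ i)\<bar> ^ l"] by simp
  qed (simp add: sum_nonneg)
  moreover have "wt j \<le> (real CARD('n) + 1) * M"
  proof -
    have "wt j \<le> 1 + (\<Sum>i\<in>UNIV. \<bar>real_of_int (j $ i)\<bar>)"
      using norm_le_l1_cart[of "real_vec j"] by (simp add: wt_def real_vec_def)
    also have "\<dots> \<le> M + (\<Sum>i\<in>(UNIV :: 'n set). M)"
      by (intro add_mono sum_mono M)
    finally show ?thesis by (simp add: algebra_simps)
  qed
  then have "wt j ^ l \<le> ((real CARD('n) + 1) * M) ^ l"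
    by (intro power_mono) auto
  ultimately show ?thesis
    unfolding power_mult_distrib by (meson mult_left_mono order_trans zero_le_power add_nonneg_nonneg of_nat_0_le_iff zero_le_one)
qed

text \<open>A power of the weight is dominated by the sum of the same powers of the coordinates, so
  derivatives in one coordinate at a time give decay in all directions.\<close>

lemma torus_coeff_decay:
  fixes g :: "real^'n::finite \<Rightarrow> complex"
  assumes g: "C_infinity g" "torus_periodic g"
    and B: "\<And>x. cmod (g x) \<le> B" "\<And>i x. cmod (falling_deriv i l g x) \<le> B"
  shows "wt j ^ l * cmod (torus_coeff g j)
    \<le> (real CARD('n) + 1) ^ l * (1 + real CARD('n) * (2 ^ l + (2 * real l) ^ l)) * B"
proof -
  define c where "c = cmod (torus_coeff g j)"
  have c: "c \<ge> 0" "c \<le> B"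
    unfolding c_def using g B by (auto intro!: torus_coeff_bound C_infinity_continuous)
  have comp: "\<bar>real_of_int (j $ i)\<bar> ^ l * c \<le> (2 ^ l + (2 * real l) ^ l) * B" for i
  proof -
    have "\<bar>\<Prod>r<l. - real_of_int (j $ i) - real r\<bar> * c = cmod (torus_coeff (falling_deriv i l g) j)"
    proof -
      have "(\<Prod>r<l. - of_int (j $ i) - of_nat r) = complex_of_real (\<Prod>r<l. - real_of_int (j $ i) - real r)"
        by simp
      then show ?thesis
        unfolding torus_coeff_falling_deriv[OF g] c_def norm_mult by (simp only: norm_of_real)
    qed
    also have "\<dots> \<le> B"
      by (intro torus_coeff_bound C_infinity_continuous C_infinity_falling_deriv g B)
    finally have 1: "\<bar>\<Prod>r<l. - real_of_int (j $ i) - real r\<bar> * c \<le> B" .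
    have "\<bar>real_of_int (j $ i)\<bar> ^ l * c \<le> (2 ^ l * \<bar>\<Prod>r<l. - real_of_int (j $ i) - real r\<bar> + (2 * real l) ^ l) * c"
      by (intro mult_right_mono falling_product_bound c)
    also have "\<dots> = 2 ^ l * (\<bar>\<Prod>r<l. - real_of_int (j $ i) - real r\<bar> * c) + (2 * real l) ^ l * c"
      by (simp add: algebra_simps)
    also have "\<dots> \<le> 2 ^ l * B + (2 * real l) ^ l * B"
      using 1 c by (intro add_mono mult_left_mono) auto
    finally show ?thesis by (simp add: algebra_simps)
  qed
  have "wt j ^ l * c \<le> (real CARD('n) + 1) ^ l * (1 + (\<Sum>i\<in>UNIV. \<bar>real_of_int (j $ i)\<bar> ^ l)) * c"
    by (intro mult_right_mono wt_power_le c)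
  also have "\<dots> = (real CARD('n) + 1) ^ l * (c + (\<Sum>i\<in>UNIV. \<bar>real_of_int (j $ i)\<bar> ^ l * c))"
    by (simp add: algebra_simps sum_distrib_left sum_distrib_right)
  also have "\<dots> \<le> (real CARD('n) + 1) ^ l * (B + (\<Sum>i\<in>(UNIV :: 'n set). (2 ^ l + (2 * real l) ^ l) * B))"
    by (intro mult_left_mono add_mono sum_mono comp c) auto
  finally show ?thesis
    by (simp add: c_def algebra_simps)
qed

section \<open>From the symbol class to coefficient estimates\<close>

lemma coords: "distinct (coords :: 'n::finite list)" "set (coords :: 'n list) = UNIV"
proof -
  have "\<exists>js :: 'n list. distinct js \<and> set js = UNIV"
    using finite_distinct_list[of "UNIV :: 'n set"] by auto
  then show "distinct (coords :: 'n::finite list)" "set (coords :: 'n list) = UNIV"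
    unfolding coords_def by (metis (mono_tags, lifting) someI_ex)+
qed

text \<open>For a multi-index supported at one coordinate all other factors are identities, so the
  arbitrary enumeration \<open>coords\<close> drops out.\<close>

lemma foldr_single:
  assumes "\<And>j. j \<noteq> i \<Longrightarrow> F j = id"
  shows "i \<notin> set js \<Longrightarrow> foldr F js = id"
    and "distinct js \<Longrightarrow> i \<in> set js \<Longrightarrow> foldr F js = F i"
proof -
  show 1: "i \<notin> set js \<Longrightarrow> foldr F js = id" for js
    by (induction js) (use assms in auto)
  show "distinct js \<Longrightarrow> i \<in> set js \<Longrightarrow> foldr F js = F i"
  proof (induction js)
    case (Cons a js)
    then show ?case
      by (cases "a = i") (auto simp: assms 1)
  qed simp
qed

lemma multi_falling_deriv_single: "multi_falling_deriv (\<lambda>j. if j = i then l else 0) = falling_deriv i l"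
proof -
  have "falling_deriv j 0 = id" for j :: 'a by (simp add: fun_eq_iff)
  then show ?thesis
    unfolding multi_falling_deriv_def
    using foldr_single(2)[of i "\<lambda>j. falling_deriv j (if j = i then l else 0)" coords] by (simp add: coords)
qed

lemma multi_difference_single: "multi_difference (\<lambda>j. if j = i then 1 else 0) = difference i"
  unfolding multi_difference_def
  using foldr_single(2)[of i "\<lambda>j. difference j ^^ (if j = i then 1 else 0)" coords] by (simp add: coords)

lemma multi_difference_zero: "multi_difference (\<lambda>_. 0) = id"
proof -
  have "foldr (\<lambda>j. difference j ^^ 0) js = id" for js :: "'a list"
    by (induction js) auto
  then show ?thesis by (simp add: multi_difference_def)
qed

text \<open>Stated for a family of general order \<open>\<mu>\<close>, to cover both the symbol and
  its first differences.\<close>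

lemma symbol_family_decay:
  fixes \<tau> :: "int^'n::finite \<Rightarrow> real^'n \<Rightarrow> complex"
  assumes \<tau>: "\<And>k. C_infinity (\<tau> k)" "\<And>k. torus_periodic (\<tau> k)"
    and bound: "\<And>i l. \<exists>C. \<forall>k x. cmod (falling_deriv i l (\<tau> k) x) \<le> C * wt k powr \<mu>"
  shows "\<exists>C\<ge>0. \<forall>k j. cmod (torus_coeff (\<tau> k) j) \<le> C * wt k powr \<mu> * wt j powr (- N)"
proof -
  obtain l :: nat where l: "N \<le> real l"
    using real_arch_simple by blast
  have "\<forall>i. \<exists>C. \<forall>k x. cmod (falling_deriv i l (\<tau> k) x) \<le> C * wt k powr \<mu>"
    using bound by blast
  then obtain Cl where Cl: "\<And>i k x. cmod (falling_deriv i l (\<tau> k) x) \<le> Cl i * wt k powr \<mu>"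
    by metis
  \<comment> \<open>\<open>falling_deriv i 0\<close> is the identity for every \<open>i\<close>, so
    the arbitrary coordinate \<open>undefined\<close> yields the bound on \<open>\<tau>\<close>
    itself.\<close>
  obtain C0 where C0: "\<And>k x. cmod (\<tau> k x) \<le> C0 * wt k powr \<mu>"
    using bound[of undefined 0] by auto
  define B where "B = \<bar>C0\<bar> + (\<Sum>i\<in>UNIV. \<bar>Cl i\<bar>)"
  define A where "A = (real CARD('n) + 1) ^ l * (1 + real CARD('n) * (2 ^ l + (2 * real l) ^ l))"
  have A: "A \<ge> 0" by (simp add: A_def)
  have B: "B \<ge> 0" by (simp add: B_def sum_nonneg)
  have "cmod (torus_coeff (\<tau> k) j) \<le> A * B * wt k powr \<mu> * wt j powr (- N)" for k j
  proof -
    have "wt j ^ l * cmod (torus_coeff (\<tau> k) j) \<le> A * (B * wt k powr \<mu>)"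
      unfolding A_def
    proof (rule torus_coeff_decay[OF \<tau>])
      have "C0 \<le> B" by (simp add: B_def sum_nonneg add_increasing2)
      then show "cmod (\<tau> k x) \<le> B * wt k powr \<mu>" for x
        by (intro order_trans[OF C0] mult_right_mono) auto
      have "\<bar>Cl i\<bar> \<le> (\<Sum>i\<in>UNIV. \<bar>Cl i\<bar>)" for i
        by (rule member_le_sum) auto
      then have "Cl i \<le> B" for i
        unfolding B_def by (smt (verit))
      then show "cmod (falling_deriv i l (\<tau> k) x) \<le> B * wt k powr \<mu>" for i x
        by (intro order_trans[OF Cl] mult_right_mono) auto
    qed
    then have "cmod (torus_coeff (\<tau> k) j) \<le> A * B * wt k powr \<mu> * wt j powr (- real l)"
      by (simp add: powr_minus powr_realpow divide_simps mult_ac)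
    also have "\<dots> \<le> A * B * wt k powr \<mu> * wt j powr (- N)"
      using l A B by (intro mult_left_mono wt_powr_mono) auto
    finally show ?thesis .
  qed
  then show ?thesis
    using A B by (intro exI[of _ "A * B"]) auto
qed

lemma symbol_classD:
  assumes "\<sigma> \<in> symbol_class m"
  shows "torus_periodic (\<sigma> k)" "C_infinity (\<sigma> k)"
    and "\<exists>C. \<forall>k x. cmod (falling_deriv i l (\<sigma> k) x) \<le> C * wt k powr m"
    and "\<exists>C. \<forall>k x. cmod (falling_deriv i l (\<lambda>y. \<sigma> (k + axis i' 1) y - \<sigma> k y) x) \<le> C * wt k powr (m - 1)"
proof -
  show "torus_periodic (\<sigma> k)" "C_infinity (\<sigma> k)"
    using assms by (auto simp: symbol_class_def)
  have *: "\<exists>C. \<forall>k x. cmod (multi_falling_deriv \<beta> (\<lambda>y. multi_difference \<alpha> (\<lambda>l. \<sigma> l y) k) x)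
        \<le> C * wt k powr (m - real (multi_order \<alpha>))" for \<alpha> \<beta>
    using assms by (simp add: symbol_class_def wt_def)
  show "\<exists>C. \<forall>k x. cmod (falling_deriv i l (\<sigma> k) x) \<le> C * wt k powr m"
    using *[of "\<lambda>j. if j = i then l else 0" "\<lambda>_. 0"]
    by (simp add: multi_falling_deriv_single multi_difference_zero multi_order_def)
  show "\<exists>C. \<forall>k x. cmod (falling_deriv i l (\<lambda>y. \<sigma> (k + axis i' 1) y - \<sigma> k y) x) \<le> C * wt k powr (m - 1)"
    using *[of "\<lambda>j. if j = i then l else 0" "\<lambda>j. if j = i' then 1 else 0"]
    by (simp add: multi_falling_deriv_single multi_difference_single multi_order_def difference_def)
qed

text \<open>For \<open>j \<noteq> 0\<close> some \<open>j $ i\<close> is nonzero; the derivative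
  formula multiplies the coefficient by it, while the derivative of a constant vanishes.\<close>

lemma torus_coeff_one: "torus_coeff (\<lambda>_. 1) j = (if j = 0 then 1 else 0)"
proof (cases "j = 0")
  case True
  have "measure lborel (cbox (0 :: real^'a) 1) = 1"
    by (rule measure_unit_cube)
  then show ?thesis
    using True by (simp add: torus_coeff_def torus_integral_eq)
next
  case False
  then obtain i where i: "j $ i \<noteq> 0"
    by (auto simp: vec_eq_iff)
  have pd: "partial_deriv i (\<lambda>_ :: real^'a. c :: complex) = (\<lambda>_. 0)" for i c
    by (simp add: partial_deriv_def fun_eq_iff)
  have "C_times N (\<lambda>_ :: real^'a. c :: complex)" for N c
    by (induction N arbitrary: c) (auto simp: pd)
  then have "torus_coeff (partial_deriv i (\<lambda>_. 1)) j = - (2 * of_real pi * \<i> * of_int (j $ i)) * torus_coeff (\<lambda>_. 1) j"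
    by (intro torus_coeff_partial_deriv) (auto simp: C_infinity_def torus_periodic_def)
  moreover have "torus_coeff (partial_deriv i (\<lambda>_. 1)) j = 0"
    unfolding pd by (simp add: torus_coeff_def torus_integral_eq)
  ultimately show ?thesis
    using i False by simp
qed

text \<open>The form is the integral of \<open>g\<close> against \<open>|\<phi>|^2\<close>, where
  \<open>\<phi>\<close> is the trigonometric polynomial with coefficients \<open>v\<close>. The same
  identity for the constant 1 is Parseval's formula and evaluates the total mass.\<close>

lemma frozen_form_le:
  fixes g :: "real^'n::finite \<Rightarrow> complex"
  assumes g: "continuous_on UNIV g" and le: "\<And>x. Re (g x) \<le> b" and F: "finite F"
  shows "Re (\<Sum>k\<in>F. \<Sum>l\<in>F. cnj (v k) * torus_coeff g (k - l) * v l) \<le> b * nsq F v"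
proof -
  define \<phi> where "\<phi> = (\<lambda>x. \<Sum>k\<in>F. v k * torus_char (- k) x)"
  have cont\<phi>: "continuous_on UNIV (\<lambda>x. (cmod (\<phi> x))\<^sup>2)"
    unfolding \<phi>_def by (intro continuous_intros continuous_torus_char)
  have sq: "complex_of_real ((cmod (\<phi> x))\<^sup>2) = (\<Sum>k\<in>F. \<Sum>l\<in>F. cnj (v k) * v l * torus_char (k - l) x)" for x
  proof -
    have "complex_of_real ((cmod (\<phi> x))\<^sup>2) = cnj (\<phi> x) * \<phi> x"
      by (metis complex_norm_square mult.commute)
    also have "\<dots> = (\<Sum>k\<in>F. \<Sum>l\<in>F. cnj (v k * torus_char (- k) x) * (v l * torus_char (- l) x))"
      unfolding \<phi>_def cnj_sum sum_product by simp
    also have "\<dots> = (\<Sum>k\<in>F. \<Sum>l\<in>F. cnj (v k) * v l * torus_char (k - l) x)"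
      by (intro sum.cong refl)
        (simp add: torus_char_uminus torus_char_add[of _ "- _", simplified] mult_ac)
    finally show ?thesis .
  qed
  have form: "(\<Sum>k\<in>F. \<Sum>l\<in>F. cnj (v k) * torus_coeff h (k - l) * v l)
      = integral (cbox 0 1) (\<lambda>x. of_real ((cmod (\<phi> x))\<^sup>2) * h x)" if h: "continuous_on UNIV h" for h
  proof -
    have cont: "continuous_on UNIV (\<lambda>x. torus_char j x * h x)" for j
      using h by (intro continuous_intros continuous_torus_char)
    have "integral (cbox 0 1) (\<lambda>x. of_real ((cmod (\<phi> x))\<^sup>2) * h x)
        = integral (cbox 0 1) (\<lambda>x. \<Sum>k\<in>F. \<Sum>l\<in>F. (cnj (v k) * v l) * (torus_char (k - l) x * h x))"
      unfolding sq by (simp add: sum_distrib_right sum_distrib_left mult_ac)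
    also have "\<dots> = (\<Sum>k\<in>F. \<Sum>l\<in>F. integral (cbox 0 1) (\<lambda>x. (cnj (v k) * v l) * (torus_char (k - l) x * h x)))"
    proof -
      have "(\<lambda>x. c * (torus_char j x * h x)) integrable_on cbox 0 1" for c j
        by (intro integrable_on_mult_right torus_integral_eq cont)
      then show ?thesis
        using F by (simp add: integral_sum integrable_sum del: integral_mult_right)
    qed
    finally have e: "integral (cbox 0 1) (\<lambda>x. of_real ((cmod (\<phi> x))\<^sup>2) * h x)
        = (\<Sum>k\<in>F. \<Sum>l\<in>F. integral (cbox 0 1) (\<lambda>x. (cnj (v k) * v l) * (torus_char (k - l) x * h x)))" .
    show ?thesis
      unfolding e torus_coeff_def torus_integral_eq(1)[OF cont] integral_mult_right
      by (simp add: mult_ac)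
  qed
  have contg: "continuous_on UNIV (\<lambda>x. of_real ((cmod (\<phi> x))\<^sup>2) * g x)"
    by (intro continuous_intros cont\<phi> g)
  have "Re (\<Sum>k\<in>F. \<Sum>l\<in>F. cnj (v k) * torus_coeff g (k - l) * v l)
      = integral (cbox 0 1) (\<lambda>x. Re (of_real ((cmod (\<phi> x))\<^sup>2) * g x))"
    unfolding form[OF g]
    using integral_linear[OF torus_integral_eq(2)[OF contg] bounded_linear_Re] by (simp add: o_def)
  also have "\<dots> \<le> integral (cbox 0 1) (\<lambda>x. b * (cmod (\<phi> x))\<^sup>2)"
    using le by (intro integral_le integrable_continuous continuous_on_subset[where t = "cbox 0 1", where s = UNIV] continuous_intros contg cont\<phi>)
      (auto simp: mult.commute[of b] intro!: mult_left_mono)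
  also have "\<dots> = b * integral (cbox 0 1) (\<lambda>x. (cmod (\<phi> x))\<^sup>2)"
    by simp
  also have "integral (cbox 0 1) (\<lambda>x. (cmod (\<phi> x))\<^sup>2) = nsq F v"
  proof -
    have "complex_of_real (integral (cbox 0 1) (\<lambda>x. (cmod (\<phi> x))\<^sup>2)) = integral (cbox 0 1) (\<lambda>x. of_real ((cmod (\<phi> x))\<^sup>2) * 1)"
      using integral_linear[OF integrable_continuous[OF continuous_on_subset[OF cont\<phi>]] bounded_linear_of_real[where 'a = complex]]
      by (simp add: o_def)
    also have "\<dots> = (\<Sum>k\<in>F. \<Sum>l\<in>F. cnj (v k) * torus_coeff (\<lambda>_. 1) (k - l) * v l)"
      by (rule form[symmetric]) simp
    also have "\<dots> = (\<Sum>k\<in>F. \<Sum>l\<in>F. if l = k then cnj (v k) * v k else 0)"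
      by (intro sum.cong refl) (auto simp: torus_coeff_one)
    also have "\<dots> = (\<Sum>k\<in>F. of_real ((cmod (v k))\<^sup>2))"
      using F by (simp add: complex_norm_square mult.commute del: of_real_power)
    finally have "complex_of_real (integral (cbox 0 1) (\<lambda>x. (cmod (\<phi> x))\<^sup>2)) = of_real (nsq F v)"
      by (simp only: of_real_sum)
    then show ?thesis
      by (simp only: of_real_eq_iff)
  qed
  finally show ?thesis .
qed

lemma symbol_coeffs_of_symbol_class:
  fixes \<sigma> :: "int^'n::finite \<Rightarrow> real^'n \<Rightarrow> complex"
  assumes m: "m > 0" and \<sigma>: "\<sigma> \<in> symbol_class m"
    and ell: "\<exists>C0>0. \<exists>d0>0. \<forall>k x. norm (real_vec k) \<ge> d0 \<longrightarrow>
           \<sigma> k x \<in> \<real> \<and> - Re (\<sigma> k x) \<ge> C0 * norm (real_vec k) powr m"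
  shows "symbol_coeffs (\<lambda>k. torus_coeff (\<sigma> k)) m"
proof
  note \<sigma>D = symbol_classD[OF \<sigma>]
  show "m > 0" by fact
  show "\<exists>C\<ge>0. \<forall>k j. cmod (torus_coeff (\<sigma> k) j) \<le> C * wt k powr m * wt j powr (- N)" for N
    by (intro symbol_family_decay \<sigma>D)
  show "\<exists>C\<ge>0. \<forall>k j. cmod (torus_coeff (\<sigma> (k + axis i 1)) j - torus_coeff (\<sigma> k) j)
      \<le> C * wt k powr (m - 1) * wt j powr (- N)" for N i
  proof -
    have "\<exists>C\<ge>0. \<forall>k j. cmod (torus_coeff (\<lambda>y. \<sigma> (k + axis i 1) y - \<sigma> k y) j)
      \<le> C * wt k powr (m - 1) * wt j powr (- N)"
    proof (rule symbol_family_decay)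
      show "C_infinity (\<lambda>y. \<sigma> (k + axis i 1) y - \<sigma> k y)" for k
        using C_infinity_lin[OF \<sigma>D(2)[of "k + axis i 1"] \<sigma>D(2)[of k], of 1 "- 1"] by simp
      show "torus_periodic (\<lambda>y. \<sigma> (k + axis i 1) y - \<sigma> k y)" for k
        using \<sigma>D(1) by (simp add: torus_periodic_def)
    qed (rule \<sigma>D)
    moreover have "torus_coeff (\<lambda>y. \<sigma> (k + axis i 1) y - \<sigma> k y) j
        = torus_coeff (\<sigma> (k + axis i 1)) j - torus_coeff (\<sigma> k) j" for k j
      using torus_coeff_lin[OF C_infinity_continuous[OF \<sigma>D(2)] C_infinity_continuous[OF \<sigma>D(2)],
          where c = 1 and d = "- 1"] by simp
    ultimately show ?thesis by simp
  qed
  obtain c0 d0 where c0: "c0 > 0" "d0 > 0"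
    "\<And>k x. norm (real_vec k) \<ge> d0 \<Longrightarrow> - Re (\<sigma> k x) \<ge> c0 * norm (real_vec k) powr m"
    using ell by blast
  obtain C1 where C1: "\<And>k x. cmod (\<sigma> k x) \<le> C1 * wt k powr m"
    using \<sigma>D(3)[of undefined 0] by auto
  \<comment> \<open>Where the norm is at least 1 the weight is at most twice the norm; the factor
    \<open>2 powr (- m)\<close> converts one into the other.\<close>
  define c where "c = c0 * 2 powr (- m)"
  define R where "R = 1 + max d0 1"
  define C where "C = (\<bar>C1\<bar> + c) * R powr m"
  have c: "c > 0" using c0 by (simp add: c_def)
  have Re_le: "Re (\<sigma> p x) \<le> C - c * wt p powr m" for p x
  proof (cases "norm (real_vec p) \<ge> max d0 1")
    case True
    have "c * wt p powr m = c0 * (wt p / 2) powr m"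
      by (simp add: c_def powr_divide powr_minus divide_simps)
    also have "\<dots> \<le> c0 * norm (real_vec p) powr m"
      using c0 m True by (intro mult_left_mono powr_mono2) (auto simp: wt_def)
    also have "\<dots> \<le> - Re (\<sigma> p x)"
      using c0(3) True by simp
    finally have "Re (\<sigma> p x) \<le> - (c * wt p powr m)" by simp
    moreover have "C \<ge> 0"
      using c by (simp add: C_def)
    ultimately show ?thesis by simp
  next
    case False
    then have "wt p powr m \<le> R powr m"
      using m by (intro powr_mono2) (auto simp: wt_def R_def)
    then have "(\<bar>C1\<bar> + c) * wt p powr m \<le> C"
      unfolding C_def using c by (intro mult_left_mono) auto
    moreover have "Re (\<sigma> p x) \<le> \<bar>C1\<bar> * wt p powr m"
      by (intro order_trans[OF complex_Re_le_cmod] order_trans[OF C1] mult_right_mono) auto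
    ultimately show ?thesis by (simp add: algebra_simps)
  qed
  have "C \<ge> 0"
    using c by (simp add: C_def)
  then show "\<exists>c>0. \<exists>C\<ge>0. \<forall>p F v. finite F \<longrightarrow>
      Re (\<Sum>k\<in>F. \<Sum>l\<in>F. cnj (v k) * torus_coeff (\<sigma> p) (k - l) * v l)
        \<le> (C - c * wt p powr m) * nsq F v"
    using c frozen_form_le[OF C_infinity_continuous[OF \<sigma>D(2)] Re_le] by blast
qed

section \<open>Energy estimates for finite systems\<close>

text \<open>With the integrating factor, \<open>exp (- c * s) * (A + c * \<Phi> s)\<close> has
  nonpositive derivative and so stays below its initial value \<open>A\<close>.\<close>

lemma gronwall:
  fixes \<phi> :: "real \<Rightarrow> real"
  assumes cont: "continuous_on {0..t} \<phi>" and c: "c \<ge> 0"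
    and le: "\<And>s. s \<in> {0..t} \<Longrightarrow> \<phi> s \<le> A + c * integral {0..s} \<phi>" and s: "s \<in> {0..t}"
  shows "\<phi> s \<le> A * exp (c * s)"
proof -
  define \<Phi> where "\<Phi> = (\<lambda>s. integral {0..s} \<phi>)"
  define \<Psi> where "\<Psi> = (\<lambda>s. exp (- c * s) * (A + c * \<Phi> s))"
  have "\<Psi> s \<le> \<Psi> 0"
  proof (rule DERIV_nonpos_imp_decreasing_open[of 0 s \<Psi>])
    show "0 \<le> s" using s by simp
    fix r assume r: "0 < r" "r < s"
    then have r': "r \<in> {0..t}" "at r within {0..t} = at r"
      using s by (auto simp: at_within_Icc_at)
    have "(\<Phi> has_real_derivative \<phi> r) (at r)"
      using integral_has_real_derivative[OF cont r'(1)] r'(2) by (simp add: \<Phi>_def)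
    then have "(\<Psi> has_real_derivative exp (- c * r) * (c * \<phi> r - c * (A + c * \<Phi> r))) (at r)"
      unfolding \<Psi>_def by (auto intro!: derivative_eq_intros simp: algebra_simps)
    moreover have "c * \<phi> r \<le> c * (A + c * \<Phi> r)"
      using le[OF r'(1)] c by (simp add: \<Phi>_def mult_left_mono)
    then have "exp (- c * r) * (c * \<phi> r - c * (A + c * \<Phi> r)) \<le> 0"
      by (intro mult_nonneg_nonpos) auto
    ultimately show "\<exists>y. (\<Psi> has_real_derivative y) (at r) \<and> y \<le> 0"
      by blast
  next
    have "continuous_on {0..t} \<Phi>"
      unfolding \<Phi>_def by (intro indefinite_integral_continuous_1 integrable_continuous_interval cont)
    then show "continuous_on {0..s} \<Psi>"
      unfolding \<Psi>_def using s by (intro continuous_intros) (auto elim: continuous_on_subset)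
  qed
  then have "\<Psi> s \<le> A"
    by (simp add: \<Psi>_def \<Phi>_def)
  have "\<phi> s \<le> A + c * \<Phi> s"
    using le[OF s] by (simp add: \<Phi>_def)
  also have "\<dots> = \<Psi> s * exp (c * s)"
    by (simp add: \<Psi>_def exp_minus field_simps)
  also have "\<dots> \<le> A * exp (c * s)"
    using \<open>\<Psi> s \<le> A\<close> by (intro mult_right_mono) auto
  finally show ?thesis .
qed

text \<open>Telescoping over a fine uniform partition bounds the total change of \<open>D\<close> by
  \<open>e * (G t - G 0)\<close> for every \<open>e\<close>. This stands in for almost everywhere
  differentiability in the product rule.\<close>

lemma small_increments_imp_constant:
  fixes D G :: "real \<Rightarrow> real"
  assumes t: "t \<ge> 0"
    and incr: "\<And>e. e > 0 \<Longrightarrow> \<exists>d>0. \<forall>a b. 0 \<le> a \<longrightarrow> a \<le> b \<longrightarrow> b \<le> t \<longrightarrow> b - a < d \<longrightarrow>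
      \<bar>D b - D a\<bar> \<le> e * (G b - G a)"
  shows "D t = D 0"
proof -
  have "\<bar>D t - D 0\<bar> \<le> e * (G t - G 0)" if e: "e > 0" for e
  proof -
    obtain d where d: "d > 0" "\<And>a b. 0 \<le> a \<Longrightarrow> a \<le> b \<Longrightarrow> b \<le> t \<Longrightarrow> b - a < d \<Longrightarrow> \<bar>D b - D a\<bar> \<le> e * (G b - G a)"
      using incr[OF e] by blast
    obtain n0 :: nat where n0: "t / d < real n0"
      using reals_Archimedean2 by blast
    define n where "n = Suc n0"
    have n: "n > 0" "t / real n < d"
    proof -
      have "t / d < real n" using n0 by (simp add: n_def)
      then show "t / real n < d"
        using d(1) by (simp add: n_def field_simps)
    qed (simp add: n_def)
    define p where "p = (\<lambda>i. t * real i / real n)"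
    have "\<bar>D t - D 0\<bar> = \<bar>\<Sum>i<n. D (p (Suc i)) - D (p i)\<bar>"
      using n by (subst sum_lessThan_telescope) (simp add: p_def)
    also have "\<dots> \<le> (\<Sum>i<n. e * (G (p (Suc i)) - G (p i)))"
    proof (rule order_trans[OF sum_abs], rule sum_mono)
      fix i assume i: "i \<in> {..<n}"
      have "p (Suc i) - p i = t / real n"
        using n by (simp add: p_def field_simps)
      moreover have "p (Suc i) \<le> t"
      proof -
        have "real (Suc i) \<le> real n" using i by simp
        then have "t * real (Suc i) \<le> t * real n" using t by (intro mult_left_mono) auto
        then show ?thesis using n by (simp add: p_def divide_le_eq)
      qed
      moreover have "0 \<le> p i" "0 \<le> t / real n"
        using t by (auto simp: p_def)
      ultimately show "\<bar>D (p (Suc i)) - D (p i)\<bar> \<le> e * (G (p (Suc i)) - G (p i))"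
        using n(2) by (intro d(2)) linarith+
    qed
    also have "\<dots> = e * (G t - G 0)"
      unfolding sum_distrib_left[symmetric] using n by (subst sum_lessThan_telescope) (simp add: p_def)
    finally show ?thesis .
  qed
  then have "((\<lambda>e. e * (G t - G 0)) \<longlongrightarrow> 0 * (G t - G 0)) (at_right 0) \<Longrightarrow> \<bar>D t - D 0\<bar> \<le> 0"
    by (intro tendsto_lowerbound[where F = "at_right 0" and f = "\<lambda>e. e * (G t - G 0)"])
      (auto simp: eventually_at_filter)
  moreover have "((\<lambda>e. e * (G t - G 0)) \<longlongrightarrow> 0 * (G t - G 0)) (at_right 0)"
    by (intro tendsto_intros)
  ultimately show ?thesis by simp
qed

lemma absolutely_integrable_imp_integrable_subinterval:
  fixes f :: "real \<Rightarrow> 'a::euclidean_space"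
  assumes "f absolutely_integrable_on {0..T}" "0 \<le> a" "b \<le> T"
  shows "f integrable_on {a..b}"
  using assms by (meson absolutely_integrable_on_def atLeastatMost_subset_iff integrable_on_subinterval)

lemma absolutely_integrable_inner_continuous:
  fixes z g :: "real \<Rightarrow> 'a::euclidean_space"
  assumes "continuous_on {a..b} z" "g absolutely_integrable_on {a..b}"
  shows "(\<lambda>s. inner (z s) (g s)) absolutely_integrable_on {a..b}"
proof (rule absolutely_integrable_bounded_measurable_product[where h = inner and f = z and g = g])
  show "bilinear (inner :: 'a \<Rightarrow> 'a \<Rightarrow> real)"
    by (simp add: bilinear_conv_bounded_bilinear bounded_bilinear_inner)
  show "z \<in> borel_measurable (lebesgue_on {a..b})"
    by (intro continuous_imp_measurable_on_sets_lebesgue assms) auto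
  show "bounded (z ` {a..b})"
    by (intro compact_imp_bounded compact_continuous_image assms) auto
qed (use assms in auto)

text \<open>
  The product rule for indefinite integrals of merely integrable functions: over a short
  interval the error of freezing \<open>z\<close> at the end points is small compared with the integral
  of the norm of \<open>g\<close>.
\<close>

lemma norm_square_indefinite_integral:
  fixes z g :: "real \<Rightarrow> 'a::euclidean_space"
  assumes g: "g absolutely_integrable_on {0..T}"
    and z: "\<And>t. t \<in> {0..T} \<Longrightarrow> z t = z0 + integral {0..t} g" and t: "t \<in> {0..T}"
  shows "(norm (z t))\<^sup>2 = (norm z0)\<^sup>2 + 2 * integral {0..t} (\<lambda>s. inner (z s) (g s))"
    and "continuous_on {0..T} z"
proof -
  have gi: "g integrable_on {a..b}" if "0 \<le> a" "b \<le> T" for a b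
    by (rule absolutely_integrable_imp_integrable_subinterval[OF g that])
  have "continuous_on {0..T} (\<lambda>t. z0 + integral {0..t} g)"
    by (intro continuous_intros indefinite_integral_continuous_1 gi) auto
  then show cont: "continuous_on {0..T} z"
    by (rule continuous_on_eq) (simp add: z)
  define I where "I = (\<lambda>s. inner (z s) (g s))"
  have I: "I absolutely_integrable_on {0..T}"
    unfolding I_def by (rule absolutely_integrable_inner_continuous[OF cont g])
  have ng: "(\<lambda>s. norm (g s)) absolutely_integrable_on {0..T}"
    using g by (rule absolutely_integrable_norm[unfolded o_def])
  define D where "D = (\<lambda>s. (norm (z s))\<^sup>2 - 2 * integral {0..s} I)"
  define G where "G = (\<lambda>s. integral {0..s} (\<lambda>s. norm (g s)))"
  have sub: "f integrable_on {a..b}" if "f absolutely_integrable_on {0..T}" "0 \<le> a" "b \<le> T"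
    for a b and f :: "real \<Rightarrow> real"
    by (rule absolutely_integrable_imp_integrable_subinterval[OF that])
  have "D t = D 0"
  proof (rule small_increments_imp_constant[of t D G])
    show "t \<ge> 0" using t by simp
    fix e :: real assume e: "e > 0"
    have "uniformly_continuous_on {0..T} z"
      by (intro compact_uniformly_continuous cont) auto
    then obtain d where d: "d > 0" "\<And>x y. x \<in> {0..T} \<Longrightarrow> y \<in> {0..T} \<Longrightarrow> dist y x < d \<Longrightarrow> dist (z y) (z x) < e / 2"
      using e unfolding uniformly_continuous_on_def by (metis half_gt_zero)
    have "\<bar>D b - D a\<bar> \<le> e * (G b - G a)" if ab: "0 \<le> a" "a \<le> b" "b \<le> t" "b - a < d" for a b
    proof -
      have bT: "b \<le> T" using ab t by simp
      \<comment> \<open>The difference of the squared norms is the inner product of the increment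
        with \<open>z a + z b\<close>, which is close to twice \<open>z r\<close> for every
        \<open>r\<close> in between.\<close>
      define v where "v = z a + z b"
      have comb: "integral {0..b} f - integral {0..a} f = integral {a..b} f" if "f absolutely_integrable_on {0..T}" for f :: "real \<Rightarrow> real"
        using Henstock_Kurzweil_Integration.integral_combine[of 0 a b f] sub[OF that, of 0 b] ab bT by simp
      have "z b - z a = integral {a..b} g"
        using Henstock_Kurzweil_Integration.integral_combine[of 0 a b g] gi[of 0 b] ab bT z[of a] z[of b]
        by (simp add: diff_eq_eq add.commute)
      then have "(norm (z b))\<^sup>2 - (norm (z a))\<^sup>2 = inner (integral {a..b} g) v"
        by (simp add: v_def power2_norm_eq_inner algebra_simps inner_commute flip: \<open>z b - z a = _\<close>)
      also have "\<dots> = integral {a..b} (\<lambda>r. inner (g r) v)"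
        using integral_linear[OF gi[of a b] bounded_linear_inner_left[of v]] ab bT by (simp add: o_def)
      finally have 1: "(norm (z b))\<^sup>2 - (norm (z a))\<^sup>2 = integral {a..b} (\<lambda>r. inner (g r) v)" .
      have giv: "(\<lambda>r. inner (g r) v) integrable_on {a..b}"
        using integrable_linear[OF gi[of a b] bounded_linear_inner_left[of v]] ab bT by (simp add: o_def)
      have Iab: "I integrable_on {a..b}" "(\<lambda>r. norm (g r)) integrable_on {a..b}"
        using sub[OF I] sub[OF ng] ab bT by auto
      have "D b - D a = integral {a..b} (\<lambda>r. inner (g r) v) - 2 * integral {a..b} I"
        using 1 comb[OF I] by (simp add: D_def algebra_simps)
      also have "\<dots> = integral {a..b} (\<lambda>r. inner (g r) v - 2 * I r)"
        using giv Iab by (subst integral_diff) (auto intro!: integrable_on_mult_right)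
      finally have "norm (D b - D a) \<le> integral {a..b} (\<lambda>r. e * norm (g r))"
      proof (simp only:, intro integral_norm_bound_integral)
        show "(\<lambda>r. inner (g r) v - 2 * I r) integrable_on {a..b}" "(\<lambda>r. e * norm (g r)) integrable_on {a..b}"
          using giv Iab by (auto intro!: integrable_diff integrable_on_mult_right)
        fix r assume r: "r \<in> {a..b}"
        have "norm (v - 2 *\<^sub>R z r) \<le> norm (z a - z r) + norm (z b - z r)"
          using norm_triangle_ineq[of "z a - z r" "z b - z r"] by (simp add: v_def scaleR_2 algebra_simps)
        also have "\<dots> \<le> e / 2 + e / 2"
          using d(2)[of r a] d(2)[of r b] r ab bT
          by (intro add_mono less_imp_le) (auto simp: dist_norm)
        finally have "norm (v - 2 *\<^sub>R z r) \<le> e" by simp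
        then have "norm (inner (g r) (v - 2 *\<^sub>R z r)) \<le> norm (g r) * e"
          using Cauchy_Schwarz_ineq2[of "g r" "v - 2 *\<^sub>R z r"] mult_left_mono[of _ e "norm (g r)"]
          by fastforce
        then show "norm (inner (g r) v - 2 * I r) \<le> e * norm (g r)"
          by (simp add: I_def inner_diff_right inner_commute mult.commute)
      qed
      also have "\<dots> = e * (G b - G a)"
        using comb[OF ng] by (simp add: G_def)
      finally show ?thesis by simp
    qed
    then show "\<exists>d>0. \<forall>a b. 0 \<le> a \<longrightarrow> a \<le> b \<longrightarrow> b \<le> t \<longrightarrow> b - a < d \<longrightarrow> \<bar>D b - D a\<bar> \<le> e * (G b - G a)"
      using d(1) by blast
  qed
  moreover have "z 0 = z0"
    using z[of 0] t by simp
  ultimately show "(norm (z t))\<^sup>2 = (norm z0)\<^sup>2 + 2 * integral {0..t} (\<lambda>s. inner (z s) (g s))"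
    by (simp add: D_def I_def)
qed

text \<open>The equation is in integral form because the forcing \<open>g\<close> is merely
  integrable in time. The weight \<open>\<omega>\<close> will be a power of \<open>wt\<close>, so
  one argument serves all orders.\<close>

locale finite_system =
  fixes F :: "'k set" and K :: "'k \<Rightarrow> 'k \<Rightarrow> complex" and \<omega> :: "'k \<Rightarrow> real" and T C :: real
    and z g :: "'k \<Rightarrow> real \<Rightarrow> complex" and z0 :: "'k \<Rightarrow> complex"
  assumes fin: "finite F" and \<omega>: "\<And>k. \<omega> k \<ge> 0" and C: "C \<ge> 0"
    and cont: "\<And>k. k \<in> F \<Longrightarrow> continuous_on {0..T} (z k)"
    and g: "\<And>k. k \<in> F \<Longrightarrow> g k absolutely_integrable_on {0..T}"
    and z: "\<And>k t. k \<in> F \<Longrightarrow> t \<in> {0..T} \<Longrightarrow>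
      z k t = z0 k + integral {0..t} (\<lambda>s. (\<Sum>l\<in>F. K k l * z l s) + g k s)"
    and quad: "\<And>v. Re (\<Sum>k\<in>F. \<Sum>l\<in>F. of_real (\<omega> k) * cnj (v k) * K k l * v l) \<le> C * (\<Sum>k\<in>F. \<omega> k * (cmod (v k))\<^sup>2)"
begin

definition energy :: "real \<Rightarrow> real" where
  "energy t = (\<Sum>k\<in>F. \<omega> k * (cmod (z k t))\<^sup>2)"

definition energy0 :: real where
  "energy0 = (\<Sum>k\<in>F. \<omega> k * (cmod (z0 k))\<^sup>2)"

definition work :: "real \<Rightarrow> real" where
  "work s = (\<Sum>k\<in>F. \<omega> k * inner (z k s) (g k s))"

lemma continuous_energy: "continuous_on {0..T} energy"
  unfolding energy_def by (intro continuous_intros cont)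

lemma energy_nonneg: "energy t \<ge> 0" "energy0 \<ge> 0"
  unfolding energy_def energy0_def by (intro sum_nonneg mult_nonneg_nonneg \<omega>; simp)+

lemma work_integrable:
  assumes "t \<in> {0..T}" shows "work integrable_on {0..t}"
proof -
  have "work absolutely_integrable_on {0..T}"
    unfolding work_def
    by (intro absolutely_integrable_sum fin set_integrable_mult_right absolutely_integrable_inner_continuous cont g)
  then show ?thesis
    using assms by (intro absolutely_integrable_imp_integrable_subinterval) auto
qed

lemma energy_integrable:
  assumes "t \<in> {0..T}" shows "energy integrable_on {0..t}"
  using assms by (intro integrable_continuous_interval continuous_on_subset[OF continuous_energy]) auto

lemma energy_inequality:
  assumes t: "t \<in> {0..T}"
  shows "energy t \<le> energy0 + 2 * integral {0..t} (\<lambda>s. C * energy s + work s)"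
proof -
  define h where "h = (\<lambda>k s. (\<Sum>l\<in>F. K k l * z l s) + g k s)"
  have h: "h k absolutely_integrable_on {0..T}" if "k \<in> F" for k
    unfolding h_def using that
    by (intro set_integral_add absolutely_integrable_continuous_real continuous_intros cont g)
  have sq: "(cmod (z k t))\<^sup>2 = (cmod (z0 k))\<^sup>2 + 2 * integral {0..t} (\<lambda>s. inner (z k s) (h k s))" if "k \<in> F" for k
    using norm_square_indefinite_integral(1)[OF h[OF that] _ t, of "z k" "z0 k"] z[OF that] by (simp add: h_def)
  have int: "(\<lambda>s. inner (z k s) (h k s)) integrable_on {0..t}" if "k \<in> F" for k
  proof -
    have "(\<lambda>s. inner (z k s) (h k s)) absolutely_integrable_on {0..T}"
      by (intro absolutely_integrable_inner_continuous cont h that)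
    then show ?thesis
      using t by (intro absolutely_integrable_imp_integrable_subinterval) auto
  qed
  have "energy t = (\<Sum>k\<in>F. \<omega> k * (cmod (z0 k))\<^sup>2 + 2 * (\<omega> k * integral {0..t} (\<lambda>s. inner (z k s) (h k s))))"
    unfolding energy_def by (intro sum.cong refl) (simp add: sq algebra_simps)
  also have "\<dots> = energy0 + 2 * (\<Sum>k\<in>F. integral {0..t} (\<lambda>s. \<omega> k * inner (z k s) (h k s)))"
    by (simp add: sum.distrib energy0_def sum_distrib_left)
  also have "(\<Sum>k\<in>F. integral {0..t} (\<lambda>s. \<omega> k * inner (z k s) (h k s)))
      = integral {0..t} (\<lambda>s. \<Sum>k\<in>F. \<omega> k * inner (z k s) (h k s))"
    by (rule integral_sum[symmetric]) (intro fin integrable_on_mult_right int; assumption)+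
  also have "\<dots> \<le> integral {0..t} (\<lambda>s. C * energy s + work s)"
  proof (rule integral_le)
    show "(\<lambda>s. \<Sum>k\<in>F. \<omega> k * inner (z k s) (h k s)) integrable_on {0..t}"
      by (intro integrable_sum fin integrable_on_mult_right int)
    show "(\<lambda>s. C * energy s + work s) integrable_on {0..t}"
      by (intro integrable_add integrable_on_mult_right energy_integrable work_integrable t)
    fix s
    have Re_inner: "\<omega> k * inner (z k s) w = Re (of_real (\<omega> k) * cnj (z k s) * w)" for k w
      by (simp add: inner_complex_def algebra_simps)
    have "\<omega> k * inner (z k s) (h k s)
        = Re (\<Sum>l\<in>F. of_real (\<omega> k) * cnj (z k s) * K k l * z l s) + \<omega> k * inner (z k s) (g k s)" for k
      unfolding h_def inner_add_right distrib_left Re_inner[of k "\<Sum>l\<in>F. K k l * z l s"] sum_distrib_left mult.assoc ..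
    then have "(\<Sum>k\<in>F. \<omega> k * inner (z k s) (h k s))
        = Re (\<Sum>k\<in>F. \<Sum>l\<in>F. of_real (\<omega> k) * cnj (z k s) * K k l * z l s) + work s"
      by (simp add: work_def sum.distrib)
    also have "\<dots> \<le> C * energy s + work s"
      unfolding energy_def by (intro add_right_mono quad)
    finally show "(\<Sum>k\<in>F. \<omega> k * inner (z k s) (h k s)) \<le> C * energy s + work s" .
  qed
  finally show ?thesis by simp
qed

text \<open>Young's inequality bounds twice the work by the energy plus \<open>\<gamma>\<close>;
  this adds 1 to the Gronwall rate \<open>2 * C\<close>.\<close>

lemma energy_bound_L2:
  assumes t: "t \<in> {0..T}" and \<gamma>: "\<gamma> integrable_on {0..t}"
    and g\<gamma>: "\<And>s. s \<in> {0..t} \<Longrightarrow> (\<Sum>k\<in>F. \<omega> k * (cmod (g k s))\<^sup>2) \<le> \<gamma> s"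
  shows "energy t \<le> exp ((2 * C + 1) * t) * (energy0 + integral {0..t} \<gamma>)"
proof -
  have \<gamma>0: "\<gamma> s \<ge> 0" if "s \<in> {0..t}" for s
    by (rule order_trans[OF _ g\<gamma>[OF that]]) (intro sum_nonneg mult_nonneg_nonneg \<omega>; simp)
  have "energy s \<le> (energy0 + integral {0..t} \<gamma>) + (2 * C + 1) * integral {0..s} energy" if s: "s \<in> {0..t}" for s
  proof -
    have sT: "s \<in> {0..T}" using s t by auto
    have \<gamma>s: "\<gamma> integrable_on {0..s}"
      using \<gamma> s by (auto intro: integrable_on_subinterval)
    have "integral {0..s} (\<lambda>r. C * energy r + work r) \<le> integral {0..s} (\<lambda>r. (C + 1 / 2) * energy r + 1 / 2 * \<gamma> r)"
    proof (rule integral_le)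
      fix r assume r: "r \<in> {0..s}"
      have "work r \<le> (\<Sum>k\<in>F. \<omega> k * (((cmod (z k r))\<^sup>2 + (cmod (g k r))\<^sup>2) / 2))"
        unfolding work_def
      proof (intro sum_mono mult_left_mono \<omega>)
        fix k
        have "inner (z k r) (g k r) \<le> cmod (z k r) * cmod (g k r)"
          by (rule norm_cauchy_schwarz)
        also have "\<dots> \<le> ((cmod (z k r))\<^sup>2 + (cmod (g k r))\<^sup>2) / 2"
          using sum_squares_bound[of "cmod (z k r)" "cmod (g k r)"] by simp
        finally show "inner (z k r) (g k r) \<le> ((cmod (z k r))\<^sup>2 + (cmod (g k r))\<^sup>2) / 2" .
      qed
      also have "\<dots> = 1 / 2 * energy r + 1 / 2 * (\<Sum>k\<in>F. \<omega> k * (cmod (g k r))\<^sup>2)"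
        unfolding energy_def by (simp add: distrib_left add_divide_distrib sum.distrib sum_divide_distrib)
      also have "\<dots> \<le> 1 / 2 * energy r + 1 / 2 * \<gamma> r"
        using g\<gamma>[of r] r s by (intro add_left_mono mult_left_mono) auto
      finally show "C * energy r + work r \<le> (C + 1 / 2) * energy r + 1 / 2 * \<gamma> r"
        by (simp add: algebra_simps)
    qed (intro integrable_add integrable_on_mult_right energy_integrable work_integrable sT \<gamma>s)+
    also have "\<dots> = (C + 1 / 2) * integral {0..s} energy + 1 / 2 * integral {0..s} \<gamma>"
      by (subst integral_add) (auto intro!: integrable_on_mult_right energy_integrable sT \<gamma>s)
    also have "integral {0..s} \<gamma> \<le> integral {0..t} \<gamma>"
      using s \<gamma>0 by (intro integral_subset_le \<gamma> \<gamma>s) auto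
    finally show ?thesis
      using energy_inequality[OF sT] by (simp add: algebra_simps)
  qed
  then have "energy t \<le> (energy0 + integral {0..t} \<gamma>) * exp ((2 * C + 1) * t)"
    using t C by (intro gronwall[of t]) (auto intro: continuous_on_subset[OF continuous_energy])
  then show ?thesis by (simp add: mult.commute)
qed

text \<open>For forcing that is only integrable in time the work is linear in
  \<open>\<gamma>\<close>, so the factor coming from the solution is pulled out at its maximum. The
  result is a quadratic inequality for the root \<open>b\<close> of the maximal energy.\<close>

lemma energy_bound_L1:
  assumes \<gamma>: "\<gamma> integrable_on {0..T}" and \<gamma>0: "\<And>s. s \<in> {0..T} \<Longrightarrow> \<gamma> s \<ge> 0"
    and g\<gamma>: "\<And>s. s \<in> {0..T} \<Longrightarrow> (\<Sum>k\<in>F. \<omega> k * (cmod (g k s))\<^sup>2) \<le> (\<gamma> s)\<^sup>2"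
    and t: "t \<in> {0..T}"
  shows "energy t \<le> 2 * exp (2 * C * T) * energy0 + 4 * (exp (2 * C * T))\<^sup>2 * (integral {0..T} \<gamma>)\<^sup>2"
proof -
  define E where "E = exp (2 * C * T)"
  define \<Gamma> where "\<Gamma> = integral {0..T} \<gamma>"
  have E: "E > 0" by (simp add: E_def)
  have \<Gamma>: "\<Gamma> \<ge> 0" unfolding \<Gamma>_def using \<gamma> \<gamma>0 by (intro integral_nonneg) auto
  obtain t1 where t1: "t1 \<in> {0..T}" "\<And>s. s \<in> {0..T} \<Longrightarrow> energy s \<le> energy t1"
    using continuous_attains_sup[OF _ _ continuous_energy] t by force
  define b where "b = sqrt (energy t1)"
  have b: "b \<ge> 0" "b\<^sup>2 = energy t1"
    by (simp_all add: b_def energy_nonneg)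
  have work_le: "work r \<le> b * \<gamma> r" if r: "r \<in> {0..T}" for r
  proof -
    have "work r = (\<Sum>k\<in>F. (sqrt (\<omega> k) * 1) * (sqrt (\<omega> k) * inner (z k r) (g k r)))"
      unfolding work_def by (simp add: \<omega> flip: mult.assoc)
    also have "\<dots> \<le> (\<Sum>k\<in>F. (sqrt (\<omega> k) * cmod (z k r)) * (sqrt (\<omega> k) * cmod (g k r)))"
    proof (intro sum_mono)
      fix k
      have "\<omega> k * inner (z k r) (g k r) \<le> \<omega> k * (cmod (z k r) * cmod (g k r))"
        by (intro mult_left_mono norm_cauchy_schwarz \<omega>)
      moreover have "\<omega> k * x = sqrt (\<omega> k) * (sqrt (\<omega> k) * x)" for x
        by (simp add: \<omega> flip: mult.assoc)
      ultimately show "(sqrt (\<omega> k) * 1) * (sqrt (\<omega> k) * inner (z k r) (g k r))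
          \<le> (sqrt (\<omega> k) * cmod (z k r)) * (sqrt (\<omega> k) * cmod (g k r))"
        by (metis mult.assoc mult.left_commute mult.right_neutral)
    qed
    also have "\<dots> \<le> sqrt ((\<Sum>k\<in>F. (sqrt (\<omega> k) * cmod (z k r))\<^sup>2) * (\<Sum>k\<in>F. (sqrt (\<omega> k) * cmod (g k r))\<^sup>2))"
      by (rule real_le_rsqrt[OF Cauchy_Schwarz_ineq_sum])
    also have "\<dots> = sqrt (energy r) * sqrt (\<Sum>k\<in>F. \<omega> k * (cmod (g k r))\<^sup>2)"
      unfolding energy_def by (simp add: power_mult_distrib \<omega> real_sqrt_mult)
    also have "\<dots> \<le> b * \<gamma> r"
      unfolding b_def using t1(2)[OF r] g\<gamma>[OF r] \<gamma>0[OF r]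
      by (intro mult_mono) (auto simp: energy_nonneg \<omega> intro!: real_le_lsqrt sum_nonneg)
    finally show ?thesis .
  qed
  have "energy s \<le> (energy0 + 2 * b * \<Gamma>) + (2 * C) * integral {0..s} energy" if s: "s \<in> {0..T}" for s
  proof -
    have \<gamma>s: "\<gamma> integrable_on {0..s}"
      using \<gamma> s by (auto intro: integrable_on_subinterval)
    have "integral {0..s} (\<lambda>r. C * energy r + work r) \<le> integral {0..s} (\<lambda>r. C * energy r + b * \<gamma> r)"
      by (intro integral_le integrable_add integrable_on_mult_right energy_integrable work_integrable s \<gamma>s)
         (use work_le s in auto)
    also have "\<dots> = C * integral {0..s} energy + b * integral {0..s} \<gamma>"
      by (subst integral_add) (auto intro!: integrable_on_mult_right energy_integrable s \<gamma>s)
    also have "b * integral {0..s} \<gamma> \<le> b * \<Gamma>"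
      unfolding \<Gamma>_def using s \<gamma>0 b by (intro mult_left_mono integral_subset_le \<gamma> \<gamma>s) auto
    finally show ?thesis
      using energy_inequality[OF s] by (simp add: algebra_simps)
  qed
  then have "energy t1 \<le> (energy0 + 2 * b * \<Gamma>) * exp (2 * C * t1)"
    using t1 C by (intro gronwall[of T]) (auto intro: continuous_on_subset[OF continuous_energy])
  also have "\<dots> \<le> (energy0 + 2 * b * \<Gamma>) * E"
    unfolding E_def using t1 C b \<Gamma> by (intro mult_left_mono) (auto simp: energy_nonneg mult_left_mono)
  finally have "b\<^sup>2 \<le> E * energy0 + 2 * b * (E * \<Gamma>)"
    using b by (simp add: algebra_simps)
  \<comment> \<open>Completing the square gives
    \<open>2 * b * (E * \<Gamma>) \<le> b^2 / 2 + 2 * (E * \<Gamma>)^2\<close>; half of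
    \<open>b^2\<close> then moves to the left.\<close>
  moreover have "0 \<le> (b - 2 * (E * \<Gamma>))\<^sup>2" by simp
  ultimately have "b\<^sup>2 \<le> 2 * E * energy0 + 4 * E\<^sup>2 * \<Gamma>\<^sup>2"
    by (simp add: power2_eq_square algebra_simps)
  then show ?thesis
    using t1(2)[OF t] b by (simp add: E_def \<Gamma>_def)
qed

end

text \<open>In the norm weighted by \<open>exp (2 * c * t)\<close> one integration against
  \<open>M\<close> gains the factor \<open>c / (2 * c) = 1 / 2\<close>, so the Neumann series
  converges on the whole interval at once.\<close>

lemma volterra_solution:
  fixes M :: "'a::banach \<Rightarrow> 'a" and h :: "real \<Rightarrow> 'a"
  assumes M: "bounded_linear M" and h: "continuous_on {0..T} h"
  shows "\<exists>u. continuous_on {0..T} u \<and> (\<forall>t\<in>{0..T}. u t = h t + integral {0..t} (\<lambda>s. M (u s)))"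
proof -
  obtain c where c: "c > 0" "\<And>x. norm (M x) \<le> norm x * c"
    using bounded_linear.pos_bounded[OF M] by blast
  obtain B where B: "B > 0" "\<And>t. t \<in> {0..T} \<Longrightarrow> norm (h t) \<le> B"
  proof -
    have "bounded (h ` {0..T})"
      by (intro compact_imp_bounded compact_continuous_image h) auto
    then show ?thesis
      using that unfolding bounded_pos by blast
  qed
  \<comment> \<open>\<open>d n\<close> is the \<open>n\<close>-th increment of the Picard iteration,
    so the solution is the sum of the series.\<close>
  define d where "d = rec_nat h (\<lambda>_ f t. integral {0..t} (\<lambda>s. M (f s)))"
  have d: "d 0 = h" "d (Suc n) = (\<lambda>t. integral {0..t} (\<lambda>s. M (d n s)))" for n
    by (simp_all add: d_def)
  have Mc: "continuous_on S (\<lambda>s. M (f s))" if "continuous_on S f" for f :: "real \<Rightarrow> 'a" and S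
    using bounded_linear.continuous_on[OF M that] .
  have cont: "continuous_on {0..T} (d n)" for n
    by (induction n) (auto simp: d h intro!: indefinite_integral_continuous_1 integrable_continuous_interval Mc)
  have bound: "norm (d n t) \<le> B * (1 / 2) ^ n * exp (2 * c * t)" if "t \<in> {0..T}" for n t
    using that
  proof (induction n arbitrary: t)
    case 0
    have "1 \<le> exp (2 * c * t)" using c 0 by simp
    then have "B \<le> B * exp (2 * c * t)"
      using B(1) by simp
    then show ?case
      using B(2)[OF 0] by (simp add: d)
  next
    case (Suc n)
    have fi: "((\<lambda>s. B * (1 / 2) ^ n * c * exp (2 * c * s)) has_integral
        B * (1 / 2) ^ Suc n * exp (2 * c * t) - B * (1 / 2) ^ Suc n * exp (2 * c * 0)) {0..t}"
    proof (rule fundamental_theorem_of_calculus)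
      fix s
      have "((\<lambda>s. B * (1 / 2) ^ Suc n * exp (2 * c * s)) has_real_derivative B * (1 / 2) ^ n * c * exp (2 * c * s))
          (at s within {0..t})"
        by (auto intro!: derivative_eq_intros)
      then show "((\<lambda>s. B * (1 / 2) ^ Suc n * exp (2 * c * s)) has_vector_derivative B * (1 / 2) ^ n * c * exp (2 * c * s))
          (at s within {0..t})"
        by (simp only: has_real_derivative_iff_has_vector_derivative)
    qed (use Suc.prems in simp)
    have "norm (d (Suc n) t) \<le> integral {0..t} (\<lambda>s. B * (1 / 2) ^ n * c * exp (2 * c * s))"
      unfolding d
    proof (rule integral_norm_bound_integral)
      show "(\<lambda>s. M (d n s)) integrable_on {0..t}"
        using Suc.prems by (intro integrable_continuous_interval Mc continuous_on_subset[OF cont]) auto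
      show "(\<lambda>s. B * (1 / 2) ^ n * c * exp (2 * c * s)) integrable_on {0..t}"
        using fi by blast
      fix s assume "s \<in> {0..t}"
      then have "norm (d n s) * c \<le> B * (1 / 2) ^ n * exp (2 * c * s) * c"
        using c Suc by (intro mult_right_mono Suc.IH) auto
      then show "norm (M (d n s)) \<le> B * (1 / 2) ^ n * c * exp (2 * c * s)"
        using c(2)[of "d n s"] by (simp add: mult_ac)
    qed
    also have "\<dots> \<le> B * (1 / 2) ^ Suc n * exp (2 * c * t)"
      using integral_unique[OF fi] B by simp
    finally show ?case .
  qed
  define u where "u = (\<lambda>t. \<Sum>n. d n t)"
  have lim: "uniform_limit {0..T} (\<lambda>n t. \<Sum>i<n. d i t) u sequentially"
    unfolding u_def
  proof (rule Weierstrass_m_test)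
    fix n t assume t: "t \<in> {0..T}"
    then have "exp (2 * c * t) \<le> exp (2 * c * T)" using c by simp
    then show "norm (d n t) \<le> B * exp (2 * c * T) * (1 / 2) ^ n"
      using B by (intro order_trans[OF bound[OF t]]) (simp add: mult_ac mult_left_mono)
  qed (intro summable_mult summable_geometric, simp)
  have contu: "continuous_on {0..T} u"
    by (rule uniform_limit_theorem[OF _ lim]) (auto intro!: always_eventually continuous_intros cont)
  have "u t = h t + integral {0..t} (\<lambda>s. M (u s))" if t: "t \<in> {0..T}" for t
  proof -
    have sub: "{0..t} \<subseteq> {0..T}" using t by auto
    have "uniform_limit {0..t} (\<lambda>n s. M (\<Sum>i<n. d i s)) (\<lambda>s. M (u s)) sequentially"
      by (intro bounded_linear_uniform_limit_intros M uniform_limit_on_subset[OF lim] sub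
          bounded_linear.uniform_limit[OF M])
    then obtain I J where I: "\<And>n. ((\<lambda>s. M (\<Sum>i<n. d i s)) has_integral I n) {0..t}"
      "((\<lambda>s. M (u s)) has_integral J) {0..t}" "I \<longlonglongrightarrow> J"
      by (rule uniform_limit_integral)
        (auto intro!: Mc continuous_intros continuous_on_subset[OF cont] sub[THEN subsetD])
    have "I n = (\<Sum>i<n. d (Suc i) t)" for n
    proof -
      have "((\<lambda>s. \<Sum>i<n. M (d i s)) has_integral (\<Sum>i<n. d (Suc i) t)) {0..t}"
        unfolding d
        by (intro has_integral_sum integrable_integral integrable_continuous_interval Mc continuous_on_subset[OF cont] sub) auto
      then show ?thesis
        using I(1)[of n] M by (simp add: linear_sum bounded_linear.linear has_integral_unique)
    qed
    then have "h t + I n = (\<Sum>i<Suc n. d i t)" for n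
      by (simp add: sum.lessThan_Suc_shift d(1) del: sum.lessThan_Suc)
    moreover have "(\<lambda>n. \<Sum>i<Suc n. d i t) \<longlonglongrightarrow> u t"
      using tendsto_uniform_limitI[OF lim t] by (rule LIMSEQ_Suc)
    moreover have "(\<lambda>n. h t + I n) \<longlonglongrightarrow> h t + J"
      by (intro tendsto_intros I)
    ultimately have "u t = h t + J"
      by (intro LIMSEQ_unique[of "\<lambda>n. \<Sum>i<Suc n. d i t"]) simp_all
    then show ?thesis
      using I(2) by (simp add: integral_unique)
  qed
  with contu show ?thesis by blast
qed

section \<open>Galerkin approximation\<close>

definition ket :: "'k \<Rightarrow> complex \<Rightarrow> 'k ell2" where
  "ket k z = Abs_ell2 (\<lambda>j. if j = k then z else 0)"

lemma ell2_apply_ket [simp]: "ell2_apply (ket k z) j = (if j = k then z else 0)"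
proof -
  have "(\<lambda>j. (cmod (if j = k then z else 0))\<^sup>2) summable_on UNIV"
    by (rule finite_nonzero_values_imp_summable_on) (auto intro: finite_subset[of _ "{k}"] split: if_splits)
  then show ?thesis
    unfolding ket_def by (simp add: Abs_ell2_inverse)
qed

lemma ell2_apply_sum [simp]: "ell2_apply (\<Sum>i\<in>I. f i) k = (\<Sum>i\<in>I. ell2_apply (f i) k)"
  by (induction I rule: infinite_finite_induct) auto

lemma bounded_linear_ell2_apply: "bounded_linear (\<lambda>u. ell2_apply u k)"
  by (rule bounded_linear_intro[of _ 1]) (auto simp: ell2_apply_norm_le)

lemma bounded_linear_ket: "bounded_linear (ket k)"
proof (rule bounded_linear_intro[of _ 1])
  fix z
  show "norm (ket k z) \<le> norm z * 1"
  proof (rule norm_ell2_leI)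
    fix F :: "'a set" assume "finite F"
    then have "nsq F (ell2_apply (ket k z)) = (if k \<in> F then (cmod z)\<^sup>2 else 0)"
      by (simp add: if_distrib[of cmod] if_distrib[of "\<lambda>x. x\<^sup>2"] cong: if_cong)
    then show "nsq F (ell2_apply (ket k z)) \<le> (norm z * 1)\<^sup>2"
      by simp
  qed simp
qed (auto intro!: ell2_eqI)

definition trunc :: "'k set \<Rightarrow> 'k ell2 \<Rightarrow> 'k ell2" where
  "trunc F u = (\<Sum>k\<in>F. ket k (ell2_apply u k))"

lemma ell2_apply_trunc: "finite F \<Longrightarrow> ell2_apply (trunc F u) k = (if k \<in> F then ell2_apply u k else 0)"
  by (simp add: trunc_def)

lemma bounded_linear_trunc: "bounded_linear (trunc F)"
  unfolding trunc_def
  by (intro bounded_linear_sum bounded_linear_compose[OF bounded_linear_ket] bounded_linear_ell2_apply)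

lemma norm_ell2_finite:
  assumes "finite F" "\<And>k. k \<notin> F \<Longrightarrow> ell2_apply u k = 0"
  shows "(norm u)\<^sup>2 = nsq F (ell2_apply u)"
proof -
  have "(norm u)\<^sup>2 = (\<Sum>\<^sub>\<infinity>k\<in>F. (cmod (ell2_apply u k))\<^sup>2)"
    unfolding norm_ell2_power2 using assms(2) by (intro infsum_cong_neutral) auto
  then show ?thesis using assms(1) by simp
qed

lemma norm_diff_trunc_le:
  assumes "finite F"
  shows "(norm (u - trunc F u))\<^sup>2 \<le> (norm u)\<^sup>2 - nsq F (ell2_apply u)"
  unfolding norm_ell2_power2[of "u - trunc F u"]
proof (rule infsum_le_finite_sums[OF ell2_summable])
  fix H :: "'a set" assume H: "finite H" "H \<subseteq> UNIV"
  have "nsq H (ell2_apply (u - trunc F u)) = nsq (H - F) (ell2_apply u)"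
    using assms H by (intro sum.mono_neutral_cong_right) (auto simp: ell2_apply_trunc)
  moreover have "nsq (H - F) (ell2_apply u) + nsq F (ell2_apply u)
      = nsq ((H - F) \<union> F) (ell2_apply u)"
    using assms H by (subst sum.union_disjoint) auto
  moreover have "\<dots> \<le> (norm u)\<^sup>2"
    using assms H by (intro ell2_finite_sum_le) auto
  ultimately show "nsq H (ell2_apply (u - trunc F u)) \<le> (norm u)\<^sup>2 - nsq F (ell2_apply u)"
    by simp
qed

lemma norm_diff_trunc_le_norm:
  assumes "finite F"
  shows "norm (u - trunc F u) \<le> norm u"
proof (rule power2_le_imp_le)
  have "0 \<le> nsq F (ell2_apply u)"
    by (simp add: sum_nonneg)
  then show "(norm (u - trunc F u))\<^sup>2 \<le> (norm u)\<^sup>2"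
    using norm_diff_trunc_le[OF assms, of u] by linarith
qed simp

definition cube :: "nat \<Rightarrow> (int^'n::finite) set" where
  "cube N = {k. \<forall>i. k $ i \<in> {- int N..int N}}"

lemma finite_cube [simp]: "finite (cube N)"
  unfolding cube_def by (rule card_int_box) auto

lemma cube_mono: "M \<le> N \<Longrightarrow> cube M \<subseteq> cube N"
proof -
  assume "M \<le> N"
  then have "{- int M..int M} \<subseteq> {- int N..int N}" by auto
  then show ?thesis
    unfolding cube_def by blast
qed

text \<open>Used to trade one order of the weight for a factor \<open>1 / Suc N\<close> on
  tails.\<close>

lemma wt_outside_cube: "k \<notin> cube N \<Longrightarrow> real (Suc N) \<le> wt k"
proof -
  assume "k \<notin> cube N"
  then obtain i where "k $ i \<notin> {- int N..int N}"
    by (auto simp: cube_def)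
  then have "int N < \<bar>k $ i\<bar>" by auto
  then have "real N \<le> \<bar>real_of_int (k $ i)\<bar>" by linarith
  then show ?thesis
    using abs_component_le_wt[of k i] by simp
qed

lemma eventually_subset_cube:
  fixes F :: "(int^'n::finite) set"
  assumes "finite F"
  shows "\<forall>\<^sub>F N in sequentially. F \<subseteq> cube N"
proof -
  define R where "R = Max (insert 0 ((\<lambda>(j, i). nat \<bar>j $ i\<bar>) ` (F \<times> UNIV)))"
  have "j \<in> cube R" if "j \<in> F" for j
  proof -
    have "nat \<bar>j $ i\<bar> \<le> R" for i
      unfolding R_def using that assms by (intro Max_ge) (auto intro!: image_eqI[of _ _ "(j, i)"])
    then have "\<bar>j $ i\<bar> \<le> int R" for i
      by (simp add: nat_le_iff)
    then show ?thesis
      by (auto simp: cube_def abs_le_iff minus_le_iff)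
  qed
  then show ?thesis
    using cube_mono by (intro eventually_sequentiallyI[of R]) blast
qed

lemma trunc_tendsto:
  fixes u :: "(int^'n::finite) ell2"
  shows "(\<lambda>N. norm (u - trunc (cube N) u)) \<longlonglongrightarrow> 0"
proof (rule LIMSEQ_I)
  fix e :: real assume e: "e > 0"
  obtain F where F: "finite F"
    "dist (nsq F (ell2_apply u)) ((norm u)\<^sup>2) \<le> e\<^sup>2 / 2"
    using infsum_finite_approximation[OF ell2_summable[of u], of "e\<^sup>2 / 2"] e
    unfolding norm_ell2_power2 by auto
  obtain N0 where N0: "\<And>N. N \<ge> N0 \<Longrightarrow> F \<subseteq> cube N"
    using eventually_subset_cube[OF F(1)] by (auto simp: eventually_sequentially)
  have "norm (u - trunc (cube N) u) < e" if "N \<ge> N0" for N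
  proof -
    have "nsq F (ell2_apply u) \<le> nsq (cube N) (ell2_apply u)"
      using N0[OF that] by (intro sum_mono2) auto
    then have "(norm (u - trunc (cube N) u))\<^sup>2 \<le> e\<^sup>2 / 2"
      using norm_diff_trunc_le[OF finite_cube, of u N] F(2) unfolding dist_real_def by linarith
    also have "\<dots> < e\<^sup>2" using e by simp
    finally show ?thesis
      using e by (intro power2_less_imp_less[of _ e]) auto
  qed
  then show "\<exists>no. \<forall>n\<ge>no. norm (norm (u - trunc (cube n) u) - 0) < e"
    by (intro exI[of _ N0]) auto
qed

lemma continuous_on_ell2_apply: "continuous_on S u \<Longrightarrow> continuous_on S (\<lambda>s. ell2_apply (u s) k)"
  by (rule bounded_linear.continuous_on[OF bounded_linear_ell2_apply])

lemma set_integrable_bounded_linear: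
  fixes h :: "'c::{banach,second_countable_topology} \<Rightarrow> 'd::{banach,second_countable_topology}"
  assumes "bounded_linear h" "set_integrable M A f"
  shows "set_integrable M A (\<lambda>x. h (f x))"
  using integrable_bounded_linear[OF assms(1) assms(2)[unfolded set_integrable_def]]
  unfolding set_integrable_def by (simp add: linear_scale[OF bounded_linear.linear[OF assms(1)]])

text \<open>The constants are functions of the order, so that later definitions can name them. Since
  \<open>garding_const\<close> does not depend on \<open>F\<close>, all principal submatrices share
  it.\<close>

locale parabolic_matrix =
  fixes K :: "int^'n::finite \<Rightarrow> int^'n \<Rightarrow> complex" and m :: real
    and decay_const garding_const :: "real \<Rightarrow> real" and T :: real
  assumes m_pos: "m > 0" and T_pos: "T > 0"
    and decay: "\<And>N. decay_const N \<ge> 0"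
      "\<And>N k l. cmod (K k l) \<le> decay_const N * wt k powr m * wt (k - l) powr (- N)"
    and garding: "\<And>s. garding_const s \<ge> 0"
      "\<And>s F v. finite F \<Longrightarrow> Re (\<Sum>k\<in>F. \<Sum>l\<in>F. of_real (wt k powr (2 * s)) * cnj (v k) * K k l * v l)
         \<le> garding_const s * wsq s F v"
begin

definition op_const :: "real \<Rightarrow> real" where
  "op_const s = decay_const (summ_exp TYPE('n) + \<bar>s\<bar>) * wt_sum TYPE('n)"

lemma op_const_nonneg: "op_const s \<ge> 0"
  unfolding op_const_def using decay(1) wt_sum_pos[where 'n = 'n] by (simp add: less_imp_le)

lemma finite_bound:
  assumes "finite F" "finite G"
  shows "(\<Sum>k\<in>F. wt k powr (2 * (s - m)) * (\<Sum>l\<in>G. cmod (K k l) * cmod (u l))\<^sup>2)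
       \<le> (op_const s)\<^sup>2 * wsq s G u"
  unfolding op_const_def by (rule matrix_bound_finite[OF decay(2,1) assms])

definition op_at :: "(int^'n) ell2 \<Rightarrow> int^'n \<Rightarrow> complex" where
  "op_at u k = (\<Sum>\<^sub>\<infinity>l. K k l * ell2_apply u l)"

lemma op_summable: "(\<lambda>l. norm (K k l * ell2_apply u l)) summable_on UNIV"
proof -
  define B where "B = op_const 0"
  have "(\<Sum>l\<in>G. norm (K k l * ell2_apply u l)) \<le> wt k powr m * (B * norm u)" if G: "finite G" for G
  proof (rule power2_le_imp_le)
    have one: "(wt k powr m)\<^sup>2 * wt k powr (2 * (0 - m)) = 1"
      unfolding power2_eq_square powr_add[symmetric] by simp
    have "wt k powr (2 * (0 - m)) * (\<Sum>l\<in>G. cmod (K k l) * cmod (ell2_apply u l))\<^sup>2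
        \<le> B\<^sup>2 * nsq G (ell2_apply u)"
      using finite_bound[of "{k}" G 0 "ell2_apply u"] G by (simp add: B_def)
    also have "\<dots> \<le> B\<^sup>2 * (norm u)\<^sup>2"
      using G by (intro mult_left_mono ell2_finite_sum_le) auto
    finally have "(wt k powr m)\<^sup>2 * (wt k powr (2 * (0 - m)) * (\<Sum>l\<in>G. cmod (K k l) * cmod (ell2_apply u l))\<^sup>2)
        \<le> (wt k powr m)\<^sup>2 * (B\<^sup>2 * (norm u)\<^sup>2)"
      by (intro mult_left_mono) auto
    from this[unfolded mult.assoc[symmetric] one]
    show "(\<Sum>l\<in>G. norm (K k l * ell2_apply u l))\<^sup>2 \<le> (wt k powr m * (B * norm u))\<^sup>2"
      by (simp add: norm_mult power_mult_distrib mult_ac)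
  qed (simp add: B_def op_const_nonneg)
  then show ?thesis
    by (intro nonneg_bdd_above_summable_on bdd_aboveI) auto
qed

lemma op_tendsto: "((\<lambda>G. \<Sum>l\<in>G. K k l * ell2_apply u l) \<longlongrightarrow> op_at u k) (finite_subsets_at_top UNIV)"
  unfolding op_at_def by (rule infsum_tendsto[OF abs_summable_summable[OF op_summable]])

text \<open>\<open>Y\<close> bounds finite partial sums, so \<open>u\<close> can be measured in any
  order \<open>s\<close>. For finite \<open>F\<close> the bound over finite column sets passes to
  the limit.\<close>

lemma op_bound:
  assumes F: "finite F" and Y: "\<And>G. finite G \<Longrightarrow> wsq s G (ell2_apply u) \<le> Y"
  shows "wsq (s - m) F (op_at u) \<le> (op_const s)\<^sup>2 * Y"
proof (rule tendsto_upperbound)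
  show "((\<lambda>G. \<Sum>k\<in>F. wt k powr (2 * (s - m)) * (cmod (\<Sum>l\<in>G. K k l * ell2_apply u l))\<^sup>2)
      \<longlongrightarrow> wsq (s - m) F (op_at u)) (finite_subsets_at_top UNIV)"
    by (intro tendsto_intros op_tendsto)
  show "\<forall>\<^sub>F G in finite_subsets_at_top UNIV.
      wsq (s - m) F (\<lambda>k. \<Sum>l\<in>G. K k l * ell2_apply u l) \<le> (op_const s)\<^sup>2 * Y"
  proof (rule eventually_finite_subsets_at_top_weakI)
    fix G :: "(int^'n) set" assume G: "finite G"
    have "wsq (s - m) F (\<lambda>k. \<Sum>l\<in>G. K k l * ell2_apply u l)
        \<le> (\<Sum>k\<in>F. wt k powr (2 * (s - m)) * (\<Sum>l\<in>G. cmod (K k l) * cmod (ell2_apply u l))\<^sup>2)"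
      by (intro sum_mono mult_left_mono power_mono sum_norm_le) (auto simp: norm_mult)
    also have "\<dots> \<le> (op_const s)\<^sup>2 * Y"
      by (intro order_trans[OF finite_bound[OF F G]] mult_left_mono Y G) auto
    finally show "wsq (s - m) F (\<lambda>k. \<Sum>l\<in>G. K k l * ell2_apply u l) \<le> (op_const s)\<^sup>2 * Y" .
  qed
qed simp

lemma op_norm_bound:
  assumes "finite F"
  shows "wsq (- m) F (op_at u) \<le> (op_const 0)\<^sup>2 * (norm u)\<^sup>2"
  using op_bound[OF assms, of 0 u "(norm u)\<^sup>2"] by (simp add: ell2_finite_sum_le)

lemma bounded_linear_op_at: "bounded_linear (\<lambda>u. op_at u k)"
proof -
  define B where "B = op_const 0"
  note summ = abs_summable_summable[OF op_summable]
  show ?thesis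
  proof (rule bounded_linear_intro[of _ "wt k powr m * B"])
    show "op_at (u + v) k = op_at u k + op_at v k" for u v
      unfolding op_at_def using summ by (simp add: distrib_left infsum_add)
    show "op_at (r *\<^sub>R u) k = r *\<^sub>R op_at u k" for r u
      unfolding op_at_def by (simp add: infsum_scaleR_right)
    show "norm (op_at u k) \<le> norm u * (wt k powr m * B)" for u
    proof (rule power2_le_imp_le)
      have one: "(wt k powr m)\<^sup>2 * wt k powr (2 * (- m)) = 1"
        unfolding power2_eq_square powr_add[symmetric] by simp
      have "(wt k powr m)\<^sup>2 * (wt k powr (2 * (- m)) * (cmod (op_at u k))\<^sup>2) \<le> (wt k powr m)\<^sup>2 * (B\<^sup>2 * (norm u)\<^sup>2)"
        using op_norm_bound[of "{k}" u] by (intro mult_left_mono) (auto simp: B_def)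
      from this[unfolded mult.assoc[symmetric] one]
      show "(norm (op_at u k))\<^sup>2 \<le> (norm u * (wt k powr m * B))\<^sup>2"
        by (simp add: power_mult_distrib mult_ac)
    qed (simp add: B_def op_const_nonneg)
  qed
qed

lemma op_at_finite:
  assumes "finite F" "\<And>l. l \<notin> F \<Longrightarrow> ell2_apply u l = 0"
  shows "op_at u k = (\<Sum>l\<in>F. K k l * ell2_apply u l)"
proof -
  have "op_at u k = (\<Sum>\<^sub>\<infinity>l\<in>F. K k l * ell2_apply u l)"
    unfolding op_at_def using assms(2) by (intro infsum_cong_neutral) auto
  then show ?thesis using assms(1) by simp
qed

text \<open>A full row is its Galerkin part plus the operator applied to the tail. Treating the
  second summand as forcing makes a projected solution solve a perturbed Galerkin system.\<close>

lemma op_at_split: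
  assumes "finite F"
  shows "op_at u k = (\<Sum>l\<in>F. K k l * ell2_apply u l) + op_at (u - trunc F u) k"
proof -
  have "op_at (u - trunc F u) k = op_at u k - op_at (trunc F u) k"
    using linear_diff[OF bounded_linear.linear[OF bounded_linear_op_at]] .
  moreover have "op_at (trunc F u) k = (\<Sum>l\<in>F. K k l * ell2_apply u l)"
    using assms by (subst op_at_finite[OF assms]) (auto simp: ell2_apply_trunc)
  ultimately show ?thesis by simp
qed

text \<open>The hypotheses of \<open>finite_system\<close> without weight and quadratic bound, so
  that one system can be estimated in every order.\<close>

definition system :: "(int^'n) set \<Rightarrow> (int^'n \<Rightarrow> real \<Rightarrow> complex) \<Rightarrow> (int^'n \<Rightarrow> complex) \<Rightarrow> (int^'n \<Rightarrow> real \<Rightarrow> complex) \<Rightarrow> bool" where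
  "system F z z0 g \<longleftrightarrow> finite F \<and> (\<forall>k\<in>F. continuous_on {0..T} (z k) \<and> g k absolutely_integrable_on {0..T} \<and>
     (\<forall>t\<in>{0..T}. z k t = z0 k + integral {0..t} (\<lambda>s. (\<Sum>l\<in>F. K k l * z l s) + g k s)))"

definition energy_const :: "real \<Rightarrow> real" where
  "energy_const r = 2 * exp (2 * garding_const r * T) + 4 * (exp (2 * garding_const r * T))\<^sup>2"

lemma energy_const_nonneg: "energy_const r \<ge> 0"
  by (simp add: energy_const_def)

lemma system_L1:
  assumes sys: "system F z z0 g" and \<gamma>: "\<gamma> integrable_on {0..T}"
    "\<And>s. s \<in> {0..T} \<Longrightarrow> 0 \<le> \<gamma> s" "\<And>s. s \<in> {0..T} \<Longrightarrow> wsq r F (\<lambda>k. g k s) \<le> (\<gamma> s)\<^sup>2" and t: "t \<in> {0..T}"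
  shows "wsq r F (\<lambda>k. z k t) \<le> energy_const r * (wsq r F z0 + (integral {0..T} \<gamma>)\<^sup>2)"
proof -
  let ?e = "exp (2 * garding_const r * T)"
  interpret finite_system F K "\<lambda>k. wt k powr (2 * r)" T "garding_const r" z g z0
    using sys garding by unfold_locales (auto simp: system_def)
  have "energy t \<le> 2 * ?e * energy0 + 4 * ?e\<^sup>2 * (integral {0..T} \<gamma>)\<^sup>2"
    using \<gamma> t by (intro energy_bound_L1) auto
  also have "\<dots> \<le> energy_const r * energy0 + energy_const r * (integral {0..T} \<gamma>)\<^sup>2"
    unfolding energy_const_def by (intro add_mono mult_right_mono energy_nonneg) auto
  finally show ?thesis
    by (simp add: energy_def energy0_def distrib_left)
qed

lemma system_L2:
  assumes sys: "system F z z0 g" and t: "t \<in> {0..T}" and \<gamma>: "\<gamma> integrable_on {0..t}"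
    "\<And>s. s \<in> {0..t} \<Longrightarrow> nsq F (\<lambda>k. g k s) \<le> \<gamma> s"
  shows "nsq F (\<lambda>k. z k t) \<le> exp ((2 * garding_const 0 + 1) * T) * (nsq F z0 + integral {0..t} \<gamma>)"
proof -
  let ?c = "2 * garding_const 0 + 1"
  interpret finite_system F K "\<lambda>_. 1" T "garding_const 0" z g z0
    using sys garding(1)[of 0] garding(2)[of F 0] by unfold_locales (auto simp: system_def)
  have "0 \<le> \<gamma> s" if "s \<in> {0..t}" for s
    by (rule order_trans[OF _ \<gamma>(2)[OF that]]) (simp add: sum_nonneg)
  then have i0: "0 \<le> integral {0..t} \<gamma>"
    by (intro integral_nonneg \<gamma>(1))
  have "energy t \<le> exp (?c * t) * (energy0 + integral {0..t} \<gamma>)"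
    using \<gamma> by (intro energy_bound_L2 t) auto
  also have "\<dots> \<le> exp (?c * T) * (energy0 + integral {0..t} \<gamma>)"
    using t garding(1)[of 0] i0
    by (intro mult_right_mono add_nonneg_nonneg energy_nonneg) (auto intro: mult_left_mono)
  finally show ?thesis
    by (simp add: energy_def energy0_def)
qed

abbreviation L1 :: "(real \<Rightarrow> 'a::{banach,second_countable_topology}) \<Rightarrow> bool" where
  "L1 f \<equiv> set_integrable lebesgue {0..T} f"

text \<open>The data \<open>u0\<close> and \<open>f\<close> enter through their coordinates in
  \<open>F\<close> only, so they need no explicit truncation.\<close>

definition galerkin :: "(int^'n) set \<Rightarrow> (int^'n) ell2 \<Rightarrow> (real \<Rightarrow> (int^'n) ell2) \<Rightarrow> (real \<Rightarrow> (int^'n) ell2) \<Rightarrow> bool" where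
  "galerkin F u0 f u \<longleftrightarrow> continuous_on {0..T} u \<and> (\<forall>t\<in>{0..T}. \<forall>k. k \<notin> F \<longrightarrow> ell2_apply (u t) k = 0) \<and>
     system F (\<lambda>k t. ell2_apply (u t) k) (ell2_apply u0) (\<lambda>k s. ell2_apply (f s) k)"

text \<open>The truncated matrix is a bounded operator on \<open>ell2\<close>, so the Volterra
  equation can be solved there and read off in coordinates.\<close>

lemma galerkin_exists:
  assumes F: "finite F" and f: "L1 f"
  shows "\<exists>u. galerkin F u0 f u"
proof -
  define M where "M = (\<lambda>u. \<Sum>k\<in>F. ket k (\<Sum>l\<in>F. K k l * ell2_apply u l))"
  define h where "h = (\<lambda>t. \<Sum>k\<in>F. ket k (ell2_apply u0 k + integral {0..t} (\<lambda>s. ell2_apply (f s) k)))"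
  have M: "bounded_linear M"
    unfolding M_def
    by (intro bounded_linear_sum bounded_linear_compose[OF bounded_linear_ket] bounded_linear_const_mult bounded_linear_ell2_apply)
  have fk: "(\<lambda>s. ell2_apply (f s) k) absolutely_integrable_on {0..T}" for k
    by (rule set_integrable_bounded_linear[OF bounded_linear_ell2_apply f])
  then have fki: "(\<lambda>s. ell2_apply (f s) k) integrable_on {0..T}" for k
    by (simp add: absolutely_integrable_on_def)
  have h: "continuous_on {0..T} h"
    unfolding h_def
    by (intro continuous_on_sum bounded_linear.continuous_on[OF bounded_linear_ket] continuous_intros
        indefinite_integral_continuous_1 fki)
  obtain u where u: "continuous_on {0..T} u" "\<And>t. t \<in> {0..T} \<Longrightarrow> u t = h t + integral {0..t} (\<lambda>s. M (u s))"
    using volterra_solution[OF M h] by blast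
  have Mapp: "ell2_apply (M v) k = (if k \<in> F then \<Sum>l\<in>F. K k l * ell2_apply v l else 0)" for v k
    using F by (simp add: M_def)
  have happ: "ell2_apply (h t) k = (if k \<in> F then ell2_apply u0 k + integral {0..t} (\<lambda>s. ell2_apply (f s) k) else 0)" for t k
    using F by (simp add: h_def)
  have coord: "ell2_apply (u t) k = ell2_apply (h t) k + integral {0..t} (\<lambda>s. ell2_apply (M (u s)) k)" if t: "t \<in> {0..T}" for t k
  proof -
    have "(\<lambda>s. M (u s)) integrable_on {0..t}"
      using t by (intro integrable_continuous_interval bounded_linear.continuous_on[OF M] continuous_on_subset[OF u(1)]) auto
    from integral_linear[OF this bounded_linear_ell2_apply[of k]] show ?thesis
      by (simp add: u(2)[OF t] o_def)
  qed
  have "ell2_apply (u t) k = 0" if "t \<in> {0..T}" "k \<notin> F" for t k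
    using coord[OF that(1)] that(2) by (simp add: Mapp happ)
  moreover have "ell2_apply (u t) k = ell2_apply u0 k + integral {0..t} (\<lambda>s. (\<Sum>l\<in>F. K k l * ell2_apply (u s) l) + ell2_apply (f s) k)"
    if t: "t \<in> {0..T}" and k: "k \<in> F" for t k
  proof -
    have "(\<lambda>s. \<Sum>l\<in>F. K k l * ell2_apply (u s) l) integrable_on {0..t}"
      using t by (intro integrable_continuous_interval continuous_intros continuous_on_ell2_apply continuous_on_subset[OF u(1)]) auto
    moreover have "(\<lambda>s. ell2_apply (f s) k) integrable_on {0..t}"
      using t by (intro integrable_on_subinterval[OF fki]) auto
    ultimately show ?thesis
      using coord[OF t, of k] k by (simp add: Mapp happ integral_add)
  qed
  ultimately have "galerkin F u0 f u"
    unfolding galerkin_def system_def using u(1) F fk by (auto intro: continuous_on_ell2_apply)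
  then show ?thesis by blast
qed

end

section \<open>Convergence of the Galerkin approximations\<close>

context parabolic_matrix
begin

lemma ell2_coord_integrable:
  assumes "L1 f"
  shows "(\<lambda>s. ell2_apply (f s) k) absolutely_integrable_on {0..T}"
  by (rule set_integrable_bounded_linear[OF bounded_linear_ell2_apply assms])

lemma ell2_norm_integrable:
  fixes f :: "real \<Rightarrow> (int^'n) ell2"
  assumes "L1 f"
  shows "(\<lambda>s. norm (f s)) integrable_on {0..T}"
proof -
  have "L1 (\<lambda>s. norm (f s))"
    using assms by (rule set_integrable_norm)
  then show ?thesis
    by (rule set_lebesgue_integral_eq_integral(1))
qed

lemma trunc_integrable:
  fixes f :: "real \<Rightarrow> (int^'n) ell2"
  assumes "L1 f"
  shows "L1 (\<lambda>s. trunc F (f s))"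
  by (rule set_integrable_bounded_linear[OF bounded_linear_trunc assms])

lemma system_diff:
  assumes "system F z z0 g" "system F z' z0' g'"
  shows "system F (\<lambda>k t. z k t - z' k t) (\<lambda>k. z0 k - z0' k) (\<lambda>k s. g k s - g' k s)"
  unfolding system_def
proof (intro conjI ballI)
  show "finite F" using assms by (simp add: system_def)
  fix k assume k: "k \<in> F"
  show "continuous_on {0..T} (\<lambda>t. z k t - z' k t)" "(\<lambda>s. g k s - g' k s) absolutely_integrable_on {0..T}"
    using assms k by (auto simp: system_def intro!: continuous_intros)
  fix t assume t: "t \<in> {0..T}"
  have int: "(\<lambda>s. (\<Sum>l\<in>F. K k l * y l s) + h k s) integrable_on {0..t}" if "system F y y0 h" for y y0 h
  proof -
    have "(\<lambda>s. (\<Sum>l\<in>F. K k l * y l s) + h k s) absolutely_integrable_on {0..T}"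
    proof (rule set_integral_add(1))
      show "(\<lambda>s. \<Sum>l\<in>F. K k l * y l s) absolutely_integrable_on {0..T}"
        using that unfolding system_def
        by (intro absolutely_integrable_continuous_real continuous_intros) auto
      show "h k absolutely_integrable_on {0..T}"
        using that k by (simp add: system_def)
    qed
    then show ?thesis
      using t by (intro absolutely_integrable_imp_integrable_subinterval) auto
  qed
  have "z k t - z' k t = (z0 k - z0' k) + (integral {0..t} (\<lambda>s. (\<Sum>l\<in>F. K k l * z l s) + g k s)
      - integral {0..t} (\<lambda>s. (\<Sum>l\<in>F. K k l * z' l s) + g' k s))"
    using assms k t by (simp add: system_def)
  also have "integral {0..t} (\<lambda>s. (\<Sum>l\<in>F. K k l * z l s) + g k s) - integral {0..t} (\<lambda>s. (\<Sum>l\<in>F. K k l * z' l s) + g' k s)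
      = integral {0..t} (\<lambda>s. (\<Sum>l\<in>F. K k l * (z l s - z' l s)) + (g k s - g' k s))"
    by (subst integral_diff[symmetric, OF int[OF assms(1)] int[OF assms(2)]])
      (simp add: right_diff_distrib sum_subtractf algebra_simps)
  finally show "z k t - z' k t = (z0 k - z0' k) + integral {0..t} (\<lambda>s. (\<Sum>l\<in>F. K k l * (z l s - z' l s)) + (g k s - g' k s))" .
qed

lemma galerkinD:
  assumes "galerkin F u0 f u"
  shows "continuous_on {0..T} u" "\<And>t k. t \<in> {0..T} \<Longrightarrow> k \<notin> F \<Longrightarrow> ell2_apply (u t) k = 0"
    "system F (\<lambda>k t. ell2_apply (u t) k) (ell2_apply u0) (\<lambda>k s. ell2_apply (f s) k)" "finite F"
  using assms by (auto simp: galerkin_def system_def)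

text \<open>The constant is independent of \<open>F\<close>, so data can be replaced by truncated
  data uniformly in the size of the cube.\<close>

lemma galerkin_stable:
  assumes u: "galerkin F u0 f u" and u': "galerkin F u0' f' u'"
    and f: "L1 f" "L1 f'" and t: "t \<in> {0..T}"
  shows "(norm (u t - u' t))\<^sup>2 \<le> energy_const 0 * ((norm (u0 - u0'))\<^sup>2 + (integral {0..T} (\<lambda>s. norm (f s - f' s)))\<^sup>2)"
proof -
  note F = galerkinD(4)[OF u]
  have "(norm (u t - u' t))\<^sup>2 = wsq 0 F (\<lambda>k. ell2_apply (u t) k - ell2_apply (u' t) k)"
    using galerkinD(2)[OF u t] galerkinD(2)[OF u' t] by (subst norm_ell2_finite[OF F]) auto
  also have "\<dots> \<le> energy_const 0 * (wsq 0 F (\<lambda>k. ell2_apply u0 k - ell2_apply u0' k) + (integral {0..T} (\<lambda>s. norm (f s - f' s)))\<^sup>2)"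
  proof (rule system_L1[OF system_diff[OF galerkinD(3)[OF u] galerkinD(3)[OF u']] _ _ _ t])
    show "(\<lambda>s. norm (f s - f' s)) integrable_on {0..T}"
      by (rule ell2_norm_integrable[OF set_integral_diff(1)[OF f]])
    show "wsq 0 F (\<lambda>k. ell2_apply (f s) k - ell2_apply (f' s) k) \<le> (norm (f s - f' s))\<^sup>2" for s
      using ell2_finite_sum_le[OF F, of "f s - f' s"] by simp
  qed simp
  also have "\<dots> \<le> energy_const 0 * ((norm (u0 - u0'))\<^sup>2 + (integral {0..T} (\<lambda>s. norm (f s - f' s)))\<^sup>2)"
    using ell2_finite_sum_le[OF F, of "u0 - u0'"] energy_const_nonneg by (intro mult_left_mono add_right_mono) auto
  finally show ?thesis .
qed

text \<open>Finitely supported data lie in every weighted space, and the energy estimate of order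
  \<open>r\<close> propagates this with a bound independent of \<open>F\<close>.\<close>

lemma galerkin_weighted:
  assumes f: "L1 f"
  shows "\<exists>D\<ge>0. \<forall>F v. galerkin F (trunc (cube R) u0) (\<lambda>s. trunc (cube R) (f s)) v \<longrightarrow>
     (\<forall>t\<in>{0..T}. wsq r F (ell2_apply (v t)) \<le> D)"
proof -
  define E where "E = energy_const r"
  have E: "E \<ge> 0"
    by (simp add: E_def energy_const_nonneg)
  \<comment> \<open>On the fixed cube the weighted norm is at most a multiple of the plain one;
    \<open>W\<close> is a crude factor for the squares.\<close>
  define W where "W = (\<Sum>k\<in>cube R. wt (k :: int^'n) powr (2 * r))"
  have W: "W \<ge> 0" by (simp add: W_def sum_nonneg)
  have cut: "wsq r F (\<lambda>k. ell2_apply (trunc (cube R) w) k) \<le> W * (norm w)\<^sup>2"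
    if F: "finite F" for F and w :: "(int^'n) ell2"
  proof -
    have "wsq r F (\<lambda>k. ell2_apply (trunc (cube R) w) k)
        = (\<Sum>k\<in>F \<inter> cube R. wt k powr (2 * r) * (cmod (ell2_apply w k))\<^sup>2)"
      using F by (intro sum.mono_neutral_cong_right) (auto simp: ell2_apply_trunc)
    also have "\<dots> \<le> wsq r (cube R) (ell2_apply w)"
      by (intro sum_mono2) auto
    also have "\<dots> \<le> (\<Sum>k\<in>cube R. wt (k :: int^'n) powr (2 * r) * (norm w)\<^sup>2)"
      by (intro sum_mono mult_left_mono power_mono ell2_apply_norm_le) auto
    finally show ?thesis
      by (simp add: W_def sum_distrib_right)
  qed
  define D where "D = E * (W * (norm u0)\<^sup>2 + (integral {0..T} (\<lambda>s. sqrt W * norm (f s)))\<^sup>2)"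
  have "wsq r F (ell2_apply (v t)) \<le> D"
    if v: "galerkin F (trunc (cube R) u0) (\<lambda>s. trunc (cube R) (f s)) v" and t: "t \<in> {0..T}" for F v t
  proof -
    note F = galerkinD(4)[OF v]
    have "wsq r F (ell2_apply (v t))
        \<le> E * (wsq r F (\<lambda>k. ell2_apply (trunc (cube R) u0) k)
          + (integral {0..T} (\<lambda>s. sqrt W * norm (f s)))\<^sup>2)"
      using W cut[OF F]
      unfolding E_def
      by (intro system_L1[OF galerkinD(3)[OF v] _ _ _ t] integrable_on_mult_right ell2_norm_integrable f)
        (auto simp: power_mult_distrib)
    also have "\<dots> \<le> D"
      unfolding D_def using E cut[OF F] by (intro mult_left_mono add_right_mono) auto
    finally show ?thesis .
  qed
  moreover have "D \<ge> 0"
    unfolding D_def using E W by simp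
  ultimately show ?thesis by blast
qed

text \<open>The approximation \<open>w\<close> on the smaller cube solves the system on the larger
  one up to a defect in the rows outside the smaller cube. Boundedness of \<open>w\<close> in order
  \<open>m + 1\<close> makes this defect small.\<close>

lemma galerkin_truncated_cauchy:
  assumes f: "L1 f" and e: "e > 0"
  shows "\<exists>N0. \<forall>M\<ge>N0. \<forall>N\<ge>M. \<forall>v w.
     galerkin (cube N) (trunc (cube R) u0) (\<lambda>s. trunc (cube R) (f s)) v \<longrightarrow>
     galerkin (cube M) (trunc (cube R) u0) (\<lambda>s. trunc (cube R) (f s)) w \<longrightarrow>
     (\<forall>t\<in>{0..T}. norm (v t - w t) \<le> e)"
proof -
  define E where "E = energy_const 0"
  have E: "E \<ge> 0"
    by (simp add: E_def energy_const_nonneg)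
  obtain D where D: "D \<ge> 0" "\<And>F v t. galerkin F (trunc (cube R) u0) (\<lambda>s. trunc (cube R) (f s)) v \<Longrightarrow>
     t \<in> {0..T} \<Longrightarrow> wsq (m + 1) F (ell2_apply (v t)) \<le> D"
    using galerkin_weighted[OF f, of R u0 "m + 1"] by blast
  define B where "B = op_const (m + 1)"
  have B: "B \<ge> 0" by (simp add: B_def op_const_nonneg)
  have "(\<lambda>M. sqrt E * (T * (B * sqrt D)) * inverse (real (Suc M))) \<longlonglongrightarrow> sqrt E * (T * (B * sqrt D)) * 0"
    by (intro tendsto_intros LIMSEQ_inverse_real_of_nat)
  then have "\<forall>\<^sub>F M in sequentially. sqrt E * (T * (B * sqrt D)) * inverse (real (Suc M)) < e"
    using e by (intro order_tendstoD(2)) auto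
  then obtain N1 where N1: "\<And>M. M \<ge> N1 \<Longrightarrow> sqrt E * (T * (B * sqrt D)) * inverse (real (Suc M)) < e"
    by (auto simp: eventually_sequentially)
  have "norm (v t - w t) \<le> e"
    if M: "M \<ge> max N1 R" and N: "N \<ge> M"
      and v: "galerkin (cube N) (trunc (cube R) u0) (\<lambda>s. trunc (cube R) (f s)) v"
      and w: "galerkin (cube M) (trunc (cube R) u0) (\<lambda>s. trunc (cube R) (f s)) w"
      and t: "t \<in> {0..T}" for M N v w t
  proof -
    define FN FM where "FN = (cube N :: (int^'n) set)" and "FM = (cube M :: (int^'n) set)"
    have fin: "finite FN" "finite FM" and sub: "FM \<subseteq> FN"
      using N cube_mono by (auto simp: FN_def FM_def)
    \<comment> \<open>This makes the truncated data vanish in the rows outside the smaller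
      cube.\<close>
    have subR: "cube R \<subseteq> FM"
      unfolding FM_def using M by (intro cube_mono) auto
    \<comment> \<open>In the rows outside the smaller cube \<open>w\<close> vanishes although the
      matrix does not; subtracting \<open>g\<close> cancels exactly this term.\<close>
    define g where "g = (\<lambda>k s. if k \<in> FM then 0 else \<Sum>l\<in>FM. K k l * ell2_apply (w s) l)"
    have wcont: "continuous_on {0..T} (\<lambda>s. ell2_apply (w s) l)" for l
      by (rule continuous_on_ell2_apply[OF galerkinD(1)[OF w]])
    have wsys: "system FN (\<lambda>k t. ell2_apply (w t) k) (ell2_apply (trunc (cube R) u0))
        (\<lambda>k s. ell2_apply (trunc (cube R) (f s)) k - g k s)"
      unfolding system_def
    proof (intro conjI ballI)
      fix k assume k: "k \<in> FN"
      show "(\<lambda>s. ell2_apply (trunc (cube R) (f s)) k - g k s) absolutely_integrable_on {0..T}"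
      proof (rule set_integral_diff(1)[OF ell2_coord_integrable[OF trunc_integrable[OF f]]])
        show "g k absolutely_integrable_on {0..T}"
          by (rule absolutely_integrable_continuous_real, cases "k \<in> FM")
            (auto simp: g_def intro!: continuous_intros wcont)
      qed
      fix t assume t: "t \<in> {0..T}"
      have sum_eq: "(\<Sum>l\<in>FN. K k l * ell2_apply (w s) l) = (\<Sum>l\<in>FM. K k l * ell2_apply (w s) l)" if "s \<in> {0..T}" for s
        using fin sub galerkinD(2)[OF w that] by (intro sum.mono_neutral_right) (auto simp: FM_def)
      show "ell2_apply (w t) k = ell2_apply (trunc (cube R) u0) k
          + integral {0..t} (\<lambda>s. (\<Sum>l\<in>FN. K k l * ell2_apply (w s) l) + (ell2_apply (trunc (cube R) (f s)) k - g k s))"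
      proof (cases "k \<in> FM")
        case True
        have "integral {0..t} (\<lambda>s. (\<Sum>l\<in>FN. K k l * ell2_apply (w s) l) + (ell2_apply (trunc (cube R) (f s)) k - g k s))
            = integral {0..t} (\<lambda>s. (\<Sum>l\<in>FM. K k l * ell2_apply (w s) l) + ell2_apply (trunc (cube R) (f s)) k)"
          using True t sum_eq by (intro integral_cong) (auto simp: g_def)
        then show ?thesis
          using galerkinD(3)[OF w] True t by (simp add: system_def FM_def)
      next
        case False
        have "integral {0..t} (\<lambda>s. (\<Sum>l\<in>FN. K k l * ell2_apply (w s) l) + (ell2_apply (trunc (cube R) (f s)) k - g k s))
            = integral {0..t} (\<lambda>s. 0)"
          using False t sum_eq subR by (intro integral_cong) (auto simp: g_def ell2_apply_trunc)
        then show ?thesis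
          using galerkinD(2)[OF w t] False subR by (auto simp: FM_def ell2_apply_trunc)
      qed
    qed (auto simp: fin wcont)
    have gle: "wsq 0 FN (\<lambda>k. g k s) \<le> (inverse (real (Suc M)) * (B * sqrt D))\<^sup>2" if s: "s \<in> {0..T}" for s
    proof -
      define q where "q = (\<lambda>k. \<Sum>l\<in>FM. cmod (K k l) * cmod (ell2_apply (w s) l))"
      \<comment> \<open>The exponent leaves \<open>m + 1 - m = 1\<close> spare order, and outside
        the smaller cube the weight is at least \<open>Suc M\<close>.\<close>
      have "wt k powr (2 * 0) * (cmod (g k s))\<^sup>2 \<le> (inverse (real (Suc M)))\<^sup>2 * (wt k powr (2 * (m + 1 - m)) * (q k)\<^sup>2)" if "k \<in> FN" for k
      proof (cases "k \<in> FM")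
        case True
        then show ?thesis by (simp add: g_def)
      next
        case False
        then have wk: "real (Suc M) \<le> wt k"
          unfolding FM_def by (rule wt_outside_cube)
        have "cmod (g k s) \<le> q k"
          unfolding g_def q_def using False by (auto intro!: sum_norm_le simp: norm_mult)
        moreover have "1 \<le> inverse (real (Suc M)) * wt k"
          using wk by (simp add: field_simps)
        then have "1 * q k \<le> inverse (real (Suc M)) * wt k * q k"
          by (rule mult_right_mono) (simp add: q_def sum_nonneg)
        ultimately have "(cmod (g k s))\<^sup>2 \<le> (inverse (real (Suc M)) * wt k * q k)\<^sup>2"
          by (intro power_mono) auto
        moreover have "wt k powr (2 * (m + 1 - m)) = (wt k)\<^sup>2"
          using powr_realpow[of "wt k" 2] by simp
        ultimately show ?thesis
          by (simp only: power_mult_distrib) simp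
      qed
      then have "wsq 0 FN (\<lambda>k. g k s)
          \<le> (inverse (real (Suc M)))\<^sup>2 * (\<Sum>k\<in>FN. wt k powr (2 * (m + 1 - m)) * (q k)\<^sup>2)"
        unfolding sum_distrib_left by (intro sum_mono)
      also have "\<dots> \<le> (inverse (real (Suc M)))\<^sup>2 * (B\<^sup>2 * D)"
        unfolding q_def B_def using D(2)[OF w s]
        by (intro mult_left_mono order_trans[OF finite_bound[OF fin]]) (auto simp: FM_def)
      finally show ?thesis
        using D(1) by (simp add: power_mult_distrib)
    qed
    define c where "c = inverse (real (Suc M)) * (B * sqrt D)"
    have c: "c \<ge> 0" using B D by (simp add: c_def)
    have "(norm (v t - w t))\<^sup>2 = wsq 0 FN (\<lambda>k. ell2_apply (v t) k - ell2_apply (w t) k)"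
      using galerkinD(2)[OF v t] galerkinD(2)[OF w t] sub
      by (subst norm_ell2_finite[OF fin(1)]) (auto simp: FN_def FM_def)
    also have "\<dots> \<le> E * ((\<Sum>k\<in>FN. wt k powr (2 * 0) *
        (cmod (ell2_apply (trunc (cube R) u0) k - ell2_apply (trunc (cube R) u0) k))\<^sup>2) + (integral {0..T} (\<lambda>_. c))\<^sup>2)"
      unfolding E_def
      by (intro system_L1[OF system_diff[OF galerkinD(3)[OF v, folded FN_def] wsys] _ _ _ t])
        (use gle c in \<open>auto simp: c_def\<close>)
    also have "\<dots> = (sqrt E * (T * (B * sqrt D)) * inverse (real (Suc M)))\<^sup>2"
      using T_pos E by (simp add: c_def power_mult_distrib mult_ac)
    finally have "norm (v t - w t) \<le> sqrt E * (T * (B * sqrt D)) * inverse (real (Suc M))"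
      using E B D T_pos by (intro power2_le_imp_le[of "norm (v t - w t)"]) auto
    then show ?thesis
      using N1[of M] M by simp
  qed
  then show ?thesis by blast
qed

lemma trunc_integral_tendsto:
  fixes f :: "real \<Rightarrow> (int^'n) ell2"
  assumes f: "L1 f"
  shows "(\<lambda>R. integral {0..T} (\<lambda>s. norm (f s - trunc (cube R) (f s)))) \<longlonglongrightarrow> 0"
proof -
  have "(\<lambda>R. integral {0..T} (\<lambda>s. norm (f s - trunc (cube R) (f s)))) \<longlonglongrightarrow> integral {0..T} (\<lambda>s. 0)"
  proof (rule dominated_convergence(2))
    show "(\<lambda>s. norm (f s - trunc (cube R) (f s))) integrable_on {0..T}" for R
      by (rule ell2_norm_integrable[OF set_integral_diff(1)[OF f trunc_integrable[OF f]]])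
    show "(\<lambda>s. norm (f s)) integrable_on {0..T}"
      by (rule ell2_norm_integrable[OF f])
  qed (auto simp: trunc_tendsto norm_diff_trunc_le_norm)
  then show ?thesis by simp
qed

lemma galerkin_sequence:
  assumes "L1 f"
  shows "\<exists>u. \<forall>N. galerkin (cube N) u0 f (u N)"
  by (intro choice allI galerkin_exists finite_cube assms)

text \<open>The Cauchy rate for truncated data depends on \<open>R\<close>, so \<open>R\<close> is
  fixed first, by the stability estimate, which is uniform in the cube.\<close>

lemma galerkin_uniformly_Cauchy:
  assumes f: "L1 f"
    and u: "\<And>N. galerkin (cube N) u0 f (u N)"
  shows "uniformly_Cauchy_on {0..T} u"
proof (rule uniformly_Cauchy_onI')
  fix e :: real assume e: "e > 0"
  let ?\<delta> = "\<lambda>R. energy_const 0 * ((norm (u0 - trunc (cube R) u0))\<^sup>2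
      + (integral {0..T} (\<lambda>s. norm (f s - trunc (cube R) (f s))))\<^sup>2)"
  have "?\<delta> \<longlonglongrightarrow> energy_const 0 * (0\<^sup>2 + 0\<^sup>2)"
    by (intro tendsto_intros trunc_tendsto trunc_integral_tendsto f)
  then have "\<forall>\<^sub>F R in sequentially. ?\<delta> R < (e / 4)\<^sup>2"
    using e by (intro order_tendstoD(2)) auto
  then obtain R where R: "?\<delta> R < (e / 4)\<^sup>2"
    by (auto simp: eventually_sequentially)
  obtain v where v: "\<And>N. galerkin (cube N) (trunc (cube R) u0) (\<lambda>s. trunc (cube R) (f s)) (v N)"
    using galerkin_sequence[OF trunc_integrable[OF f]] by blast
  have close: "norm (u N t - v N t) \<le> e / 4" if "t \<in> {0..T}" for N t
  proof (rule power2_le_imp_le)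
    show "(norm (u N t - v N t))\<^sup>2 \<le> (e / 4)\<^sup>2"
      using galerkin_stable[OF u v f trunc_integrable[OF f] that, of N] R by linarith
  qed (use e in simp)
  obtain N0 where N0: "\<And>M N t. M \<ge> N0 \<Longrightarrow> N \<ge> M \<Longrightarrow> t \<in> {0..T} \<Longrightarrow> norm (v N t - v M t) \<le> e / 4"
    using galerkin_truncated_cauchy[OF f, of "e / 4" R u0] e v by (metis zero_less_divide_iff zero_less_numeral)
  have "dist (u M t) (u N t) < e" if t: "t \<in> {0..T}" and MN: "M \<ge> N0" "N > M" for t M N
  proof -
    have "dist (u M t) (u N t) \<le> dist (u M t) (v M t) + dist (v M t) (v N t) + dist (v N t) (u N t)"
      by (meson add_right_mono dist_triangle order_trans)
    also have "\<dots> \<le> e / 4 + e / 4 + e / 4"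
      using close[OF t] N0[OF MN(1) _ t, of N] MN by (intro add_mono) (auto simp: dist_norm norm_minus_commute)
    finally show ?thesis using e by simp
  qed
  then show "\<exists>M. \<forall>x\<in>{0..T}. \<forall>m\<ge>M. \<forall>n>m. dist (u m x) (u n x) < e"
    by blast
qed

text \<open>The equation read coordinatewise, with scalar integrals in place of the Bochner integral
  in the weighted space.\<close>

definition coord_solution :: "(int^'n) ell2 \<Rightarrow> (real \<Rightarrow> (int^'n) ell2) \<Rightarrow> (real \<Rightarrow> (int^'n) ell2) \<Rightarrow> bool" where
  "coord_solution u0 f u \<longleftrightarrow> continuous_on {0..T} u \<and>
     (\<forall>t\<in>{0..T}. \<forall>k. ell2_apply (u t) k = ell2_apply u0 k + integral {0..t} (\<lambda>s. op_at (u s) k + ell2_apply (f s) k))"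

lemma continuous_on_op_at: "continuous_on S u \<Longrightarrow> continuous_on S (\<lambda>s. op_at (u s) k)"
  by (rule bounded_linear.continuous_on[OF bounded_linear_op_at])

lemma coord_solution_exists:
  assumes f: "L1 f"
  shows "\<exists>u. coord_solution u0 f u"
proof -
  obtain u where u: "\<And>N. galerkin (cube N) u0 f (u N)"
    using galerkin_sequence[OF f] by blast
  obtain w where w: "uniform_limit {0..T} u w sequentially"
    using Cauchy_uniformly_convergent[OF galerkin_uniformly_Cauchy[OF f u]]
    by (auto simp: uniformly_convergent_on_def)
  have cont: "continuous_on {0..T} w"
    by (rule uniform_limit_theorem[OF _ w]) (auto intro!: always_eventually galerkinD(1)[OF u])
  have "ell2_apply (w t) k = ell2_apply u0 k + integral {0..t} (\<lambda>s. op_at (w s) k + ell2_apply (f s) k)"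
    if t: "t \<in> {0..T}" for t k
  proof -
    have sub: "{0..t} \<subseteq> {0..T}" using t by auto
    have fk: "(\<lambda>s. ell2_apply (f s) k) integrable_on {0..t}"
      using set_lebesgue_integral_eq_integral(1)[OF ell2_coord_integrable[OF f]] sub
      by (rule integrable_on_subinterval)
    have "uniform_limit {0..t} (\<lambda>N s. op_at (u N s) k) (\<lambda>s. op_at (w s) k) sequentially"
      by (intro bounded_linear.uniform_limit[OF bounded_linear_op_at] uniform_limit_on_subset[OF w] sub)
    then obtain I J where I: "\<And>N. ((\<lambda>s. op_at (u N s) k) has_integral I N) {0..t}"
      "((\<lambda>s. op_at (w s) k) has_integral J) {0..t}" "I \<longlonglongrightarrow> J"
      by (rule uniform_limit_integral)
        (auto intro!: continuous_on_op_at continuous_on_subset[OF galerkinD(1)[OF u] sub])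
    \<comment> \<open>The \<open>k\<close>-th equation belongs to the system once the cube contains
      \<open>k\<close>, and its finite sum is then the full row, as the approximation vanishes
      outside the cube.\<close>
    have "\<forall>\<^sub>F N in sequentially. ell2_apply (u N t) k = ell2_apply u0 k + (I N + integral {0..t} (\<lambda>s. ell2_apply (f s) k))"
      using eventually_subset_cube[OF finite.insertI[OF finite.emptyI, of k]]
    proof eventually_elim
      case (elim N)
      have "integral {0..t} (\<lambda>s. (\<Sum>l\<in>cube N. K k l * ell2_apply (u N s) l) + ell2_apply (f s) k)
          = integral {0..t} (\<lambda>s. op_at (u N s) k + ell2_apply (f s) k)"
        using sub galerkinD(2)[OF u] by (intro integral_cong) (subst op_at_finite[OF finite_cube], auto)
      also have "\<dots> = I N + integral {0..t} (\<lambda>s. ell2_apply (f s) k)"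
        using I(1)[of N] fk by (simp add: integral_add has_integral_integrable integral_unique)
      finally show ?case
        using galerkinD(3)[OF u[of N]] elim t by (simp add: system_def)
    qed
    moreover have "(\<lambda>N. ell2_apply (u N t) k) \<longlonglongrightarrow> ell2_apply (w t) k"
      by (intro bounded_linear.tendsto[OF bounded_linear_ell2_apply] tendsto_uniform_limitI[OF w t])
    ultimately have "(\<lambda>N. ell2_apply u0 k + (I N + integral {0..t} (\<lambda>s. ell2_apply (f s) k))) \<longlonglongrightarrow> ell2_apply (w t) k"
      by (rule Lim_transform_eventually[rotated])
    moreover have "(\<lambda>N. ell2_apply u0 k + (I N + integral {0..t} (\<lambda>s. ell2_apply (f s) k)))
        \<longlonglongrightarrow> ell2_apply u0 k + (J + integral {0..t} (\<lambda>s. ell2_apply (f s) k))"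
      by (intro tendsto_intros I)
    ultimately have "ell2_apply (w t) k = ell2_apply u0 k + (J + integral {0..t} (\<lambda>s. ell2_apply (f s) k))"
      by (rule LIMSEQ_unique)
    then show ?thesis
      using I(2) fk by (simp add: integral_add has_integral_integrable integral_unique)
  qed
  with cont show ?thesis
    unfolding coord_solution_def by blast
qed

text \<open>The tail of a bounded \<open>ell2\<close>-valued function is of size
  \<open>1 / Suc N\<close> in order -1, and the operator carries it to order \<open>- 1 - m\<close>.
  The energy estimate in that order gives convergence of each coordinate, since a fixed coordinate
  carries a fixed weight.\<close>

lemma galerkin_tendsto_solution:
  assumes f: "L1 f"
    and u: "\<And>N. galerkin (cube N) u0 f (u N)" and v: "coord_solution u0 f v" and t: "t \<in> {0..T}"
  shows "(\<lambda>N. ell2_apply (u N t) k) \<longlonglongrightarrow> ell2_apply (v t) k"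
proof -
  have vc: "continuous_on {0..T} v"
    using v by (simp add: coord_solution_def)
  obtain V where V: "V > 0" "\<And>s. s \<in> {0..T} \<Longrightarrow> norm (v s) \<le> V"
  proof -
    have "bounded (v ` {0..T})"
      by (intro compact_imp_bounded compact_continuous_image vc) auto
    then show ?thesis
      using that unfolding bounded_pos by blast
  qed
  define E where "E = energy_const (- 1 - m)"
  have E: "E \<ge> 0"
    by (simp add: E_def energy_const_nonneg)
  define B where "B = op_const (- 1)"
  have B: "B \<ge> 0" by (simp add: B_def op_const_nonneg)
  have err: "wt k powr (2 * (- 1 - m)) * (cmod (ell2_apply (v t) k - ell2_apply (u N t) k))\<^sup>2
      \<le> E * (T * (B * V) * inverse (real (Suc N)))\<^sup>2" if kN: "k \<in> cube N" for N
  proof -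
    define F where "F = (cube N :: (int^'n) set)"
    have fin: "finite F" by (simp add: F_def)
    define g where "g = (\<lambda>k s. op_at (v s - trunc F (v s)) k)"
    define c where "c = inverse (real (Suc N)) * (B * V)"
    have c: "c \<ge> 0" using B V by (simp add: c_def)
    have gc: "continuous_on {0..T} (g k)" for k
      unfolding g_def
      by (intro continuous_on_op_at continuous_intros vc bounded_linear.continuous_on[OF bounded_linear_trunc])
    have vsys: "system F (\<lambda>k t. ell2_apply (v t) k) (ell2_apply u0) (\<lambda>k s. ell2_apply (f s) k + g k s)"
      unfolding system_def
    proof (intro conjI ballI fin)
      fix k
      show "continuous_on {0..T} (\<lambda>t. ell2_apply (v t) k)"
        by (rule continuous_on_ell2_apply[OF vc])
      show "(\<lambda>s. ell2_apply (f s) k + g k s) absolutely_integrable_on {0..T}"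
        by (intro set_integral_add(1) ell2_coord_integrable f absolutely_integrable_continuous_real gc)
      fix t assume "t \<in> {0..T}"
      then have "ell2_apply (v t) k = ell2_apply u0 k + integral {0..t} (\<lambda>s. op_at (v s) k + ell2_apply (f s) k)"
        using v by (simp add: coord_solution_def)
      then show "ell2_apply (v t) k = ell2_apply u0 k
          + integral {0..t} (\<lambda>s. (\<Sum>l\<in>F. K k l * ell2_apply (v s) l) + (ell2_apply (f s) k + g k s))"
        unfolding g_def op_at_split[OF fin, of "v _" k] by (simp add: add_ac)
    qed
    have gle: "wsq (- 1 - m) F (\<lambda>k. g k s) \<le> c\<^sup>2" if s: "s \<in> {0..T}" for s
    proof -
      have "wsq (- 1) G (\<lambda>l. ell2_apply (v s - trunc F (v s)) l) \<le> (inverse (real (Suc N)))\<^sup>2 * V\<^sup>2"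
        if G: "finite G" for G
      proof -
        have "wt l powr (2 * - 1) * (cmod (ell2_apply (v s - trunc F (v s)) l))\<^sup>2 \<le> (inverse (real (Suc N)))\<^sup>2 * (cmod (ell2_apply (v s) l))\<^sup>2" for l
        proof (cases "l \<in> F")
          case False
          then have "real (Suc N) \<le> wt l"
            unfolding F_def by (rule wt_outside_cube)
          then have "inverse (wt l) \<le> inverse (real (Suc N))"
            by (intro le_imp_inverse_le) auto
          then have "(inverse (wt l))\<^sup>2 \<le> (inverse (real (Suc N)))\<^sup>2"
            by (intro power_mono) auto
          moreover have "wt l powr (2 * - 1) = (inverse (wt l))\<^sup>2"
            using powr_realpow[of "wt l" 2] by (simp add: powr_minus power_inverse)
          ultimately show ?thesis
            using False fin by (simp add: ell2_apply_trunc mult_right_mono)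
        qed (use fin in \<open>simp add: ell2_apply_trunc\<close>)
        then have "wsq (- 1) G (\<lambda>l. ell2_apply (v s - trunc F (v s)) l)
            \<le> (inverse (real (Suc N)))\<^sup>2 * nsq G (ell2_apply (v s))"
          unfolding sum_distrib_left by (intro sum_mono)
        also have "\<dots> \<le> (inverse (real (Suc N)))\<^sup>2 * V\<^sup>2"
          by (intro mult_left_mono order_trans[OF ell2_finite_sum_le[OF G]] power_mono V s) auto
        finally show ?thesis .
      qed
      from op_bound[OF fin this] show ?thesis
        by (simp add: g_def c_def B_def power_mult_distrib mult_ac)
    qed
    have "wt k powr (2 * (- 1 - m)) * (cmod (ell2_apply (v t) k - ell2_apply (u N t) k))\<^sup>2
        \<le> wsq (- 1 - m) F (\<lambda>k. ell2_apply (v t) k - ell2_apply (u N t) k)"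
      using kN fin by (intro member_le_sum[of k F "\<lambda>k. wt k powr (2 * (- 1 - m)) * (cmod (ell2_apply (v t) k - ell2_apply (u N t) k))\<^sup>2"]) (auto simp: F_def)
    also have "\<dots> \<le> E * (wsq (- 1 - m) F (\<lambda>k. ell2_apply u0 k - ell2_apply u0 k) + (integral {0..T} (\<lambda>_. c))\<^sup>2)"
      unfolding E_def
      by (intro system_L1[OF system_diff[OF vsys galerkinD(3)[OF u[of N], folded F_def]] _ _ _ t])
        (use gle c in auto)
    finally show ?thesis
      using T_pos by (simp add: c_def mult_ac)
  qed
  have "(\<lambda>N. E * (T * (B * V) * inverse (real (Suc N)))\<^sup>2) \<longlonglongrightarrow> E * (T * (B * V) * 0)\<^sup>2"
    by (intro tendsto_intros LIMSEQ_inverse_real_of_nat)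
  then have lim0: "(\<lambda>N. E * (T * (B * V) * inverse (real (Suc N)))\<^sup>2) \<longlonglongrightarrow> 0"
    by simp
  have "(\<lambda>N. wt k powr (2 * (- 1 - m)) * (cmod (ell2_apply (v t) k - ell2_apply (u N t) k))\<^sup>2) \<longlonglongrightarrow> 0"
  proof (rule tendsto_sandwich[OF _ _ tendsto_const lim0])
    show "\<forall>\<^sub>F N in sequentially. 0 \<le> wt k powr (2 * (- 1 - m)) * (cmod (ell2_apply (v t) k - ell2_apply (u N t) k))\<^sup>2"
      by (intro always_eventually allI) simp
    have "\<forall>\<^sub>F N in sequentially. {k} \<subseteq> cube N"
      by (rule eventually_subset_cube) simp
    then show "\<forall>\<^sub>F N in sequentially. wt k powr (2 * (- 1 - m)) * (cmod (ell2_apply (v t) k - ell2_apply (u N t) k))\<^sup>2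
        \<le> E * (T * (B * V) * inverse (real (Suc N)))\<^sup>2"
      by (rule eventually_mono) (rule err, simp)
  qed
  then have "(\<lambda>N. sqrt (wt k powr (- (2 * (- 1 - m))) * (wt k powr (2 * (- 1 - m)) * (cmod (ell2_apply (v t) k - ell2_apply (u N t) k))\<^sup>2)))
      \<longlonglongrightarrow> sqrt (wt k powr (- (2 * (- 1 - m))) * 0)"
    by (intro tendsto_intros)
  then have "(\<lambda>N. cmod (ell2_apply (v t) k - ell2_apply (u N t) k)) \<longlonglongrightarrow> 0"
    unfolding mult.assoc[symmetric] powr_add[symmetric] by simp
  then show ?thesis
    by (subst tendsto_iff) (auto simp: tendsto_iff dist_norm norm_minus_commute)
qed

lemma coord_solution_unique:
  assumes f: "L1 f"
    and v: "coord_solution u0 f v" and w: "coord_solution u0 f w" and t: "t \<in> {0..T}"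
  shows "v t = w t"
proof -
  obtain u where u: "\<And>N. galerkin (cube N) u0 f (u N)"
    using galerkin_sequence[OF f] by blast
  show ?thesis
    using LIMSEQ_unique[OF galerkin_tendsto_solution[OF f u v t] galerkin_tendsto_solution[OF f u w t]]
    by (intro ell2_eqI)
qed

text \<open>The bound for the approximations is free of \<open>N\<close>. Coordinatewise convergence
  passes it to finite partial sums of the limit, and hence to the norm.\<close>

lemma coord_solution_estimate:
  assumes f: "L1 f" and v: "coord_solution u0 f v" and t: "t \<in> {0..T}"
    and f2: "(\<lambda>s. (norm (f s))\<^sup>2) integrable_on {0..t}"
  shows "(norm (v t))\<^sup>2 \<le> exp ((2 * garding_const 0 + 1) * T) * ((norm u0)\<^sup>2 + integral {0..t} (\<lambda>s. (norm (f s))\<^sup>2))"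
proof -
  define E where "E = exp ((2 * garding_const 0 + 1) * T)"
  obtain u where u: "\<And>N. galerkin (cube N) u0 f (u N)"
    using galerkin_sequence[OF f] by blast
  define Y where "Y = E * ((norm u0)\<^sup>2 + integral {0..t} (\<lambda>s. (norm (f s))\<^sup>2))"
  have "(norm (u N t))\<^sup>2 \<le> Y" for N
  proof -
    have "(norm (u N t))\<^sup>2 = nsq (cube N) (ell2_apply (u N t))"
      using galerkinD(2)[OF u t] by (intro norm_ell2_finite) auto
    also have "\<dots> \<le> E * (nsq (cube N) (ell2_apply u0) + integral {0..t} (\<lambda>s. (norm (f s))\<^sup>2))"
      unfolding E_def by (intro system_L2[OF galerkinD(3)[OF u] t f2]) (auto intro: ell2_finite_sum_le)
    also have "\<dots> \<le> Y"
      unfolding Y_def E_def by (intro mult_left_mono add_right_mono ell2_finite_sum_le) auto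
    finally show ?thesis .
  qed
  then have bnd: "nsq H (ell2_apply (u N t)) \<le> Y" if "finite H" for H N
    using ell2_finite_sum_le[OF that] order_trans by blast
  have lim: "(\<lambda>N. \<Sum>k\<in>H. (cmod (ell2_apply (u N t) k))\<^sup>2) \<longlonglongrightarrow> nsq H (ell2_apply (v t))" for H
    by (intro tendsto_intros galerkin_tendsto_solution[OF f u v t])
  have "nsq H (ell2_apply (v t)) \<le> Y" if "finite H" for H
    using LIMSEQ_le_const2[OF lim] bnd[OF that] by blast
  then show ?thesis
    unfolding E_def[symmetric] Y_def[symmetric] norm_ell2_power2[of "v t"] by (intro infsum_le_finite_sums ell2_summable)
qed

end

section \<open>From matrices to operators\<close>

lemma (in symbol_coeffs) parabolic:
  assumes "T > 0"
  shows "\<exists>D G. parabolic_matrix (\<lambda>k l. a k (k - l)) m D G T"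
proof -
  have "\<forall>N. \<exists>C. C \<ge> 0 \<and> (\<forall>k j. cmod (a k j) \<le> C * wt k powr m * wt j powr (- N))"
    using decay by blast
  from choice[OF this] obtain D where D: "\<forall>N. D N \<ge> 0 \<and> (\<forall>k j. cmod (a k j) \<le> D N * wt k powr m * wt j powr (- N))"
    by blast
  have "\<forall>s. \<exists>C. C \<ge> 0 \<and> (\<forall>F v. finite F \<longrightarrow>
      Re (\<Sum>k\<in>F. \<Sum>l\<in>F. of_real (wt k powr (2 * s)) * cnj (v k) * a k (k - l) * v l) \<le> C * wsq s F v)"
    using garding by blast
  from choice[OF this] obtain G where G: "\<forall>s. G s \<ge> 0 \<and> (\<forall>F v. finite F \<longrightarrow>
      Re (\<Sum>k\<in>F. \<Sum>l\<in>F. of_real (wt k powr (2 * s)) * cnj (v k) * a k (k - l) * v l) \<le> G s * wsq s F v)"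
    by blast
  have "parabolic_matrix (\<lambda>k l. a k (k - l)) m D G T"
    by unfold_locales (use assms m_pos D G in blast)+
  then show ?thesis by blast
qed

section \<open>The matrix of \<open>Op\<close> on rapidly decreasing functions\<close>

lemma rapidly_decreasing_summable:
  fixes f :: "int^'n::finite \<Rightarrow> complex"
  assumes "rapidly_decreasing f"
  shows "(\<lambda>l. cmod (f l)) summable_on UNIV"
proof -
  obtain C where C: "\<And>k. wt k ^ (2 * CARD('n)) * cmod (f k) \<le> C"
    using assms unfolding rapidly_decreasing_def wt_def by meson
  have C0: "C \<ge> 0"
    by (rule order_trans[OF _ C[of 0]]) simp
  have le: "cmod (f k) \<le> C * wt k powr (- summ_exp TYPE('n))" for k
  proof -
    have "wt k powr (summ_exp TYPE('n)) = wt k ^ (2 * CARD('n))"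
      using powr_realpow[of "wt k" "2 * CARD('n)"] by (simp add: summ_exp_def)
    then show ?thesis
      using C[of k] by (simp add: powr_minus field_simps)
  qed
  have "(\<Sum>k\<in>F. cmod (f k)) \<le> C * wt_sum TYPE('n)" if "finite F" for F
  proof -
    have "(\<Sum>k\<in>F. cmod (f k)) \<le> (\<Sum>k\<in>F. C * wt k powr (- summ_exp TYPE('n)))"
      by (intro sum_mono le)
    also have "\<dots> \<le> C * wt_sum TYPE('n)"
      unfolding sum_distrib_left[symmetric] by (intro mult_left_mono wt_sum_le that C0)
    finally show ?thesis .
  qed
  then show ?thesis
    by (intro nonneg_bdd_above_summable_on bdd_aboveI) auto
qed

lemma fourier_eq: "fourier f x = (\<Sum>\<^sub>\<infinity>l. torus_char (- l) x * f l)"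
  unfolding fourier_def torus_char_def by (simp add: real_vec_simps)

lemma fourier_continuous:
  assumes "rapidly_decreasing f"
  shows "continuous_on UNIV (fourier f)"
proof -
  have "uniform_limit UNIV (\<lambda>G x. \<Sum>l\<in>G. torus_char (- l) x * f l) (\<lambda>x. \<Sum>\<^sub>\<infinity>l. torus_char (- l) x * f l) (finite_subsets_at_top UNIV)"
    by (rule Weierstrass_m_test_general[OF _ rapidly_decreasing_summable[OF assms]]) (simp add: norm_mult)
  then have "continuous_on UNIV (\<lambda>x. \<Sum>\<^sub>\<infinity>l. torus_char (- l) x * f l)"
    by (rule uniform_limit_theorem[rotated]) (auto intro!: always_eventually continuous_intros continuous_torus_char)
  then show ?thesis
    by (simp add: fourier_eq[abs_def])
qed

text \<open>The Fourier series of \<open>f\<close> converges uniformly and may be integrated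
  termwise against \<open>torus_char k x * \<sigma> k x\<close>. The conclusion is a limit over
  finite sets, to match \<open>op_tendsto\<close>.\<close>

lemma Op_eq_matrix:
  fixes \<sigma> :: "int^'n::finite \<Rightarrow> real^'n \<Rightarrow> complex"
  assumes \<sigma>: "continuous_on UNIV (\<sigma> k)" and f: "rapidly_decreasing f"
  shows "((\<lambda>G. \<Sum>l\<in>G. torus_coeff (\<sigma> k) (k - l) * f l) \<longlongrightarrow> Op \<sigma> f k) (finite_subsets_at_top UNIV)"
proof -
  define c where "c = (\<lambda>x. torus_char k x * \<sigma> k x)"
  have c: "continuous_on UNIV c"
    unfolding c_def by (intro continuous_intros continuous_torus_char \<sigma>)
  obtain B where B: "B > 0" "\<And>x. x \<in> cbox 0 1 \<Longrightarrow> cmod (c x) \<le> B"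
  proof -
    have "bounded (c ` cbox 0 1)"
      by (intro compact_imp_bounded compact_continuous_image continuous_on_subset[OF c]) auto
    then show ?thesis
      using that unfolding bounded_pos by blast
  qed
  have "uniform_limit (cbox 0 1) (\<lambda>G x. \<Sum>l\<in>G. c x * (torus_char (- l) x * f l))
      (\<lambda>x. \<Sum>\<^sub>\<infinity>l. c x * (torus_char (- l) x * f l)) (finite_subsets_at_top UNIV)"
  proof (rule Weierstrass_m_test_general)
    show "(\<lambda>l. B * cmod (f l)) summable_on UNIV"
      by (intro summable_on_cmult_right rapidly_decreasing_summable f)
  qed (auto simp: norm_mult intro!: mult_right_mono B)
  then obtain I J where I:
    "\<And>G. ((\<lambda>x. \<Sum>l\<in>G. c x * (torus_char (- l) x * f l)) has_integral I G) (cbox 0 1)"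
    "((\<lambda>x. \<Sum>\<^sub>\<infinity>l. c x * (torus_char (- l) x * f l)) has_integral J) (cbox 0 1)"
    "(I \<longlongrightarrow> J) (finite_subsets_at_top UNIV)"
    by (rule uniform_limit_integral_cbox)
      (auto intro!: continuous_intros continuous_torus_char continuous_on_subset[OF c])
  have IG: "I G = (\<Sum>l\<in>G. torus_coeff (\<sigma> k) (k - l) * f l)" if G: "finite G" for G
  proof -
    have cont: "continuous_on UNIV (\<lambda>x. torus_char j x * \<sigma> k x)" for j
      by (intro continuous_intros continuous_torus_char \<sigma>)
    have "((\<lambda>x. \<Sum>l\<in>G. torus_char (k - l) x * \<sigma> k x * f l) has_integral (\<Sum>l\<in>G. torus_coeff (\<sigma> k) (k - l) * f l)) (cbox 0 1)"
      unfolding torus_coeff_def torus_integral_eq(1)[OF cont]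
      by (intro has_integral_sum G has_integral_mult_left integrable_integral torus_integral_eq(2)[OF cont])
    moreover have "torus_char (k - l) x * \<sigma> k x * f l = c x * (torus_char (- l) x * f l)" for l x
      using torus_char_add[of k "- l" x] by (simp add: c_def mult_ac)
    ultimately have "((\<lambda>x. \<Sum>l\<in>G. c x * (torus_char (- l) x * f l)) has_integral (\<Sum>l\<in>G. torus_coeff (\<sigma> k) (k - l) * f l)) (cbox 0 1)"
      by (simp only:)
    then show ?thesis
      by (rule has_integral_unique[OF I(1)])
  qed
  have J: "J = Op \<sigma> f k"
  proof -
    have eq: "(\<lambda>x. \<Sum>\<^sub>\<infinity>l. c x * (torus_char (- l) x * f l)) = (\<lambda>x. c x * fourier f x)"
      by (simp add: fourier_eq[abs_def] infsum_cmult_right')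
    have cont: "continuous_on UNIV (\<lambda>x. c x * fourier f x)"
      by (intro continuous_intros c fourier_continuous f)
    have "Op \<sigma> f k = torus_integral (\<lambda>x. c x * fourier f x)"
      unfolding Op_def c_def torus_char_def ..
    then show ?thesis
      using I(2) unfolding eq torus_integral_eq(1)[OF cont] by (simp add: integral_unique)
  qed
  have "\<forall>\<^sub>F G in finite_subsets_at_top UNIV. I G = (\<Sum>l\<in>G. torus_coeff (\<sigma> k) (k - l) * f l)"
    by (rule eventually_finite_subsets_at_top_weakI) (rule IG)
  from Lim_transform_eventually[OF I(3) this] show ?thesis
    by (simp only: J)
qed

section \<open>Uniqueness of the bounded extension\<close>

lemma bounded_extension_coord_le:
  assumes "bounded_extension m P A"
  shows "\<exists>B. \<forall>u k. cmod (A u k) \<le> wt k powr m * B * norm u"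
proof -
  obtain B where B: "\<And>u. A u \<in> weighted_ell2 (- m)" "\<And>u. weighted_norm (- m) (A u) \<le> B * norm u"
    using assms unfolding bounded_extension_def by blast
  have "cmod (A u k) \<le> wt k powr m * B * norm u" for u k
  proof -
    have "wt k powr (- m) * cmod (A u k) = cmod (ell2_apply (weight_iso (- m) (A u)) k)"
      by (simp add: weight_iso(1)[OF B(1)] norm_mult wt_def)
    also have "\<dots> \<le> weighted_norm (- m) (A u)"
      using ell2_apply_norm_le weight_iso(2)[OF B(1)] by metis
    also have "\<dots> \<le> B * norm u" by (rule B(2))
    finally have "wt k powr m * (wt k powr (- m) * cmod (A u k)) \<le> wt k powr m * (B * norm u)"
      by (intro mult_left_mono) auto
    moreover have "wt k powr m * wt k powr (- m) = 1"
      by (simp flip: powr_add)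
    ultimately show ?thesis
      by (simp add: mult.assoc[symmetric])
  qed
  then show ?thesis by blast
qed

lemma rapidly_decreasing_trunc: "rapidly_decreasing (ell2_apply (trunc F u))" if "finite F" for F :: "(int^'n::finite) set"
  unfolding rapidly_decreasing_def
proof
  fix N :: nat
  show "\<exists>C. \<forall>k. (1 + norm (real_vec k)) ^ N * cmod (ell2_apply (trunc F u) k) \<le> C"
  proof (intro exI allI)
    fix k
    show "(1 + norm (real_vec k)) ^ N * cmod (ell2_apply (trunc F u) k)
        \<le> (\<Sum>k\<in>F. (1 + norm (real_vec k)) ^ N * cmod (ell2_apply (trunc F u) k))"
    proof (cases "k \<in> F")
      case True
      then show ?thesis
        using that by (intro member_le_sum) auto
    next
      case False
      then show ?thesis
        using that by (simp add: ell2_apply_trunc sum_nonneg)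
    qed
  qed
qed

text \<open>Truncations are rapidly decreasing, so both extensions agree on them. Their difference
  at \<open>u\<close> is their difference at a tail of \<open>u\<close>, which tends to zero in each
  coordinate.\<close>

lemma bounded_extension_unique:
  fixes A A' :: "(int^'n::finite) ell2 \<Rightarrow> int^'n \<Rightarrow> complex"
  assumes A: "bounded_extension m P A" and A': "bounded_extension m P A'"
  shows "A = A'"
proof (intro ext)
  fix u k
  obtain B where B: "\<And>u k. cmod (A u k) \<le> wt k powr m * B * norm u"
    using bounded_extension_coord_le[OF A] by blast
  obtain B' where B': "\<And>u k. cmod (A' u k) \<le> wt k powr m * B' * norm u"
    using bounded_extension_coord_le[OF A'] by blast
  have split: "Z u k = Z (u - trunc (cube N) u) k + P (ell2_apply (trunc (cube N) u)) k"
    if Z: "bounded_extension m P Z" for Z N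
  proof -
    have "\<forall>k. ell2_apply u k = 1 * ell2_apply (u - trunc (cube N) u) k + 1 * ell2_apply (trunc (cube N) u) k"
      by simp
    then have "\<forall>k. Z u k = 1 * Z (u - trunc (cube N) u) k + 1 * Z (trunc (cube N) u) k"
      using Z unfolding bounded_extension_def by blast
    moreover have "Z (trunc (cube N) u) = P (ell2_apply (trunc (cube N) u))"
      using Z rapidly_decreasing_trunc[OF finite_cube] unfolding bounded_extension_def by blast
    ultimately show ?thesis by simp
  qed
  have le: "cmod (A u k - A' u k) \<le> wt k powr m * (B + B') * norm (u - trunc (cube N) u)" for N
  proof -
    have "cmod (A u k - A' u k) = cmod (A (u - trunc (cube N) u) k - A' (u - trunc (cube N) u) k)"
      using split[OF A, of N] split[OF A', of N] by simp
    also have "\<dots> \<le> cmod (A (u - trunc (cube N) u) k) + cmod (A' (u - trunc (cube N) u) k)"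
      by (rule norm_triangle_ineq4)
    also have "\<dots> \<le> wt k powr m * (B + B') * norm (u - trunc (cube N) u)"
      using add_mono[OF B[of "u - trunc (cube N) u" k] B'[of "u - trunc (cube N) u" k]]
      by (simp add: algebra_simps)
    finally show ?thesis .
  qed
  have "(\<lambda>N. wt k powr m * (B + B') * norm (u - trunc (cube N) u)) \<longlonglongrightarrow> wt k powr m * (B + B') * 0"
    by (intro tendsto_intros trunc_tendsto)
  then have "cmod (A u k - A' u k) \<le> wt k powr m * (B + B') * 0"
    by (rule LIMSEQ_le_const) (use le in blast)
  then show "A u k = A' u k" by simp
qed

section \<open>The evolution equation in coordinates\<close>

lemma wt_powr_sq: "(wt k powr s)\<^sup>2 = wt k powr (2 * s)"
  by (simp add: power2_eq_square flip: powr_add)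

context parabolic_matrix
begin

lemma op_at_weighted:
  "op_at u \<in> weighted_ell2 (- m)"
  "\<exists>B\<ge>0. \<forall>u. weighted_norm (- m) (op_at u) \<le> B * norm u"
proof -
  define B where "B = op_const 0"
  note B = op_const_nonneg[of 0, folded B_def] op_norm_bound[folded B_def]
  have summ: "(\<lambda>k. wt k powr (2 * (- m)) * (cmod (op_at u k))\<^sup>2) summable_on UNIV" for u
    by (rule nonneg_bdd_above_summable_on) (use B(2)[of _ u] in \<open>auto intro!: bdd_aboveI[of _ "B\<^sup>2 * (norm u)\<^sup>2"]\<close>)
  then show "op_at u \<in> weighted_ell2 (- m)"
    by (simp add: weighted_ell2_def wt_def)
  have "weighted_norm (- m) (op_at u) \<le> B * norm u" for u
  proof -
    have "(\<Sum>\<^sub>\<infinity>k. wt k powr (2 * (- m)) * (cmod (op_at u k))\<^sup>2) \<le> (B * norm u)\<^sup>2"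
      unfolding power_mult_distrib by (intro infsum_le_finite_sums summ B(2))
    then show ?thesis
      unfolding weighted_norm_def wt_def[symmetric] using B(1) by (simp add: real_le_lsqrt)
  qed
  then show "\<exists>B\<ge>0. \<forall>u. weighted_norm (- m) (op_at u) \<le> B * norm u"
    using B(1) by blast
qed

lemma op_at_lin:
  assumes "\<And>k. ell2_apply w k = a * ell2_apply u k + b * ell2_apply v k"
  shows "op_at w k = a * op_at u k + b * op_at v k"
proof -
  note summ = abs_summable_summable[OF op_summable]
  have "op_at w k = (\<Sum>\<^sub>\<infinity>l. a * (K k l * ell2_apply u l) + b * (K k l * ell2_apply v l))"
    unfolding op_at_def assms by (intro infsum_cong) (simp add: algebra_simps)
  also have "\<dots> = (\<Sum>\<^sub>\<infinity>l. a * (K k l * ell2_apply u l)) + (\<Sum>\<^sub>\<infinity>l. b * (K k l * ell2_apply v l))"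
    by (intro infsum_add summable_on_cmult_right summ)
  finally show ?thesis
    by (simp add: op_at_def infsum_cmult_right')
qed

lemma ell2_weighted: "ell2_apply u \<in> weighted_ell2 (- m)" for u :: "(int^'n) ell2"
proof -
  have "(\<lambda>k. wt k powr (2 * (- m)) * (cmod (ell2_apply u k))\<^sup>2) summable_on UNIV"
  proof (rule summable_on_comparison_test[OF ell2_summable[of u]])
    fix k :: "int^'n"
    have "wt k powr (2 * (- m)) \<le> wt k powr 0"
      using m_pos by (intro wt_powr_mono) auto
    then show "wt k powr (2 * (- m)) * (cmod (ell2_apply u k))\<^sup>2 \<le> (cmod (ell2_apply u k))\<^sup>2"
      by (simp add: mult_left_le_one_le)
  qed simp
  then show ?thesis
    by (simp add: weighted_ell2_def wt_def)
qed

text \<open>The right-hand side carried over to \<open>ell2\<close>, where the Bochner integral is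
  taken. The two summands are kept apart because one is continuous in time and the other only
  integrable.\<close>

definition rhs :: "(int^'n) ell2 \<Rightarrow> (int^'n) ell2 \<Rightarrow> (int^'n) ell2" where
  "rhs u f = weight_iso (- m) (op_at u) + weight_iso (- m) (ell2_apply f)"

lemma rhs_apply: "ell2_apply (rhs u f) k = of_real (wt k powr (- m)) * (op_at u k + ell2_apply f k)"
  unfolding rhs_def
  by (simp add: weight_iso(1)[OF op_at_weighted(1)] weight_iso(1)[OF ell2_weighted] wt_def distrib_left)

lemma weighted_sum:
  "(\<lambda>k. op_at u k + ell2_apply f k) \<in> weighted_ell2 (- m)"
  "weight_iso (- m) (\<lambda>k. op_at u k + ell2_apply f k) = rhs u f"
proof -
  have "(cmod (ell2_apply (rhs u f) k))\<^sup>2 = wt k powr (2 * (- m)) * (cmod (op_at u k + ell2_apply f k))\<^sup>2" for k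
    unfolding rhs_apply norm_mult power_mult_distrib by (simp add: wt_powr_sq)
  then show mem: "(\<lambda>k. op_at u k + ell2_apply f k) \<in> weighted_ell2 (- m)"
    using ell2_summable[of "rhs u f"] by (simp add: weighted_ell2_def wt_def)
  show "weight_iso (- m) (\<lambda>k. op_at u k + ell2_apply f k) = rhs u f"
    by (rule ell2_eqI) (simp add: weight_iso(1)[OF mem] rhs_apply wt_def)
qed

lemma bounded_linear_weight_op: "bounded_linear (\<lambda>u. weight_iso (- m) (op_at u))"
proof -
  obtain B where B: "B \<ge> 0" "\<And>u. weighted_norm (- m) (op_at u) \<le> B * norm u"
    using op_at_weighted(2) by blast
  show ?thesis
  proof (rule bounded_linear_intro[of _ B])
    show "weight_iso (- m) (op_at (u + v)) = weight_iso (- m) (op_at u) + weight_iso (- m) (op_at v)" for u v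
      using op_at_lin[of "u + v" 1 u 1 v]
      by (intro ell2_eqI) (simp add: weight_iso(1)[OF op_at_weighted(1)] distrib_left)
    show "weight_iso (- m) (op_at (r *\<^sub>R u)) = r *\<^sub>R weight_iso (- m) (op_at u)" for r u
      using op_at_lin[of "r *\<^sub>R u" "of_real r" u 0 u]
      by (intro ell2_eqI) (simp add: weight_iso(1)[OF op_at_weighted(1)] scaleR_conv_of_real)
    show "norm (weight_iso (- m) (op_at u)) \<le> norm u * B" for u
      using B(2)[of u] by (simp add: weight_iso(2)[OF op_at_weighted(1)] mult.commute)
  qed
qed

lemma bounded_linear_weight_ell2: "bounded_linear (\<lambda>f. weight_iso (- m) (ell2_apply f) :: (int^'n) ell2)"
proof (rule bounded_linear_intro[of _ 1])
  show "weight_iso (- m) (ell2_apply (u + v)) = weight_iso (- m) (ell2_apply u) + weight_iso (- m) (ell2_apply v)" for u v :: "(int^'n) ell2"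
    by (intro ell2_eqI) (simp add: weight_iso(1)[OF ell2_weighted] distrib_left)
  show "weight_iso (- m) (ell2_apply (r *\<^sub>R u)) = r *\<^sub>R weight_iso (- m) (ell2_apply u)" for r and u :: "(int^'n) ell2"
    by (intro ell2_eqI) (simp add: weight_iso(1)[OF ell2_weighted] scaleR_conv_of_real)
  fix u :: "(int^'n) ell2"
  show "norm (weight_iso (- m) (ell2_apply u)) \<le> norm u * 1"
  proof (rule norm_ell2_leI)
    fix F :: "(int^'n) set" assume F: "finite F"
    have "nsq F (\<lambda>k. ell2_apply (weight_iso (- m) (ell2_apply u)) k) \<le> nsq F (ell2_apply u)"
    proof (intro sum_mono power_mono)
      fix k :: "int^'n"
      have "wt k powr (- m) \<le> wt k powr 0"
        using m_pos by (intro wt_powr_mono) auto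
      then show "cmod (ell2_apply (weight_iso (- m) (ell2_apply u)) k) \<le> cmod (ell2_apply u k)"
        by (simp add: weight_iso(1)[OF ell2_weighted] norm_mult mult_left_le_one_le flip: wt_def)
    qed auto
    also have "\<dots> \<le> (norm u * 1)\<^sup>2"
      using ell2_finite_sum_le[OF F] by simp
    finally show "nsq F (\<lambda>k. ell2_apply (weight_iso (- m) (ell2_apply u)) k) \<le> (norm u * 1)\<^sup>2" .
  qed simp
qed

lemma rhs_integrable:
  fixes u f :: "real \<Rightarrow> (int^'n) ell2"
  assumes u: "continuous_on {0..T} u" and f: "L1 f" and t: "t \<in> {0..T}"
  shows "set_integrable lebesgue {0..t} (\<lambda>s. rhs (u s) (f s))"
proof -
  have "set_integrable lebesgue {0..t} (\<lambda>s. weight_iso (- m) (op_at (u s)))"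
  proof -
    have "continuous_on {0..t} (\<lambda>s. weight_iso (- m) (op_at (u s)))"
      by (intro bounded_linear.continuous_on[OF bounded_linear_weight_op] continuous_on_subset[OF u]) (use t in simp)
    then have "set_integrable lborel {0..t} (\<lambda>s. weight_iso (- m) (op_at (u s)))"
      by (rule borel_integrable_atLeastAtMost')
    then show ?thesis
      unfolding set_integrable_def by (simp add: integrable_completion)
  qed
  moreover have "set_integrable lebesgue {0..t} (\<lambda>s. weight_iso (- m) (ell2_apply (f s)))"
    by (intro set_integrable_bounded_linear[OF bounded_linear_weight_ell2] set_integrable_subset[OF f]) (use t in simp_all)
  ultimately show ?thesis
    unfolding rhs_def by (rule set_integral_add(1))
qed

text \<open>Evaluation at \<open>k\<close> with the weight undone is a bounded functional, so it
  commutes with the Bochner integral.\<close>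

lemma weighted_integral_coord:
  fixes u f :: "real \<Rightarrow> (int^'n) ell2"
  assumes u: "continuous_on {0..T} u" and f: "L1 f" and t: "t \<in> {0..T}"
  shows "weighted_integral (- m) {0..t} (\<lambda>s k. op_at (u s) k + ell2_apply (f s) k) k
    = integral {0..t} (\<lambda>s. op_at (u s) k + ell2_apply (f s) k)"
proof -
  define L where "L = (\<lambda>w. of_real (wt k powr m) * ell2_apply w k :: complex)"
  have L: "bounded_linear L"
    unfolding L_def by (intro bounded_linear_const_mult bounded_linear_ell2_apply)
  have Lrhs: "L (rhs w g) = op_at w k + ell2_apply g k" for w g
  proof -
    have "L (rhs w g) = of_real (wt k powr m * wt k powr (- m)) * (op_at w k + ell2_apply g k)"
      by (simp add: L_def rhs_apply)
    also have "wt k powr m * wt k powr (- m) = 1"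
      by (simp flip: powr_add)
    finally show ?thesis by simp
  qed
  have int: "set_integrable lebesgue {0..t} (\<lambda>s. rhs (u s) (f s))"
    by (rule rhs_integrable[OF u f t])
  have "weighted_integral (- m) {0..t} (\<lambda>s k. op_at (u s) k + ell2_apply (f s) k) k
      = L (LINT s:{0..t}|lebesgue. rhs (u s) (f s))"
    by (simp add: weighted_integral_def weighted_sum(2) weight_iso_inv_def L_def wt_def)
  also have "\<dots> = (LINT s:{0..t}|lebesgue. L (rhs (u s) (f s)))"
    unfolding set_lebesgue_integral_def
    using integral_bounded_linear[OF L int[unfolded set_integrable_def]]
    by (simp add: linear_scale[OF bounded_linear.linear[OF L]])
  also have "\<dots> = integral {0..t} (\<lambda>s. L (rhs (u s) (f s)))"
    by (rule set_lebesgue_integral_eq_integral(2)[OF set_integrable_bounded_linear[OF L int]])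
  finally show ?thesis
    by (simp add: Lrhs)
qed

lemma is_solution_iff_coord_solution:
  assumes f: "L1 f"
  shows "is_solution m op_at T u0 f u \<longleftrightarrow> coord_solution u0 f u"
proof (cases "continuous_on {0..T} u")
  case True
  have "weighted_integrable (- m) {0..t} (\<lambda>s k. op_at (u s) k + ell2_apply (f s) k)" if "t \<in> {0..T}" for t
    unfolding weighted_integrable_def using rhs_integrable[OF True f that] weighted_sum by simp
  then show ?thesis
    unfolding is_solution_def coord_solution_def
    using True weighted_integral_coord[OF True f] by simp
next
  case False
  then show ?thesis
    by (simp add: is_solution_def coord_solution_def)
qed

end

text \<open>The matrix operator satisfies the description that defines \<open>Op_ext\<close>, and
  uniqueness of the extension makes the description definite.\<close>

lemma Op_ext_eq:
  fixes \<sigma> :: "int^'n::finite \<Rightarrow> real^'n \<Rightarrow> complex"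
  assumes par: "parabolic_matrix (\<lambda>k l. torus_coeff (\<sigma> k) (k - l)) m D G T"
    and \<sigma>: "\<And>k. continuous_on UNIV (\<sigma> k)"
  shows "Op_ext m \<sigma> = parabolic_matrix.op_at (\<lambda>k l. torus_coeff (\<sigma> k) (k - l))"
proof -
  interpret parabolic_matrix "\<lambda>k l. torus_coeff (\<sigma> k) (k - l)" m D G T by (rule par)
  have ext: "bounded_extension m (Op \<sigma>) op_at"
    unfolding bounded_extension_def
  proof (intro conjI allI impI)
    show "op_at w k = a * op_at u k + b * op_at v k"
      if "\<forall>k. ell2_apply w k = a * ell2_apply u k + b * ell2_apply v k" for u v w a b k
      using that by (intro op_at_lin) simp
    show "\<exists>B. \<forall>u. op_at u \<in> weighted_ell2 (- m) \<and> weighted_norm (- m) (op_at u) \<le> B * norm u"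
      using op_at_weighted by blast
    show "op_at u = Op \<sigma> (ell2_apply u)" if "rapidly_decreasing (ell2_apply u)" for u
      by (intro ext tendsto_unique[OF _ op_tendsto Op_eq_matrix[OF \<sigma> that]]) simp
  qed
  show ?thesis
    unfolding Op_ext_def using ext bounded_extension_unique[OF _ ext] by (rule the_equality)
qed

text \<open>An infinite integral makes the bound trivial; a finite one coincides with the gauge
  integral of the real-valued estimate.\<close>

lemma energy_bound_ennreal:
  fixes f :: "real \<Rightarrow> 'a::{banach,second_countable_topology}"
  assumes f: "set_integrable lebesgue {0..T} f" and t: "t \<in> {0..T}" and E: "E > 0" and a: "a \<ge> 0" and b: "b \<ge> 0"
    and le: "(\<lambda>s. (norm (f s))\<^sup>2) integrable_on {0..t} \<Longrightarrow> b \<le> E * (a + integral {0..t} (\<lambda>s. (norm (f s))\<^sup>2))"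
  shows "ennreal b \<le> ennreal E * (ennreal a + (\<integral>\<^sup>+\<tau>\<in>{0..t}. ennreal ((norm (f \<tau>))\<^sup>2) \<partial>lebesgue))"
proof (cases "(\<integral>\<^sup>+\<tau>\<in>{0..t}. ennreal ((norm (f \<tau>))\<^sup>2) \<partial>lebesgue) = \<infinity>")
  case True
  then show ?thesis
    using E by (simp add: ennreal_mult_top)
next
  case False
  define h where "h = (\<lambda>s. indicator {0..t} s *\<^sub>R (norm (f s))\<^sup>2)"
  have nn: "(\<integral>\<^sup>+\<tau>\<in>{0..t}. ennreal ((norm (f \<tau>))\<^sup>2) \<partial>lebesgue) = (\<integral>\<^sup>+\<tau>. ennreal (h \<tau>) \<partial>lebesgue)"
    unfolding h_def by (intro nn_integral_cong) (simp split: split_indicator)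
  \<comment> \<open>Measurability is known only for \<open>f\<close> cut off to
    \<open>{0..T}\<close>, so \<open>h\<close> is rewritten through that cut-off.\<close>
  have h_eq: "h = (\<lambda>s. indicator {0..t} s *\<^sub>R (norm (indicator {0..T} s *\<^sub>R f s))\<^sup>2)"
    using t by (auto simp: h_def fun_eq_iff split: split_indicator)
  have meas: "(\<lambda>s. indicator {0..T} s *\<^sub>R f s) \<in> borel_measurable lebesgue"
    using f unfolding set_integrable_def by (rule borel_measurable_integrable)
  have "h \<in> borel_measurable lebesgue"
    unfolding h_eq
    by (intro borel_measurable_scaleR borel_measurable_indicator borel_measurable_power measurable_compose[OF meas borel_measurable_norm]) auto
  then have "integrable lebesgue h"
    using False unfolding nn by (intro integrableI_nonneg) (auto simp: h_def less_top)
  then have hi: "set_integrable lebesgue {0..t} (\<lambda>s. (norm (f s))\<^sup>2)"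
    by (simp add: set_integrable_def h_def)
  have "(\<integral>\<^sup>+\<tau>. ennreal (h \<tau>) \<partial>lebesgue) = ennreal (integral\<^sup>L lebesgue h)"
    by (rule nn_integral_eq_integral[OF \<open>integrable lebesgue h\<close>]) (simp add: h_def)
  also have "integral\<^sup>L lebesgue h = integral {0..t} (\<lambda>s. (norm (f s))\<^sup>2)"
    using set_lebesgue_integral_eq_integral(2)[OF hi] by (simp add: set_lebesgue_integral_def h_def)
  finally have eq: "(\<integral>\<^sup>+\<tau>\<in>{0..t}. ennreal ((norm (f \<tau>))\<^sup>2) \<partial>lebesgue) = ennreal (integral {0..t} (\<lambda>s. (norm (f s))\<^sup>2))"
    using nn by simp
  have "0 \<le> integral {0..t} (\<lambda>s. (norm (f s))\<^sup>2)"
    using set_lebesgue_integral_eq_integral(1)[OF hi] by (rule integral_nonneg) simp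
  then show ?thesis
    unfolding eq using le[OF set_lebesgue_integral_eq_integral(1)[OF hi]] a E
    by (simp add: ennreal_leI flip: ennreal_plus ennreal_mult)
qed

theorem theorem5p11:
  fixes \<sigma> :: "int^'n::finite \<Rightarrow> real^'n \<Rightarrow> complex" and m T :: real
  assumes "m > 0"
    and "\<sigma> \<in> symbol_class m"
    and "\<exists>C0>0. \<exists>d0>0. \<forall>k x. norm (real_vec k) \<ge> d0 \<longrightarrow>
           \<sigma> k x \<in> \<real> \<and> - Re (\<sigma> k x) \<ge> C0 * norm (real_vec k) powr m"
    and "T > 0"
  shows "(\<forall>(u0 :: (int^'n) ell2) f. set_integrable lebesgue {0..T} f \<longrightarrow>
           (\<exists>u. is_solution m (Op_ext m \<sigma>) T u0 f u \<and>
             (\<forall>v. is_solution m (Op_ext m \<sigma>) T u0 f v \<longrightarrow> (\<forall>t\<in>{0..T}. v t = u t)))) \<and>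
         (\<exists>C>0. \<forall>(u0 :: (int^'n) ell2) f u.
           set_integrable lebesgue {0..T} f \<longrightarrow> is_solution m (Op_ext m \<sigma>) T u0 f u \<longrightarrow>
           (\<forall>t\<in>{0..T}. ennreal ((norm (u t))\<^sup>2) \<le>
             ennreal C * (ennreal ((norm u0)\<^sup>2) +
               (\<integral>\<^sup>+\<tau>\<in>{0..t}. ennreal ((norm (f \<tau>))\<^sup>2) \<partial>lebesgue))))"
proof -
  interpret symbol_coeffs "\<lambda>k. torus_coeff (\<sigma> k)" m
    by (rule symbol_coeffs_of_symbol_class[OF assms(1-3)])
  obtain D G where par: "parabolic_matrix (\<lambda>k l. torus_coeff (\<sigma> k) (k - l)) m D G T"
    using parabolic[OF assms(4)] by blast
  interpret P: parabolic_matrix "\<lambda>k l. torus_coeff (\<sigma> k) (k - l)" m D G T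
    by (rule par)
  have ext: "Op_ext m \<sigma> = P.op_at"
    by (rule Op_ext_eq[OF par C_infinity_continuous[OF symbol_classD(2)[OF assms(2)]]])
  \<comment> \<open>Built from \<open>T\<close> and the Garding constant of order 0 alone, hence
    fixed before the data.\<close>
  define E where "E = exp ((2 * G 0 + 1) * T)"
  have E: "E > 0" by (simp add: E_def)
  show ?thesis
    unfolding ext
  proof (intro conjI exI[of _ E] allI impI ballI E)
    fix u0 :: "(int^'n) ell2" and f :: "real \<Rightarrow> (int^'n) ell2"
    assume f: "set_integrable lebesgue {0..T} f"
    obtain u where u: "P.coord_solution u0 f u"
      using P.coord_solution_exists[OF f] by blast
    show "\<exists>u. is_solution m P.op_at T u0 f u \<and>
        (\<forall>v. is_solution m P.op_at T u0 f v \<longrightarrow> (\<forall>t\<in>{0..T}. v t = u t))"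
      unfolding P.is_solution_iff_coord_solution[OF f]
      using u P.coord_solution_unique[OF f _ u] by blast
  next
    fix u0 :: "(int^'n) ell2" and f u t
    assume f: "set_integrable lebesgue {0..T} f" and u: "is_solution m P.op_at T u0 f u" and t: "t \<in> {0..T}"
    show "ennreal ((norm (u t))\<^sup>2) \<le> ennreal E * (ennreal ((norm u0)\<^sup>2) +
               (\<integral>\<^sup>+\<tau>\<in>{0..t}. ennreal ((norm (f \<tau>))\<^sup>2) \<partial>lebesgue))"
      using P.coord_solution_estimate[OF f u[unfolded P.is_solution_iff_coord_solution[OF f]] t]
      by (intro energy_bound_ennreal[OF f t E]) (auto simp: E_def)
  qed
qed

end
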